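(* Let $\mathbf A_n$ and $\mathbf M_n$ be real symmetric $n\times n$ matrices with $\sup_n\|\mathbf A_n\|<\infty$ and $\sup_n\|\mathbf M_n\|<\infty$ (operator norms). Let $(\mathbf Y,\mathbf T,\mathbf X)$ be generated from the model in the context, and assume that the true parameters satisfy $(\tau_0,\boldsymbol\theta_0)\in[-B,B]\times[-M,M]^d$ for some $B,M>0$ and belong to the interior of this parameter space. Then the maximum pseudo-likelihood estimator $(\hat\tau_{\mathrm{MPL}},\hat{\boldsymbol\theta}_{\mathrm{MPL}})$ exists and satisfies $$\sqrt n\,\big((\hat\tau_{\mathrm{MPL}},\hat{\boldsymbol\theta}_{\mathrm{MPL}})-(\tau_0,\boldsymbol\theta_0)\big)=O_P(1).$$
   Context: Model. The dimension $d$ is fixed and $n\to\infty$. Covariates $\mathbf X_1,\dots,\mathbf X_n$ are i.i.d. from a distribution $\mathbb P_X$ on $[-1,1]^d$ whose covariance matrix $\boldsymbol\Sigma$ satisfies $C\ge\lambda_{\max}(\boldsymbol\Sigma)\ge\lambda_{\min}(\boldsymbol\Sigma)\ge c>0$ for some constants $c,C>0$; $\mathbf X$ is the $n\times d$ matrix with rows $\mathbf X_i^\top$. Given $\mathbf X=\mathbf x$, the treatments $\mathbf T\in\{\pm1\}^n$ have law $$\mathbb P(\mathbf T=\mathbf t|\mathbf x)\propto\exp\Big(\tfrac12\mathbf t^\top\mathbf M_n\mathbf t+\sum_{i=1}^nt_i\mathbf x_i^\top\boldsymbol\gamma_0\Big),\qquad\boldsymbol\gamma_0\in[-M,M]^d.$$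 Given $\mathbf T=\mathbf t$, $\mathbf X=\mathbf x$, the outcomes $\mathbf Y=(Y_1,\dots,Y_n)\in[-1,1]^n$ have law $$f(\mathbf y|\mathbf t,\mathbf x)\propto\exp\Big(\tfrac12\mathbf y^\top\mathbf A_n\mathbf y+\mathbf y^\top(\tau_0\mathbf t+\mathbf x\boldsymbol\theta_0)\Big)\prod_{i=1}^nd\mu(y_i),$$ where $\mu$ is a probability measure on $[-1,1]$ with at least two points in its support. The matrices $\mathbf A_n,\mathbf M_n$ are known. Estimator. Given $(\mathbf Y,\mathbf T,\mathbf X)$, the maximum pseudo-likelihood estimator is $$(\hat\tau_{\mathrm{MPL}},\hat{\boldsymbol\theta}_{\mathrm{MPL}})=\operatorname{argmax}_{\tau,\boldsymbol\theta}\prod_{i=1}^nf(Y_i|\mathbf Y_{-i},\mathbf T,\mathbf X),$$ as long as the maximizer is unique. Here $\mathbf Y_{-i}$ denotes all coordinates of $\mathbf Y$ other than the $i$-th, and $f(Y_i|\mathbf Y_{-i},\mathbf T,\mathbf X)$ is the conditional density (with respect to $\mu$) of the $i$-th outcome given the others, computed from the joint outcome law above with $(\tau_0,\boldsymbol\theta_0)$ replaced by $(\tau,\boldsymbol\theta)$. $Z_n=O_P(1)$ means that the sequence $Z_n$ is tight. *)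

theory Defs
  imports "HOL-Probability.Probability"
begin

text \<open>
  Vectors in \<open>\<real>\<^sup>n\<close> and \<open>n \<times> n\<close> matrices, with \<open>n\<close> growing, are functions on \<open>nat\<close> of which only
  the indices below \<open>n\<close> are used. The fixed dimension \<open>d\<close> is the index type \<open>'d\<close>.
\<close>

definition op_norm :: "nat \<Rightarrow> (nat \<Rightarrow> nat \<Rightarrow> real) \<Rightarrow> real" where
  "op_norm n A = Sup {L2_set (\<lambda>i. \<Sum>j<n. A i j * v j) {..<n} | v. L2_set v {..<n} \<le> 1}"

definition symmetric_matrix :: "nat \<Rightarrow> (nat \<Rightarrow> nat \<Rightarrow> real) \<Rightarrow> bool" where
  "symmetric_matrix n A \<longleftrightarrow> (\<forall>i<n. \<forall>j<n. A i j = A j i)"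

definition quad_form :: "nat \<Rightarrow> (nat \<Rightarrow> nat \<Rightarrow> real) \<Rightarrow> (nat \<Rightarrow> real) \<Rightarrow> real" where
  "quad_form n A v = (\<Sum>i<n. \<Sum>j<n. v i * A i j * v j)"

definition eigenvalues :: "real^'d^'d \<Rightarrow> real set" where
  "eigenvalues S = {l. \<exists>v. v \<noteq> 0 \<and> S *v v = l *\<^sub>R v}"

definition lambda_max :: "real^'d^'d \<Rightarrow> real" where
  "lambda_max S = Max (eigenvalues S)"

definition lambda_min :: "real^'d^'d \<Rightarrow> real" where
  "lambda_min S = Min (eigenvalues S)"

definition covariance_matrix :: "(real^'d) measure \<Rightarrow> real^'d^'d" where
  "covariance_matrix P = (\<chi> i j. \<integral>x. (x $ i - (\<integral>z. z $ i \<partial>P)) * (x $ j - (\<integral>z. z $ j \<partial>P)) \<partial>P)"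

definition measure_support :: "'a::topological_space measure \<Rightarrow> 'a set" where
  "measure_support P = {x. \<forall>U. open U \<longrightarrow> x \<in> U \<longrightarrow> measure P U > 0}"

text \<open>The probability density, with respect to \<open>\<nu>\<close>, proportional to \<open>w\<close>.\<close>

definition normalized :: "'a measure \<Rightarrow> ('a \<Rightarrow> real) \<Rightarrow> 'a \<Rightarrow> real" where
  "normalized \<nu> w z = w z / (\<integral>u. w u \<partial>\<nu>)"

definition treatment_base :: "nat \<Rightarrow> (nat \<Rightarrow> real) measure" where
  "treatment_base n = PiM {..<n} (\<lambda>_. count_space {-1, 1})"

definition outcome_base :: "nat \<Rightarrow> real measure \<Rightarrow> (nat \<Rightarrow> real) measure" where
  "outcome_base n \<mu> = PiM {..<n} (\<lambda>_. \<mu>)"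

definition treatment_density ::
  "nat \<Rightarrow> (nat \<Rightarrow> nat \<Rightarrow> real) \<Rightarrow> real^'d \<Rightarrow> (nat \<Rightarrow> real^'d) \<Rightarrow> (nat \<Rightarrow> real) \<Rightarrow> real" where
  "treatment_density n Q \<gamma> x =
     normalized (treatment_base n)
       (\<lambda>t. exp (quad_form n Q t / 2 + (\<Sum>i<n. t i * (x i \<bullet> \<gamma>))))"

definition outcome_density ::
  "nat \<Rightarrow> real measure \<Rightarrow> (nat \<Rightarrow> nat \<Rightarrow> real) \<Rightarrow> real \<times> (real^'d)
    \<Rightarrow> (nat \<Rightarrow> real^'d) \<Rightarrow> (nat \<Rightarrow> real) \<Rightarrow> (nat \<Rightarrow> real) \<Rightarrow> real" where
  "outcome_density n \<mu> A = (\<lambda>(\<tau>, \<theta>) x t.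
     normalized (outcome_base n \<mu>)
       (\<lambda>y. exp (quad_form n A y / 2 + (\<Sum>i<n. y i * (\<tau> * t i + x i \<bullet> \<theta>)))))"

text \<open>
  The joint law of \<open>(X, T, Y)\<close>: \<open>X\<close> is i.i.d. from \<open>P\<close>, and the two normalized factors are the
  conditional densities of \<open>T\<close> given \<open>X\<close> and of \<open>Y\<close> given \<open>(T, X)\<close>.
\<close>

definition model_law ::
  "nat \<Rightarrow> (real^'d) measure \<Rightarrow> (nat \<Rightarrow> nat \<Rightarrow> real) \<Rightarrow> real^'d \<Rightarrow> real measure
    \<Rightarrow> (nat \<Rightarrow> nat \<Rightarrow> real) \<Rightarrow> real \<times> (real^'d)
    \<Rightarrow> ((nat \<Rightarrow> real^'d) \<times> (nat \<Rightarrow> real) \<times> (nat \<Rightarrow> real)) measure" where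
  "model_law n P Q \<gamma> \<mu> A \<beta> =
     density (PiM {..<n} (\<lambda>_. P) \<Otimes>\<^sub>M treatment_base n \<Otimes>\<^sub>M outcome_base n \<mu>)
       (\<lambda>(x, t, y). ennreal (treatment_density n Q \<gamma> x t * outcome_density n \<mu> A \<beta> x t y))"

text \<open>The density (with respect to \<open>\<mu>\<close>) of the \<open>i\<close>-th outcome at \<open>y i\<close>, given all the others.\<close>

definition conditional_density ::
  "nat \<Rightarrow> real measure \<Rightarrow> (nat \<Rightarrow> nat \<Rightarrow> real) \<Rightarrow> real \<times> (real^'d)
    \<Rightarrow> (nat \<Rightarrow> real^'d) \<Rightarrow> (nat \<Rightarrow> real) \<Rightarrow> (nat \<Rightarrow> real) \<Rightarrow> nat \<Rightarrow> real" where
  "conditional_density n \<mu> A \<beta> x t y i =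
     normalized \<mu> (\<lambda>u. outcome_density n \<mu> A \<beta> x t (y(i := u))) (y i)"

definition pseudo_likelihood ::
  "nat \<Rightarrow> real measure \<Rightarrow> (nat \<Rightarrow> nat \<Rightarrow> real)
    \<Rightarrow> (nat \<Rightarrow> real^'d) \<times> (nat \<Rightarrow> real) \<times> (nat \<Rightarrow> real) \<Rightarrow> real \<times> (real^'d) \<Rightarrow> real" where
  "pseudo_likelihood n \<mu> A = (\<lambda>(x, t, y) \<beta>. \<Prod>i<n. conditional_density n \<mu> A \<beta> x t y i)"

definition MPL_exists ::
  "nat \<Rightarrow> real measure \<Rightarrow> (nat \<Rightarrow> nat \<Rightarrow> real) \<Rightarrow> (real \<times> (real^'d)) set
    \<Rightarrow> (nat \<Rightarrow> real^'d) \<times> (nat \<Rightarrow> real) \<times> (nat \<Rightarrow> real) \<Rightarrow> bool" where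
  "MPL_exists n \<mu> A \<Theta> \<omega> \<longleftrightarrow>
     (\<exists>!\<beta>. is_arg_max (pseudo_likelihood n \<mu> A \<omega>) (\<lambda>\<beta>. \<beta> \<in> \<Theta>) \<beta>)"

text \<open>The value \<open>0\<close> is a placeholder for data without a unique maximizer.\<close>

definition MPL_estimator ::
  "nat \<Rightarrow> real measure \<Rightarrow> (nat \<Rightarrow> nat \<Rightarrow> real) \<Rightarrow> (real \<times> (real^'d)) set
    \<Rightarrow> (nat \<Rightarrow> real^'d) \<times> (nat \<Rightarrow> real) \<times> (nat \<Rightarrow> real) \<Rightarrow> real \<times> (real^'d)" where
  "MPL_estimator n \<mu> A \<Theta> \<omega> =
     (if MPL_exists n \<mu> A \<Theta> \<omega>
      then THE \<beta>. is_arg_max (pseudo_likelihood n \<mu> A \<omega>) (\<lambda>\<beta>. \<beta> \<in> \<Theta>) \<beta> else 0)"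

definition cube :: "real \<Rightarrow> (real^'d) set" where
  "cube r = cbox (\<chi> i. - r) (\<chi> i. r)"

text \<open>
  \<open>Z\<^sub>n = O\<^sub>P(1)\<close>: the random elements \<open>Z n\<close>, each on its own probability space, have tight laws.
  The constant \<open>tight\<close> of the library covers only real-valued laws.
\<close>

definition bounded_in_probability ::
  "(nat \<Rightarrow> 'w measure) \<Rightarrow> (nat \<Rightarrow> 'w \<Rightarrow> 'a::topological_space) \<Rightarrow> bool" where
  "bounded_in_probability P Z \<longleftrightarrow>
     (\<forall>n. Z n \<in> borel_measurable (P n)) \<and>
     (\<forall>\<epsilon>>0. \<exists>K. compact K \<and> (\<forall>n. measure (P n) {\<omega> \<in> space (P n). Z n \<omega> \<notin> K} \<le> \<epsilon>))"

end

theory Submission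
  imports Defs
begin

text \<open>
  The logarithm of the pseudo-likelihood is a sum of one-parameter exponential family terms, so it
  is concave in \<open>\<beta> = (\<tau>, \<theta>)\<close>. A concave function that stays below its value at \<open>\<beta>\<^sub>0 = (\<tau>\<^sub>0, \<theta>\<^sub>0)\<close> on a
  sphere of radius \<open>r\<close> about \<open>\<beta>\<^sub>0\<close> has all its maximizers in the ball; it therefore suffices
  that, with high probability, the score at \<open>\<beta>\<^sub>0\<close> has norm at most \<open>k \<surd>n\<close> and the curvature along
  every direction is at least \<open>\<delta> n\<close> near \<open>\<beta>\<^sub>0\<close>. Then \<open>r = 2 k / (\<delta> \<surd>n)\<close> works (\<open>MPL_close\<close>),
  and \<open>k\<close> can be as large as the wanted probability demands.

  The score is a sum of terms \<open>c\<^sub>i (Y\<^sub>i - E[Y\<^sub>i | the rest])\<close> with \<open>|c\<^sub>i| \<le> 1\<close>. Each term is centred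
  given the other outcomes, so its product with the same sum in which \<open>Y\<^sub>i\<close> is replaced by \<open>0\<close> has
  mean zero. The second moment of the sum thus only sees how the sum reacts to a single coordinate;
  a second-order expansion bounds the total reaction by bilinear forms in the interaction matrix,
  hence by a multiple of \<open>n\<close> that depends on the operator norm alone
  (\<open>residual_sum_second_moment\<close>).

  For the curvature, the conditional variances are bounded below at all sites whose local field is
  bounded. Since the squared local fields sum to at most a multiple of \<open>n\<close>, the other sites are
  a small fraction (\<open>tilted_var_ge_weighted\<close>), and what remains is the second-moment matrix of the
  pairs \<open>(T\<^sub>i, X\<^sub>i)\<close>. Its covariate block is close to the population second moments, by independence.
  This matrix could then be degenerate only if the treatments were nearly a linear function of the
  covariates. But they are themselves a Gibbs sample, so the second moment bound for residual sums
  allows their cross terms with the covariates to be replaced by conditional means, and then the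
  conditional variances of the treatments contribute a positive amount (\<open>design_nondegenerate\<close>).

  That the estimator is a random variable, and that its existence is an event, follows from
  continuity of the pseudo-likelihood in the parameter: the set of samples with a maximizer in a
  given compact set is described by countably many inequalities
  (\<open>sets_maximizer_in_compact\<close>).
\<close>

section \<open>Operator norm bounds\<close>

definition mat_vec :: "nat \<Rightarrow> (nat \<Rightarrow> nat \<Rightarrow> real) \<Rightarrow> (nat \<Rightarrow> real) \<Rightarrow> nat \<Rightarrow> real" where
  "mat_vec n A v i = (\<Sum>j<n. A i j * v j)"

lemma op_norm_bdd:
  "bdd_above {L2_set (mat_vec n A v) {..<n} | v. L2_set v {..<n} \<le> 1}"
proof (rule bdd_aboveI)
  fix r assume "r \<in> {L2_set (mat_vec n A v) {..<n} | v. L2_set v {..<n} \<le> 1}"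
  then obtain v where r: "r = L2_set (mat_vec n A v) {..<n}" and v: "L2_set v {..<n} \<le> 1" by auto
  have vj: "\<bar>v j\<bar> \<le> 1" if "j < n" for j
    using member_le_L2_set[of "{..<n}" j "\<lambda>i. \<bar>v i\<bar>"] that v
    by (simp add: L2_set_def) (meson order_trans real_sqrt_le_1_iff)
  have "r \<le> (\<Sum>i<n. \<bar>mat_vec n A v i\<bar>)"
    unfolding r by (rule L2_set_le_sum_abs)
  also have "\<dots> \<le> (\<Sum>i<n. \<Sum>j<n. \<bar>A i j\<bar>)"
    unfolding mat_vec_def
  proof (intro sum_mono order_trans[OF sum_abs])
    fix i j assume "j \<in> {..<n}"
    then show "\<bar>A i j * v j\<bar> \<le> \<bar>A i j\<bar>"
      using vj[of j] by (simp add: abs_mult mult_left_le)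
  qed
  finally show "r \<le> (\<Sum>i<n. \<Sum>j<n. \<bar>A i j\<bar>)" .
qed

lemma op_norm_alt: "op_norm n A = Sup {L2_set (mat_vec n A v) {..<n} | v. L2_set v {..<n} \<le> 1}"
  unfolding op_norm_def mat_vec_def by simp

lemma op_norm_nonneg: "op_norm n A \<ge> 0"
proof -
  have "L2_set (mat_vec n A (\<lambda>_. 0)) {..<n} \<le> op_norm n A"
    unfolding op_norm_alt
    by (rule cSup_upper[OF _ op_norm_bdd]) (auto intro!: exI[of _ "\<lambda>_. 0"] simp: L2_set_def)
  then show ?thesis by (simp add: mat_vec_def L2_set_def)
qed

lemma L2_set_mat_vec_le: "L2_set (mat_vec n A v) {..<n} \<le> op_norm n A * L2_set v {..<n}"
proof (cases "L2_set v {..<n} = 0")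
  case True
  then have "\<And>j. j < n \<Longrightarrow> v j = 0" by (simp add: L2_set_eq_0_iff)
  then have "mat_vec n A v i = 0" for i by (simp add: mat_vec_def)
  then have "L2_set (mat_vec n A v) {..<n} = 0" by (simp add: L2_set_def)
  with True show ?thesis by simp
next
  case False
  define l where "l = L2_set v {..<n}"
  have l: "l > 0" using False by (simp add: l_def order.strict_iff_order)
  have w: "L2_set (\<lambda>j. (1/l) * v j) {..<n} = 1"
    using l by (subst L2_set_right_distrib[symmetric]) (auto simp: l_def)
  have "mat_vec n A (\<lambda>j. (1/l) * v j) = (\<lambda>i. (1/l) * mat_vec n A v i)"
    by (simp add: mat_vec_def sum_distrib_left fun_eq_iff algebra_simps)
  then have "L2_set (mat_vec n A (\<lambda>j. (1/l) * v j)) {..<n} = (1/l) * L2_set (mat_vec n A v) {..<n}"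
    using l by (simp add: L2_set_right_distrib del: times_divide_eq_left)
  moreover have "L2_set (mat_vec n A (\<lambda>j. (1/l) * v j)) {..<n} \<le> op_norm n A"
    unfolding op_norm_alt
    by (rule cSup_upper[OF _ op_norm_bdd]) (use w in \<open>auto intro!: exI[of _ "\<lambda>j. (1/l) * v j"]\<close>)
  ultimately show ?thesis using l by (simp add: l_def field_simps)
qed

lemma L2_set_power2: "finite I \<Longrightarrow> (L2_set f I)\<^sup>2 = (\<Sum>i\<in>I. (f i)\<^sup>2)"
  unfolding L2_set_def by (simp add: sum_nonneg)

lemma sum_mat_vec_sq_le:
  assumes "op_norm n A \<le> \<rho>"
  shows "(\<Sum>i<n. (mat_vec n A v i)\<^sup>2) \<le> \<rho>\<^sup>2 * (\<Sum>j<n. (v j)\<^sup>2)"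
proof -
  have "L2_set (mat_vec n A v) {..<n} \<le> \<rho> * L2_set v {..<n}"
    using L2_set_mat_vec_le[of n A v] assms mult_right_mono[OF assms, of "L2_set v {..<n}"] by simp
  from power_mono[OF this, of 2] show ?thesis
    by (simp add: power_mult_distrib L2_set_power2)
qed

lemma bilinear_form_le:
  assumes "op_norm n A \<le> \<rho>"
  shows "\<bar>\<Sum>i<n. p i * mat_vec n A q i\<bar> \<le> \<rho> * L2_set p {..<n} * L2_set q {..<n}"
proof -
  have "\<bar>\<Sum>i<n. p i * mat_vec n A q i\<bar> \<le> (\<Sum>i<n. \<bar>p i\<bar> * \<bar>mat_vec n A q i\<bar>)"
    by (rule order_trans[OF sum_abs]) (simp add: abs_mult)
  also have "\<dots> \<le> L2_set p {..<n} * L2_set (mat_vec n A q) {..<n}"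
    by (rule L2_set_mult_ineq)
  also have "\<dots> \<le> L2_set p {..<n} * (\<rho> * L2_set q {..<n})"
    using L2_set_mat_vec_le[of n A q] assms mult_right_mono[OF assms, of "L2_set q {..<n}"]
    by (intro mult_left_mono) simp_all
  finally show ?thesis by (simp add: mult_ac)
qed

lemma column_sq_le:
  assumes "op_norm n A \<le> \<rho>" "j < n"
  shows "(\<Sum>i<n. (A i j)\<^sup>2) \<le> \<rho>\<^sup>2"
proof -
  have "mat_vec n A (\<lambda>k. if k = j then 1 else 0) i = A i j" for i
    using assms(2) by (simp add: mat_vec_def if_distrib[of "(*) _"] cong: if_cong)
  moreover have "(\<Sum>k<n. (if k = j then 1 else 0 :: real)\<^sup>2) = 1"
    using assms(2) by (simp add: if_distrib[of "\<lambda>x. x\<^sup>2"] cong: if_cong)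
  ultimately show ?thesis
    using sum_mat_vec_sq_le[OF assms(1), of "\<lambda>k. if k = j then 1 else 0"] by simp
qed

lemma entry_le:
  assumes "op_norm n A \<le> \<rho>" "i < n" "j < n"
  shows "\<bar>A i j\<bar> \<le> \<rho>"
proof -
  have "(A i j)\<^sup>2 \<le> (\<Sum>i<n. (A i j)\<^sup>2)"
    using assms by (intro member_le_sum) auto
  also have "\<dots> \<le> \<rho>\<^sup>2" using assms by (intro column_sq_le)
  finally have "\<bar>A i j\<bar> \<le> \<bar>\<rho>\<bar>" by (rule abs_le_square_iff[THEN iffD2])
  moreover have "\<rho> \<ge> 0" using op_norm_nonneg assms(1) order_trans by blast
  ultimately show ?thesis by simp
qed

text \<open>
  The diagonal entry is left out: at site \<open>i\<close> it multiplies \<open>(y i)\<^sup>2\<close> and so belongs to the base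
  measure of that site rather than to its external field.
\<close>

definition local_field :: "nat \<Rightarrow> (nat \<Rightarrow> nat \<Rightarrow> real) \<Rightarrow> (nat \<Rightarrow> real) \<Rightarrow> nat \<Rightarrow> real" where
  "local_field n A y i = (\<Sum>j\<in>{..<n} - {i}. A i j * y j)"

lemma local_field_mat_vec: "i < n \<Longrightarrow> local_field n A y i = mat_vec n A y i - A i i * y i"
  unfolding local_field_def mat_vec_def by (simp add: sum_diff1)

text \<open>
  Consequently at most a fraction \<open>4 \<rho>\<^sup>2 / K\<^sup>2\<close> of the sites have a local field of modulus above
  \<open>K\<close>, whatever the configuration.
\<close>

lemma sum_local_field_sq_le:
  assumes \<rho>: "op_norm n A \<le> \<rho>" and y: "\<And>i. i < n \<Longrightarrow> \<bar>y i\<bar> \<le> 1"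
  shows "(\<Sum>i<n. (local_field n A y i)\<^sup>2) \<le> 4 * \<rho>\<^sup>2 * n"
proof -
  have y2: "(y i)\<^sup>2 \<le> 1" if "i < n" for i
    using y[OF that] by (simp add: abs_square_le_1)
  have "(\<Sum>i<n. (local_field n A y i)\<^sup>2) \<le> (\<Sum>i<n. 2 * (mat_vec n A y i)\<^sup>2 + 2 * \<rho>\<^sup>2)"
  proof (rule sum_mono)
    fix i assume i: "i \<in> {..<n}"
    have "(A i i * y i)\<^sup>2 \<le> \<rho>\<^sup>2 * 1"
      unfolding power_mult_distrib using entry_le[OF \<rho>, of i i] i y2[of i]
      by (intro mult_mono) (auto simp: abs_le_square_iff[symmetric])
    moreover have "(mat_vec n A y i - A i i * y i)\<^sup>2 \<le> 2 * (mat_vec n A y i)\<^sup>2 + 2 * (A i i * y i)\<^sup>2"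
      using zero_le_power2[of "mat_vec n A y i + A i i * y i"]
      by (simp add: power2_eq_square algebra_simps)
    ultimately show "(local_field n A y i)\<^sup>2 \<le> 2 * (mat_vec n A y i)\<^sup>2 + 2 * \<rho>\<^sup>2"
      using i by (simp add: local_field_mat_vec)
  qed
  also have "\<dots> = 2 * (\<Sum>i<n. (mat_vec n A y i)\<^sup>2) + 2 * \<rho>\<^sup>2 * n"
    by (simp add: sum.distrib sum_distrib_left)
  also have "\<dots> \<le> 2 * (\<rho>\<^sup>2 * n) + 2 * \<rho>\<^sup>2 * n"
  proof -
    have "(\<Sum>i<n. (y i)\<^sup>2) \<le> (\<Sum>i<n. 1)" using y2 by (intro sum_mono) auto
    then have "\<rho>\<^sup>2 * (\<Sum>i<n. (y i)\<^sup>2) \<le> \<rho>\<^sup>2 * n" by (intro mult_left_mono) auto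
    with sum_mat_vec_sq_le[OF \<rho>, of y] show ?thesis by linarith
  qed
  finally show ?thesis by (simp add: mult_ac)
qed

section \<open>Tilted moments\<close>

text \<open>
  The site law with diagonal interaction \<open>a\<close> and field \<open>s\<close> has density proportional to
  \<open>exp (a u\<^sup>2 / 2 + s u)\<close>; \<open>moment \<nu> a 0\<close> is its partition function, and the functions below are the
  derivatives in \<open>s\<close> of the logarithm.
\<close>

definition moment :: "real measure \<Rightarrow> real \<Rightarrow> nat \<Rightarrow> real \<Rightarrow> real" where
  "moment \<nu> a k s = (\<integral>u. u ^ k * exp (a * u\<^sup>2 / 2 + s * u) \<partial>\<nu>)"

definition log_partition :: "real measure \<Rightarrow> real \<Rightarrow> real \<Rightarrow> real" where
  "log_partition \<nu> a s = ln (moment \<nu> a 0 s)"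

definition tilted_mean :: "real measure \<Rightarrow> real \<Rightarrow> real \<Rightarrow> real" where
  "tilted_mean \<nu> a s = moment \<nu> a 1 s / moment \<nu> a 0 s"

definition tilted_var :: "real measure \<Rightarrow> real \<Rightarrow> real \<Rightarrow> real" where
  "tilted_var \<nu> a s = moment \<nu> a 2 s / moment \<nu> a 0 s - (tilted_mean \<nu> a s)\<^sup>2"

lemma exponent_bound:
  fixes u :: real assumes "\<bar>u\<bar> \<le> 1" shows "\<bar>a * u\<^sup>2 / 2 + s * u\<bar> \<le> \<bar>a\<bar> / 2 + \<bar>s\<bar>"
proof -
  have "u\<^sup>2 \<le> 1" using assms by (simp add: abs_square_le_1)
  then have "\<bar>a * u\<^sup>2 / 2\<bar> \<le> \<bar>a\<bar> / 2"
    by (simp add: abs_mult mult_left_le)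
  moreover have "\<bar>s * u\<bar> \<le> \<bar>s\<bar> * 1" unfolding abs_mult using assms by (intro mult_left_mono) auto
  ultimately show ?thesis by linarith
qed

lemma tilt_bounded:
  fixes u :: real
  assumes "\<bar>u\<bar> \<le> 1" "\<bar>g\<bar> \<le> K"
  shows "\<bar>g * exp (a * u\<^sup>2 / 2 + s * u)\<bar> \<le> K * exp (\<bar>a\<bar> / 2 + \<bar>s\<bar>)"
proof -
  have "exp (a * u\<^sup>2 / 2 + s * u) \<le> exp (\<bar>a\<bar> / 2 + \<bar>s\<bar>)"
    using exponent_bound[OF assms(1), of a s] by simp
  then show ?thesis unfolding abs_mult abs_exp_cancel using assms by (intro mult_mono) auto
qed

lemma exp_remainder_le:
  fixes z :: real assumes "\<bar>z\<bar> \<le> 1" shows "\<bar>exp z - 1 - z\<bar> \<le> 2 * z\<^sup>2"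
proof -
  obtain t where t: "\<bar>t\<bar> \<le> \<bar>z\<bar>" and e: "exp z = (\<Sum>m<2. z ^ m / fact m) + exp t / fact 2 * z ^ 2"
    using Maclaurin_exp_le[of z 2] by auto
  have "exp t \<le> exp 1" using t assms by simp
  then have "exp t \<le> 3" using exp_le by linarith
  then have "exp t / 2 * z\<^sup>2 \<le> 2 * z\<^sup>2" by (intro mult_right_mono) auto
  moreover have "exp z - 1 - z = exp t / 2 * z\<^sup>2" using e by (simp add: numeral_2_eq_2)
  moreover have "0 \<le> exp t / 2 * z\<^sup>2" by simp
  ultimately show ?thesis by linarith
qed

text \<open>
  Finite measures rather than probability measures, and measurability of the identity rather than
  \<open>sets \<nu> = sets borel\<close>, so that counting measure on \<open>{-1, 1}\<close>, the base of the treatments, is an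
  instance along with \<open>\<mu>\<close>. The constant \<open>v\<^sub>0\<close> quantifies that \<open>\<nu>\<close> is not a point mass.
\<close>

locale bounded_base = finite_measure \<nu> for \<nu> :: "real measure" +
  fixes v\<^sub>0 :: real
  assumes id_measurable [measurable]: "(\<lambda>u. u) \<in> borel_measurable \<nu>"
    and AE_bounded: "AE u in \<nu>. \<bar>u\<bar> \<le> 1"
    and v\<^sub>0_pos: "v\<^sub>0 > 0"
    and spread: "v\<^sub>0 \<le> (\<integral>u. (u - c)\<^sup>2 \<partial>\<nu>)"
begin

definition mass :: real where "mass = measure \<nu> (space \<nu>)"

lemma integrable_bounded:
  fixes f :: "real \<Rightarrow> real"
  assumes [measurable]: "f \<in> borel_measurable \<nu>" and "\<And>u. \<bar>u\<bar> \<le> 1 \<Longrightarrow> \<bar>f u\<bar> \<le> K"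
  shows "integrable \<nu> f"
  by (rule integrable_const_bound[where B = K]) (use AE_bounded assms in auto)

lemma integral_mono_bounded:
  fixes f g :: "real \<Rightarrow> real"
  assumes "integrable \<nu> f" "integrable \<nu> g" and "\<And>u. \<bar>u\<bar> \<le> 1 \<Longrightarrow> f u \<le> g u"
  shows "(\<integral>u. f u \<partial>\<nu>) \<le> (\<integral>u. g u \<partial>\<nu>)"
  by (rule integral_mono_AE) (use AE_bounded assms in auto)

lemma mass_pos: "mass > 0"
proof -
  have "v\<^sub>0 \<le> (\<integral>u. (u - 0)\<^sup>2 \<partial>\<nu>)" by (rule spread)
  also have "\<dots> \<le> (\<integral>u. 1 \<partial>\<nu>)"
    by (intro integral_mono_bounded integrable_bounded[where K = 1])
       (auto simp: abs_square_le_1)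
  finally show ?thesis using v\<^sub>0_pos by (simp add: mass_def)
qed

lemma integrable_tilt:
  assumes [measurable]: "g \<in> borel_measurable \<nu>" and "\<And>u. \<bar>u\<bar> \<le> 1 \<Longrightarrow> \<bar>g u\<bar> \<le> K"
  shows "integrable \<nu> (\<lambda>u. g u * exp (a * u\<^sup>2 / 2 + s * u))"
  by (rule integrable_bounded[where K = "K * exp (\<bar>a\<bar> / 2 + \<bar>s\<bar>)"]) (simp_all add: tilt_bounded assms)

lemma integrable_moment [simp]: "integrable \<nu> (\<lambda>u. u ^ k * exp (a * u\<^sup>2 / 2 + s * u))"
  by (rule integrable_tilt[where K = 1]) (auto simp: power_abs power_le_one)

lemma moment_0_lower: "moment \<nu> a 0 s \<ge> mass * exp (- (\<bar>a\<bar> / 2 + \<bar>s\<bar>))"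
proof -
  have "(\<integral>u. exp (- (\<bar>a\<bar> / 2 + \<bar>s\<bar>)) \<partial>\<nu>) \<le> (\<integral>u. u ^ 0 * exp (a * u\<^sup>2 / 2 + s * u) \<partial>\<nu>)"
  proof (rule integral_mono_bounded)
    show "exp (- (\<bar>a\<bar> / 2 + \<bar>s\<bar>)) \<le> u ^ 0 * exp (a * u\<^sup>2 / 2 + s * u)" if "\<bar>u\<bar> \<le> 1" for u
      using exponent_bound[OF that, of a s] unfolding power_0 mult_1 exp_le_cancel_iff by linarith
  qed (use integrable_moment[of 0 a s] in simp_all)
  then show ?thesis by (simp add: moment_def mass_def)
qed

lemma moment_0_pos [simp]: "moment \<nu> a 0 s > 0"
  using moment_0_lower[of a s] mult_pos_pos[OF mass_pos exp_gt_zero[of "- (\<bar>a\<bar> / 2 + \<bar>s\<bar>)"]] by linarith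

lemma moment_0_upper: "moment \<nu> a 0 s \<le> mass * exp (\<bar>a\<bar> / 2 + \<bar>s\<bar>)"
proof -
  have "(\<integral>u. u ^ 0 * exp (a * u\<^sup>2 / 2 + s * u) \<partial>\<nu>) \<le> (\<integral>u. exp (\<bar>a\<bar> / 2 + \<bar>s\<bar>) \<partial>\<nu>)"
  proof (rule integral_mono_bounded)
    show "u ^ 0 * exp (a * u\<^sup>2 / 2 + s * u) \<le> exp (\<bar>a\<bar> / 2 + \<bar>s\<bar>)" if "\<bar>u\<bar> \<le> 1" for u
      using exponent_bound[OF that, of a s] unfolding power_0 mult_1 exp_le_cancel_iff by linarith
  qed (use integrable_moment[of 0 a s] in simp_all)
  then show ?thesis by (simp add: moment_def mass_def)
qed

lemma abs_moment_le: "\<bar>moment \<nu> a k s\<bar> \<le> moment \<nu> a 0 s"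
proof -
  have "\<bar>moment \<nu> a k s\<bar> \<le> (\<integral>u. \<bar>u ^ k * exp (a * u\<^sup>2 / 2 + s * u)\<bar> \<partial>\<nu>)"
    unfolding moment_def by (rule integral_abs_bound)
  also have "\<dots> \<le> moment \<nu> a 0 s"
    unfolding moment_def
    by (intro integral_mono_bounded integrable_abs integrable_moment)
       (auto simp: abs_mult power_abs power_le_one)
  finally show ?thesis .
qed

lemma moment_ratio_le: "\<bar>moment \<nu> a k s / moment \<nu> a 0 s\<bar> \<le> 1"
  using abs_moment_le[of a k s] moment_0_pos[of a s] by (simp add: abs_divide)

lemma abs_tilted_mean_le: "\<bar>tilted_mean \<nu> a s\<bar> \<le> 1"
  unfolding tilted_mean_def by (rule moment_ratio_le)

text \<open>
  Differentiation under the integral sign: on the support \<open>|u| \<le> 1\<close> the integrand has a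
  second-order remainder that is uniform in \<open>u\<close>.
\<close>

lemma DERIV_moment: "(moment \<nu> a k has_real_derivative moment \<nu> a (Suc k) s) (at s)"
proof -
  let ?D = "\<lambda>h. moment \<nu> a k (s + h) - moment \<nu> a k s - h * moment \<nu> a (Suc k) s"
  have bound: "\<bar>?D h\<bar>
      \<le> 2 * moment \<nu> a 0 s * h\<^sup>2" if h: "\<bar>h\<bar> \<le> 1" for h
  proof -
    let ?e = "\<lambda>u. exp (a * u\<^sup>2 / 2 + s * u)"
    have "?D h
        = (\<integral>u. u ^ k * exp (a * u\<^sup>2 / 2 + (s + h) * u) - u ^ k * ?e u - h * (u ^ Suc k * ?e u) \<partial>\<nu>)"
      unfolding moment_def using integrable_moment[of "Suc k" a s]
      by (simp del: power_Suc)
    also have "\<dots> = (\<integral>u. u ^ k * (exp (h * u) - 1 - h * u) * ?e u \<partial>\<nu>)"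
      by (intro Bochner_Integration.integral_cong) (auto simp: algebra_simps exp_add)
    finally have eq: "?D h
        = (\<integral>u. u ^ k * (exp (h * u) - 1 - h * u) * ?e u \<partial>\<nu>)" .
    have pt: "\<bar>u ^ k * (exp (h * u) - 1 - h * u)\<bar> \<le> 2 * h\<^sup>2" if u: "\<bar>u\<bar> \<le> 1" for u
    proof -
      have hu: "\<bar>h * u\<bar> \<le> \<bar>h\<bar>" using u by (simp add: abs_mult mult_left_le)
      have "\<bar>exp (h * u) - 1 - h * u\<bar> \<le> 2 * (h * u)\<^sup>2" using hu h by (intro exp_remainder_le) linarith
      also have "\<dots> \<le> 2 * h\<^sup>2" using hu by (simp add: abs_le_square_iff[symmetric])
      finally have "\<bar>u\<bar> ^ k * \<bar>exp (h * u) - 1 - h * u\<bar> \<le> 1 * (2 * h\<^sup>2)"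
        using u by (intro mult_mono power_le_one) auto
      then show ?thesis by (simp add: abs_mult power_abs)
    qed
    have int: "integrable \<nu> (\<lambda>u. u ^ k * (exp (h * u) - 1 - h * u) * ?e u)"
      by (rule integrable_tilt[where K = "2 * h\<^sup>2"]) (use pt in auto)
    have "\<bar>\<integral>u. u ^ k * (exp (h * u) - 1 - h * u) * ?e u \<partial>\<nu>\<bar>
        \<le> (\<integral>u. \<bar>u ^ k * (exp (h * u) - 1 - h * u) * ?e u\<bar> \<partial>\<nu>)"
      by (rule integral_abs_bound)
    also have "\<dots> \<le> (\<integral>u. 2 * h\<^sup>2 * (u ^ 0 * ?e u) \<partial>\<nu>)"
    proof (rule integral_mono_bounded)
      show "\<bar>u ^ k * (exp (h * u) - 1 - h * u) * ?e u\<bar> \<le> 2 * h\<^sup>2 * (u ^ 0 * ?e u)" if "\<bar>u\<bar> \<le> 1" for u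
        unfolding abs_mult[of _ "?e u"] using pt[OF that] by simp
    qed (use int in \<open>auto intro!: integrable_mult_right integrable_moment simp del: power_0\<close>)
    also have "\<dots> = 2 * moment \<nu> a 0 s * h\<^sup>2" by (simp add: moment_def)
    finally show ?thesis unfolding eq .
  qed
  have "((\<lambda>h. (moment \<nu> a k (s + h) - moment \<nu> a k s) / h - moment \<nu> a (Suc k) s) \<longlongrightarrow> 0) (at 0)"
  proof (rule Lim_null_comparison)
    have "\<forall>\<^sub>F h::real in at 0. \<bar>h\<bar> \<le> 1 \<and> h \<noteq> 0"
      unfolding eventually_at by (intro exI[of _ 1]) (auto simp: dist_real_def)
    then show "\<forall>\<^sub>F h in at 0. norm ((moment \<nu> a k (s + h) - moment \<nu> a k s) / h - moment \<nu> a (Suc k) s)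
        \<le> 2 * moment \<nu> a 0 s * \<bar>h\<bar>"
    proof eventually_elim
      case (elim h)
      then have h: "h \<noteq> 0" by simp
      have "(moment \<nu> a k (s + h) - moment \<nu> a k s) / h - moment \<nu> a (Suc k) s
          = (?D h) / h"
        using h by (simp add: field_simps)
      also have "\<bar>\<dots>\<bar> \<le> 2 * moment \<nu> a 0 s * h\<^sup>2 / \<bar>h\<bar>"
        unfolding abs_divide using elim bound[of h] by (intro divide_right_mono) auto
      also have "\<dots> = 2 * moment \<nu> a 0 s * \<bar>h\<bar>"
        using h by (simp add: power2_eq_square abs_if)
      finally show ?case by simp
    qed
    show "((\<lambda>h. 2 * moment \<nu> a 0 s * \<bar>h\<bar>) \<longlongrightarrow> 0) (at 0)"
      by (auto intro!: tendsto_eq_intros)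
  qed
  then show ?thesis
    unfolding DERIV_def by (rule LIM_zero_cancel)
qed

lemma DERIV_log_partition: "(log_partition \<nu> a has_real_derivative tilted_mean \<nu> a s) (at s)"
  unfolding log_partition_def[abs_def] tilted_mean_def
  by (rule derivative_eq_intros DERIV_moment moment_0_pos refl)+ simp

lemma DERIV_tilted_mean: "(tilted_mean \<nu> a has_real_derivative tilted_var \<nu> a s) (at s)"
proof -
  have "moment \<nu> a 0 s \<noteq> 0" using moment_0_pos[of a s] by linarith
  then show ?thesis
    unfolding tilted_mean_def[abs_def] tilted_var_def
    by (auto intro!: derivative_eq_intros DERIV_moment simp: field_simps power2_eq_square numeral_2_eq_2)
qed

text \<open>
  The derivative is the third cumulant; \<open>6\<close> is a crude bound from moments of modulus at most \<open>1\<close>.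
\<close>

lemma DERIV_tilted_var:
  "\<exists>D. (tilted_var \<nu> a has_real_derivative D) (at s) \<and> \<bar>D\<bar> \<le> 6"
proof (intro exI conjI)
  let ?m = "\<lambda>k. moment \<nu> a k s / moment \<nu> a 0 s"
  have nz: "moment \<nu> a 0 s \<noteq> 0" using moment_0_pos[of a s] by linarith
  show "(tilted_var \<nu> a has_real_derivative
      ?m 3 - ?m 2 * ?m 1 - 2 * tilted_mean \<nu> a s * tilted_var \<nu> a s) (at s)"
    unfolding tilted_var_def[abs_def]
    by (rule derivative_eq_intros DERIV_moment DERIV_tilted_mean nz refl)+
       (use nz in \<open>simp add: tilted_var_def field_simps numeral_2_eq_2 numeral_3_eq_3\<close>)
  have m: "\<bar>?m k\<bar> \<le> 1" for k by (rule moment_ratio_le)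
  have "(tilted_mean \<nu> a s)\<^sup>2 \<le> 1" using abs_tilted_mean_le[of a s] by (simp add: abs_square_le_1)
  then have v: "\<bar>tilted_var \<nu> a s\<bar> \<le> 2"
    using m[of 2] zero_le_power2[of "tilted_mean \<nu> a s"] unfolding tilted_var_def by linarith
  have "\<bar>?m 2 * ?m 1\<bar> \<le> 1" unfolding abs_mult using m by (intro mult_le_one) auto
  moreover have "\<bar>tilted_mean \<nu> a s * tilted_var \<nu> a s\<bar> \<le> 1 * 2"
    unfolding abs_mult using v abs_tilted_mean_le by (intro mult_mono) auto
  ultimately show "\<bar>?m 3 - ?m 2 * ?m 1 - 2 * tilted_mean \<nu> a s * tilted_var \<nu> a s\<bar> \<le> 6"
    using m[of 3] by linarith
qed

lemma tilted_var_eq: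
  "tilted_var \<nu> a s = (\<integral>u. (u - tilted_mean \<nu> a s)\<^sup>2 * exp (a * u\<^sup>2 / 2 + s * u) \<partial>\<nu>) / moment \<nu> a 0 s"
proof -
  let ?b = "tilted_mean \<nu> a s" and ?e = "\<lambda>u. exp (a * u\<^sup>2 / 2 + s * u)"
  have nz: "moment \<nu> a 0 s \<noteq> 0" using moment_0_pos[of a s] by linarith
  have "(\<integral>u. (u - ?b)\<^sup>2 * ?e u \<partial>\<nu>)
      = (\<integral>u. u ^ 2 * ?e u - 2 * ?b * (u ^ 1 * ?e u) + ?b\<^sup>2 * (u ^ 0 * ?e u) \<partial>\<nu>)"
    by (intro Bochner_Integration.integral_cong) (auto simp: power2_eq_square algebra_simps)
  also have "\<dots> = moment \<nu> a 2 s - 2 * ?b * moment \<nu> a 1 s + ?b\<^sup>2 * moment \<nu> a 0 s"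
    unfolding moment_def using integrable_moment[of 0 a s] integrable_moment[of 1 a s] integrable_moment[of 2 a s]
    by simp
  also have "moment \<nu> a 1 s = ?b * moment \<nu> a 0 s" using nz by (simp add: tilted_mean_def)
  finally show ?thesis using nz by (simp add: tilted_var_def field_simps power2_eq_square)
qed

definition var_bound :: "real \<Rightarrow> real \<Rightarrow> real" where
  "var_bound a s = v\<^sub>0 * exp (- \<bar>a\<bar> - 2 * \<bar>s\<bar>) / mass"

lemma var_bound_pos: "var_bound a s > 0"
  unfolding var_bound_def using v\<^sub>0_pos mass_pos by simp

lemma var_bound_antimono:
  assumes "\<bar>a\<bar> \<le> a'" "\<bar>s\<bar> \<le> s'" shows "var_bound a' s' \<le> var_bound a s"
  unfolding var_bound_def using v\<^sub>0_pos mass_pos assms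
  by (intro divide_right_mono mult_left_mono) auto

text \<open>
  Tilting changes densities by a factor of at least \<open>exp (- |a| / 2 - |s|)\<close> before normalization and
  by the same factor again through the partition function, and a variance is a mean squared
  distance to some point.
\<close>

lemma tilted_var_ge: "var_bound a s \<le> tilted_var \<nu> a s"
proof -
  let ?b = "tilted_mean \<nu> a s" and ?E = "exp (- (\<bar>a\<bar> / 2 + \<bar>s\<bar>))"
  have "v\<^sub>0 * ?E \<le> (\<integral>u. (u - ?b)\<^sup>2 \<partial>\<nu>) * ?E" using spread by (intro mult_right_mono) auto
  also have "\<dots> = (\<integral>u. (u - ?b)\<^sup>2 * ?E \<partial>\<nu>)" by simp
  also have "\<dots> \<le> (\<integral>u. (u - ?b)\<^sup>2 * exp (a * u\<^sup>2 / 2 + s * u) \<partial>\<nu>)"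
  proof -
    have sq: "\<bar>(u - ?b)\<^sup>2\<bar> \<le> 4" if "\<bar>u\<bar> \<le> 1" for u
      using power_mono[of "\<bar>u - ?b\<bar>" 2 2] that abs_tilted_mean_le[of a s] by simp
    show ?thesis
    proof (rule integral_mono_bounded)
      show "(u - ?b)\<^sup>2 * ?E \<le> (u - ?b)\<^sup>2 * exp (a * u\<^sup>2 / 2 + s * u)" if "\<bar>u\<bar> \<le> 1" for u
        using exponent_bound[OF that, of a s] by (intro mult_left_mono) auto
      show "integrable \<nu> (\<lambda>u. (u - ?b)\<^sup>2 * ?E)"
        by (intro integrable_mult_left integrable_bounded[where K = 4] sq) auto
      show "integrable \<nu> (\<lambda>u. (u - ?b)\<^sup>2 * exp (a * u\<^sup>2 / 2 + s * u))"
        by (intro integrable_tilt[where K = 4] sq) auto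
    qed
  qed
  finally have "v\<^sub>0 * ?E / moment \<nu> a 0 s \<le> tilted_var \<nu> a s"
    unfolding tilted_var_eq by (intro divide_right_mono) (auto intro: less_imp_le)
  moreover have "v\<^sub>0 * ?E / (mass * exp (\<bar>a\<bar> / 2 + \<bar>s\<bar>)) \<le> v\<^sub>0 * ?E / moment \<nu> a 0 s"
    using moment_0_upper[of a s] v\<^sub>0_pos mass_pos by (intro divide_left_mono) auto
  moreover have "v\<^sub>0 * ?E / (mass * exp (\<bar>a\<bar> / 2 + \<bar>s\<bar>)) = var_bound a s"
  proof -
    have "?E / exp (\<bar>a\<bar> / 2 + \<bar>s\<bar>) = exp (- \<bar>a\<bar> - 2 * \<bar>s\<bar>)"
      unfolding exp_diff[symmetric] by (simp add: field_simps)
    then show ?thesis unfolding var_bound_def by (metis times_divide_eq_right divide_divide_eq_left mult.commute)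
  qed
  ultimately show ?thesis by linarith
qed

lemma tilted_var_pos: "tilted_var \<nu> a s > 0"
  using tilted_var_ge[of a s] var_bound_pos[of a s] by linarith

lemma tilted_var_le_1: "tilted_var \<nu> a s \<le> 1"
  using moment_ratio_le[of a 2 s] unfolding tilted_var_def by (smt (verit) zero_le_power2)

lemma tilted_mean_taylor:
  "\<bar>tilted_mean \<nu> a s - tilted_mean \<nu> a (s - e) - tilted_var \<nu> a s * e\<bar> \<le> 6 * e\<^sup>2"
proof (cases "e = 0")
  case False
  define s' where "s' = s - e"
  have ss': "s \<noteq> s'" "e = s - s'" using False by (auto simp: s'_def)
  \<comment> \<open>The third cumulant bounds the Lipschitz constant of the variance.\<close>
  have lip: "\<bar>tilted_var \<nu> a x - tilted_var \<nu> a y\<bar> \<le> 6 * \<bar>x - y\<bar>" for x y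
  proof -
    obtain D where "\<And>x. (tilted_var \<nu> a has_real_derivative D x) (at x)" "\<And>x. \<bar>D x\<bar> \<le> 6"
      using DERIV_tilted_var by metis
    then show ?thesis
      using field_differentiable_bound[of UNIV "tilted_var \<nu> a" D 6 x y] by auto
  qed
  obtain z where z: "\<bar>z - s\<bar> \<le> \<bar>e\<bar>" "tilted_mean \<nu> a s - tilted_mean \<nu> a s' = tilted_var \<nu> a z * e"
  proof (cases "s' < s")
    case True
    with MVT2[OF True DERIV_tilted_mean] obtain z where "s' < z" "z < s"
      "tilted_mean \<nu> a s - tilted_mean \<nu> a s' = (s - s') * tilted_var \<nu> a z" by blast
    then show ?thesis using that[of z] ss' by (simp add: mult.commute)
  next
    case False
    then have "s < s'" using ss' by simp
    from MVT2[OF this DERIV_tilted_mean] obtain z where "s < z" "z < s'"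
      "tilted_mean \<nu> a s' - tilted_mean \<nu> a s = (s' - s) * tilted_var \<nu> a z" by blast
    then show ?thesis using that[of z] ss' by (simp add: algebra_simps)
  qed
  have "\<bar>tilted_var \<nu> a z * e - tilted_var \<nu> a s * e\<bar> = \<bar>tilted_var \<nu> a z - tilted_var \<nu> a s\<bar> * \<bar>e\<bar>"
    by (simp add: abs_mult[symmetric] algebra_simps)
  also have "\<dots> \<le> (6 * \<bar>e\<bar>) * \<bar>e\<bar>"
    using lip[of z s] z(1) by (intro mult_right_mono) auto
  finally show ?thesis unfolding s'_def[symmetric] z(2) by (simp add: power2_eq_square)
qed simp

text \<open>
  The exact second-order form serves both strict convexity and the quantitative curvature bound,
  which needs the location of the intermediate point.
\<close>

lemma log_partition_taylor:
  obtains t where "\<bar>t - s\<bar> \<le> \<bar>e\<bar>"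
    "log_partition \<nu> a (s + e) = log_partition \<nu> a s + tilted_mean \<nu> a s * e + tilted_var \<nu> a t / 2 * e\<^sup>2"
proof (cases "e = 0")
  case False
  define diff where "diff m = (if m = 0 then log_partition \<nu> a else if m = 1 then tilted_mean \<nu> a else tilted_var \<nu> a)"
    for m :: nat
  have "\<exists>t. (if s + e < s then s + e < t \<and> t < s else s < t \<and> t < s + e) \<and>
      log_partition \<nu> a (s + e) = (\<Sum>m<2. diff m s / fact m * (s + e - s) ^ m) + diff 2 t / fact 2 * (s + e - s)\<^sup>2"
  proof (rule Taylor[where a = "min s (s + e)" and b = "max s (s + e)"])
    show "\<forall>m t. m < 2 \<and> min s (s + e) \<le> t \<and> t \<le> max s (s + e) \<longrightarrow>
        (diff m has_real_derivative diff (Suc m) t) (at t)"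
      using DERIV_log_partition[of a] DERIV_tilted_mean[of a] by (auto simp: diff_def less_2_cases_iff)
  qed (use False in \<open>auto simp: diff_def\<close>)
  then obtain t where "if s + e < s then s + e < t \<and> t < s else s < t \<and> t < s + e"
    and "log_partition \<nu> a (s + e) = (\<Sum>m<2. diff m s / fact m * (s + e - s) ^ m) + diff 2 t / fact 2 * (s + e - s)\<^sup>2"
    by blast
  then show ?thesis
    by (intro that[of t]) (auto simp: diff_def numeral_2_eq_2 split: if_splits)
qed (use that[of s] in simp)

lemma log_partition_strictly_above_tangent:
  assumes "e \<noteq> 0"
  shows "log_partition \<nu> a s + tilted_mean \<nu> a s * e < log_partition \<nu> a (s + e)"
proof -
  obtain t where "log_partition \<nu> a (s + e) = log_partition \<nu> a s + tilted_mean \<nu> a s * e + tilted_var \<nu> a t / 2 * e\<^sup>2"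
    using log_partition_taylor by blast
  moreover have "tilted_var \<nu> a t / 2 * e\<^sup>2 > 0" using tilted_var_pos[of a t] assms by simp
  ultimately show ?thesis by linarith
qed

lemma log_partition_strictly_convex:
  assumes "s \<noteq> s'" "0 < l" "l < 1"
  shows "log_partition \<nu> a ((1 - l) * s + l * s') < (1 - l) * log_partition \<nu> a s + l * log_partition \<nu> a s'"
proof -
  define p where "p = (1 - l) * s + l * s'"
  let ?L = "log_partition \<nu> a" and ?b = "tilted_mean \<nu> a p"
  have "s - p = l * (s - s')" "s' - p = (1 - l) * (s' - s)" by (simp_all add: p_def algebra_simps)
  then have ne: "s - p \<noteq> 0" "s' - p \<noteq> 0" using assms by auto
  have "(1 - l) * (?L p + ?b * (s - p)) + l * (?L p + ?b * (s' - p)) < (1 - l) * ?L s + l * ?L s'"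
    using log_partition_strictly_above_tangent[OF ne(1), of a p]
      log_partition_strictly_above_tangent[OF ne(2), of a p] assms
    by (intro add_strict_mono mult_strict_left_mono) auto
  moreover have "(1 - l) * (?L p + ?b * (s - p)) + l * (?L p + ?b * (s' - p)) = ?L p"
    by (simp add: p_def algebra_simps)
  ultimately show ?thesis by (simp add: p_def)
qed

lemma continuous_on_log_partition: "continuous_on UNIV (log_partition \<nu> a)"
  by (meson DERIV_log_partition DERIV_isCont continuous_at_imp_continuous_on)

lemma continuous_on_tilted_mean: "continuous_on UNIV (tilted_mean \<nu> a)"
  by (meson DERIV_tilted_mean DERIV_isCont continuous_at_imp_continuous_on)

lemma borel_measurable_log_partition [measurable]: "log_partition \<nu> a \<in> borel_measurable borel"
  by (rule borel_measurable_continuous_onI[OF continuous_on_log_partition])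

lemma borel_measurable_tilted_mean [measurable]: "tilted_mean \<nu> a \<in> borel_measurable borel"
  by (rule borel_measurable_continuous_onI[OF continuous_on_tilted_mean])

end

section \<open>Product measures\<close>

lemma AE_PiM_coordinate:
  assumes "finite_measure M" "finite I" "i \<in> I" "AE u in M. P u"
  shows "AE y in PiM I (\<lambda>_. M). P (y i)"
proof -
  interpret finite_measure M by fact
  interpret product_sigma_finite "\<lambda>_. M" by unfold_locales
  obtain N where N: "N \<in> null_sets M" "{u \<in> space M. \<not> P u} \<subseteq> N"
    using assms(4) by (auto simp: eventually_ae_filter)
  let ?E = "PiE I (\<lambda>j. if j = i then N else space M)"
  have "emeasure (PiM I (\<lambda>_. M)) ?E = (\<Prod>j\<in>I. emeasure M (if j = i then N else space M))"
    using N assms(2) by (intro emeasure_PiM) (auto simp: null_sets_def)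
  also have "\<dots> = 0"
    using N assms(2,3) by (intro prod_zero) (auto simp: null_sets_def intro!: bexI[of _ i])
  finally have "emeasure (PiM I (\<lambda>_. M)) ?E = 0" .
  moreover have "?E \<in> sets (PiM I (\<lambda>_. M))"
    using N assms(2) by (intro sets_PiM_I_finite) (auto simp: null_sets_def)
  moreover have "{y \<in> space (PiM I (\<lambda>_. M)). \<not> P (y i)} \<subseteq> ?E"
  proof
    fix y assume "y \<in> {y \<in> space (PiM I (\<lambda>_. M)). \<not> P (y i)}"
    then have y: "y \<in> PiE I (\<lambda>_. space M)" "\<not> P (y i)" by (auto simp: space_PiM)
    then have "y i \<in> N" using N(2) assms(3) by (auto dest: PiE_mem)
    with y show "y \<in> ?E" by (auto simp: PiE_iff)
  qed
  ultimately show ?thesis by (intro AE_I[where N = ?E])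
qed

lemma finite_measure_PiM:
  assumes "finite_measure M" "finite I"
  shows "finite_measure (PiM I (\<lambda>_. M))"
    and "measure (PiM I (\<lambda>_. M)) (space (PiM I (\<lambda>_. M))) = measure M (space M) ^ card I"
proof -
  interpret finite_measure M by fact
  interpret product_sigma_finite "\<lambda>_. M" by unfold_locales
  have "emeasure (PiM I (\<lambda>_. M)) (space (PiM I (\<lambda>_. M))) = (\<Prod>j\<in>I. emeasure M (space M))"
    unfolding space_PiM by (intro emeasure_PiM assms) auto
  also have "\<dots> = ennreal (measure M (space M) ^ card I)"
    by (simp add: emeasure_eq_measure ennreal_power)
  finally have *: "emeasure (PiM I (\<lambda>_. M)) (space (PiM I (\<lambda>_. M))) = ennreal (measure M (space M) ^ card I)" .
  then show "finite_measure (PiM I (\<lambda>_. M))" by (intro finite_measureI) simp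
  show "measure (PiM I (\<lambda>_. M)) (space (PiM I (\<lambda>_. M))) = measure M (space M) ^ card I"
    unfolding measure_def * by simp
qed

text \<open>
  Fubini with one coordinate integrated out first. It removes the off-diagonal terms for independent
  covariates, and with a Gibbs weight as a factor of \<open>f\<close> it expresses conditional centring.
\<close>

lemma integral_PiM_eq_0:
  fixes f :: "(nat \<Rightarrow> 'a) \<Rightarrow> real"
  assumes "finite_measure M" "i < n" "integrable (PiM {..<n} (\<lambda>_. M)) f"
    and "\<And>y. (\<integral>u. f (y(i := u)) \<partial>M) = 0"
  shows "(\<integral>y. f y \<partial>PiM {..<n} (\<lambda>_. M)) = 0"
proof -
  interpret finite_measure M by fact
  interpret product_sigma_finite "\<lambda>_. M" by unfold_locales
  have eq: "{..<n} = insert i ({..<n} - {i})" using assms(2) by auto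
  have "(\<integral>y. f y \<partial>PiM {..<n} (\<lambda>_. M)) = (\<integral>y. (\<integral>u. f (y(i := u)) \<partial>M) \<partial>PiM ({..<n} - {i}) (\<lambda>_. M))"
    using product_integral_insert[of "{..<n} - {i}" i f] assms(3) unfolding eq[symmetric] by simp
  then show ?thesis by (simp add: assms(4))
qed

section \<open>Gibbs measures\<close>

definition gibbs_weight :: "nat \<Rightarrow> (nat \<Rightarrow> nat \<Rightarrow> real) \<Rightarrow> (nat \<Rightarrow> real) \<Rightarrow> (nat \<Rightarrow> real) \<Rightarrow> real" where
  "gibbs_weight n A h y = exp (quad_form n A y / 2 + (\<Sum>i<n. y i * h i))"

definition cond_mean :: "real measure \<Rightarrow> nat \<Rightarrow> (nat \<Rightarrow> nat \<Rightarrow> real) \<Rightarrow> (nat \<Rightarrow> real) \<Rightarrow> (nat \<Rightarrow> real) \<Rightarrow> nat \<Rightarrow> real" where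
  "cond_mean \<nu> n A h y i = tilted_mean \<nu> (A i i) (local_field n A y i + h i)"

text \<open>
  With \<open>c\<close> the coordinates of the covariates or the treatments, these are the components of the
  gradient of the log pseudo-likelihood.
\<close>

definition residual_sum ::
  "real measure \<Rightarrow> nat \<Rightarrow> (nat \<Rightarrow> nat \<Rightarrow> real) \<Rightarrow> (nat \<Rightarrow> real) \<Rightarrow> (nat \<Rightarrow> real) \<Rightarrow> (nat \<Rightarrow> real) \<Rightarrow> real" where
  "residual_sum \<nu> n A h c y = (\<Sum>i<n. c i * (y i - cond_mean \<nu> n A h y i))"

lemma local_field_upd_same [simp]: "local_field n A (y(i := u)) i = local_field n A y i"
  unfolding local_field_def by (intro sum.cong) auto

lemma local_field_upd_other:
  assumes "i < n" "i \<noteq> j"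
  shows "local_field n A (y(i := 0)) j = local_field n A y j - A j i * y i"
proof -
  have i: "i \<in> {..<n} - {j}" using assms by auto
  have "(\<Sum>k\<in>{..<n} - {j} - {i}. A j k * (y(i := 0)) k) = (\<Sum>k\<in>{..<n} - {j} - {i}. A j k * y k)"
    by (intro sum.cong) auto
  then show ?thesis
    unfolding local_field_def using sum.remove[OF _ i, of "\<lambda>k. A j k * (y(i := 0)) k"]
      sum.remove[OF _ i, of "\<lambda>k. A j k * y k"] by simp
qed

lemma quad_form_upd:
  assumes "symmetric_matrix n A" and i: "i < n"
  shows "quad_form n A (y(i := u)) = quad_form n A (y(i := 0)) + A i i * u\<^sup>2 + 2 * u * local_field n A y i"
proof -
  define z where "z = y(i := 0)"
  define e where "e j = (if j = i then u else 0)" for j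
  have z: "(y(i := u)) j = z j + e j" for j by (simp add: z_def e_def)
  have lf: "(\<Sum>j<n. A i j * z j) = local_field n A y i"
    unfolding local_field_def z_def
    using sum.remove[of "{..<n}" i "\<lambda>j. A i j * (y(i := 0)) j"] i by (auto intro!: sum.cong)
  have lf': "(\<Sum>j<n. z j * A j i) = local_field n A y i"
    unfolding lf[symmetric] using assms by (intro sum.cong) (auto simp: symmetric_matrix_def)
  have row: "(\<Sum>k<n. f k * e k) = f i * u" for f
    using i by (simp add: e_def if_distrib[of "(*) _"] cong: if_cong)
  have "quad_form n A (y(i := u)) = (\<Sum>j<n. \<Sum>k<n. z j * A j k * z k)
      + (\<Sum>j<n. \<Sum>k<n. (z j * A j k) * e k)
      + (\<Sum>j<n. (\<Sum>k<n. A j k * z k) * e j) + (\<Sum>j<n. (\<Sum>k<n. A j k * e k) * e j)"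
    unfolding quad_form_def z
    by (simp add: sum.distrib[symmetric] sum_distrib_left sum_distrib_right algebra_simps)
  also have "(\<Sum>j<n. \<Sum>k<n. (z j * A j k) * e k) = u * local_field n A y i"
    unfolding row lf'[symmetric] by (simp add: sum_distrib_left mult_ac)
  also have "(\<Sum>j<n. (\<Sum>k<n. A j k * z k) * e j) = u * local_field n A y i"
    unfolding row lf by simp
  also have "(\<Sum>j<n. (\<Sum>k<n. A j k * e k) * e j) = A i i * u\<^sup>2"
    unfolding row by (simp add: power2_eq_square)
  finally show ?thesis by (simp add: quad_form_def z_def)
qed

text \<open>
  As a function of the single coordinate \<open>i\<close>, a Gibbs weight is a tilt of the base measure, which
  identifies all conditional laws. Taking \<open>y(i := 0)\<close> as reference point gives a factor that does
  not involve \<open>y i\<close>, even if \<open>0\<close> is outside the support.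
\<close>

lemma gibbs_weight_upd:
  assumes "symmetric_matrix n A" and i: "i < n"
  shows "gibbs_weight n A h (y(i := u))
    = gibbs_weight n A h (y(i := 0)) * exp (A i i * u\<^sup>2 / 2 + (local_field n A y i + h i) * u)"
proof -
  have "(\<Sum>j<n. (y(i := v)) j * h j) = v * h i + (\<Sum>j\<in>{..<n} - {i}. y j * h j)" for v
    using sum.remove[of "{..<n}" i "\<lambda>j. (y(i := v)) j * h j"] i by (auto intro!: sum.cong)
  from this[of u] this[of 0] show ?thesis
    unfolding gibbs_weight_def quad_form_upd[OF assms, of y u] exp_add[symmetric]
    by (simp add: field_simps)
qed

lemma gibbs_exponent_le:
  assumes "\<And>i. i < n \<Longrightarrow> \<bar>y i\<bar> \<le> (1::real)"
  shows "\<bar>quad_form n A y / 2 + (\<Sum>i<n. y i * h i)\<bar> \<le> (\<Sum>i<n. \<Sum>j<n. \<bar>A i j\<bar>) / 2 + (\<Sum>i<n. \<bar>h i\<bar>)"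
proof -
  have "\<bar>quad_form n A y\<bar> \<le> (\<Sum>i<n. \<Sum>j<n. \<bar>A i j\<bar>)"
    unfolding quad_form_def
  proof (intro order_trans[OF sum_abs] sum_mono)
    fix i j assume "i \<in> {..<n}" "j \<in> {..<n}"
    then have "\<bar>y i\<bar> * \<bar>A i j\<bar> * \<bar>y j\<bar> \<le> 1 * \<bar>A i j\<bar> * 1" using assms by (intro mult_mono) auto
    then show "\<bar>y i * A i j * y j\<bar> \<le> \<bar>A i j\<bar>" by (simp add: abs_mult)
  qed
  moreover have "\<bar>\<Sum>i<n. y i * h i\<bar> \<le> (\<Sum>i<n. \<bar>h i\<bar>)"
  proof (intro order_trans[OF sum_abs] sum_mono)
    fix i assume "i \<in> {..<n}"
    then have "\<bar>y i\<bar> * \<bar>h i\<bar> \<le> 1 * \<bar>h i\<bar>" using assms by (intro mult_mono) auto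
    then show "\<bar>y i * h i\<bar> \<le> \<bar>h i\<bar>" by (simp add: abs_mult)
  qed
  ultimately show ?thesis by linarith
qed

lemma residual_sum_inner:
  "residual_sum \<nu> n A h (\<lambda>i. x i \<bullet> v) y = (\<Sum>k\<in>UNIV. v $ k * residual_sum \<nu> n A h (\<lambda>i. x i $ k) y)"
  for x :: "nat \<Rightarrow> real^'d"
  unfolding residual_sum_def inner_vec_def sum_distrib_left sum_distrib_right
  by (subst sum.swap) (simp add: mult_ac)

lemma measurable_local_field:
  assumes "\<And>j. j < n \<Longrightarrow> (\<lambda>w. g w j) \<in> borel_measurable M"
  shows "(\<lambda>w. local_field n A (g w) i) \<in> borel_measurable M"
  unfolding local_field_def using assms by (intro borel_measurable_sum borel_measurable_times) auto

lemma measurable_gibbs_weight: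
  assumes "\<And>j. j < n \<Longrightarrow> (\<lambda>w. g w j) \<in> borel_measurable M"
    and "\<And>j. j < n \<Longrightarrow> (\<lambda>w. h w j) \<in> borel_measurable M"
  shows "(\<lambda>w. gibbs_weight n A (h w) (g w)) \<in> borel_measurable M"
proof -
  have "(\<lambda>w. \<Sum>i<n. \<Sum>j<n. g w i * A i j * g w j) \<in> borel_measurable M"
    using assms(1) by (intro borel_measurable_sum borel_measurable_times borel_measurable_const) auto
  moreover have "(\<lambda>w. \<Sum>i<n. g w i * h w i) \<in> borel_measurable M"
    using assms by (intro borel_measurable_sum borel_measurable_times) auto
  ultimately show ?thesis unfolding gibbs_weight_def quad_form_def by simp
qed

context bounded_base
begin

lemma measurable_cond_mean:
  assumes "\<And>j. j < n \<Longrightarrow> (\<lambda>w. g w j) \<in> borel_measurable M"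
    and "\<And>j. j < n \<Longrightarrow> (\<lambda>w. h w j) \<in> borel_measurable M" and "i < n"
  shows "(\<lambda>w. cond_mean \<nu> n A (h w) (g w) i) \<in> borel_measurable M"
  unfolding cond_mean_def
  by (rule measurable_compose[OF _ borel_measurable_tilted_mean])
     (use assms in \<open>intro borel_measurable_add measurable_local_field; simp\<close>)

lemma measurable_residual_sum:
  assumes "\<And>j. j < n \<Longrightarrow> (\<lambda>w. g w j) \<in> borel_measurable M"
    and "\<And>j. j < n \<Longrightarrow> (\<lambda>w. h w j) \<in> borel_measurable M"
    and "\<And>j. j < n \<Longrightarrow> (\<lambda>w. c w j) \<in> borel_measurable M"
  shows "(\<lambda>w. residual_sum \<nu> n A (h w) (c w) (g w)) \<in> borel_measurable M"
  unfolding residual_sum_def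
  by (intro borel_measurable_sum borel_measurable_times borel_measurable_diff measurable_cond_mean assms) auto

lemma abs_residual_le:
  assumes "\<bar>y i\<bar> \<le> 1" "\<bar>c\<bar> \<le> 1"
  shows "\<bar>c * (y i - cond_mean \<nu> n A h y i)\<bar> \<le> 2"
proof -
  have "\<bar>y i - cond_mean \<nu> n A h y i\<bar> \<le> 2"
    unfolding cond_mean_def using abs_tilted_mean_le[of "A i i" "local_field n A y i + h i"] assms by linarith
  then have "\<bar>c\<bar> * \<bar>y i - cond_mean \<nu> n A h y i\<bar> \<le> 1 * 2" using assms by (intro mult_mono) auto
  then show ?thesis by (simp add: abs_mult)
qed

text \<open>
  Setting \<open>y i\<close> to \<open>0\<close> changes the conditional mean at \<open>j\<close> by \<open>v j * A j i * y i\<close> up to a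
  remainder of order \<open>(A j i)\<^sup>2\<close>. Bounding the first-order terms one by one would cost
  \<open>\<Sum>\<bar>A j i\<bar>\<close>, which may be of order \<open>n powr (3 / 2)\<close>; together they form a bilinear form in \<open>A\<close>,
  bounded by \<open>\<rho>\<close> times two Euclidean norms of order \<open>\<surd>n\<close>. This is why the expansion goes to second
  order: the remainders are summable thanks to \<open>\<Sum>\<^sub>j (A j i)\<^sup>2 \<le> \<rho>\<^sup>2\<close>.
\<close>

lemma sum_residual_increments_le:
  assumes sym: "symmetric_matrix n A" and \<rho>: "op_norm n A \<le> \<rho>"
    and y: "\<And>i. i < n \<Longrightarrow> \<bar>y i\<bar> \<le> 1" and c: "\<And>i. i < n \<Longrightarrow> \<bar>c i\<bar> \<le> 1"
  shows "(\<Sum>i<n. c i * (y i - cond_mean \<nu> n A h y i)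
      * (residual_sum \<nu> n A h c y - residual_sum \<nu> n A h c (y(i := 0)))) \<le> (2 + 4 * \<rho> + 12 * \<rho>\<^sup>2) * n"
proof -
  let ?F = "residual_sum \<nu> n A h c"
  have \<rho>0: "\<rho> \<ge> 0" using op_norm_nonneg[of n A] \<rho> by linarith
  define p where "p i = c i * (y i - cond_mean \<nu> n A h y i)" for i
  have p: "\<bar>p i\<bar> \<le> 2" if "i < n" for i unfolding p_def using y c that by (intro abs_residual_le) auto
  define v where "v j = tilted_var \<nu> (A j j) (local_field n A y j + h j)" for j
  have v: "\<bar>v j\<bar> \<le> 1" for j
    using tilted_var_le_1[of "A j j" "local_field n A y j + h j"] tilted_var_pos[of "A j j" "local_field n A y j + h j"]
    unfolding v_def by linarith
  define R where "R i j = cond_mean \<nu> n A h y j - cond_mean \<nu> n A h (y(i := 0)) j - v j * (A j i * y i)" for i j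
  have R: "\<bar>R i j\<bar> \<le> 6 * (A j i)\<^sup>2" if "i < n" "j < n" "i \<noteq> j" for i j
  proof -
    have "\<bar>R i j\<bar> \<le> 6 * (A j i * y i)\<^sup>2"
      unfolding R_def cond_mean_def v_def local_field_upd_other[OF that(1,3)]
      using tilted_mean_taylor[of "A j j" "local_field n A y j + h j" "A j i * y i"]
      by (simp add: algebra_simps)
    also have "(A j i * y i)\<^sup>2 \<le> (A j i)\<^sup>2 * 1"
      unfolding power_mult_distrib using y[OF that(1)] by (intro mult_left_mono) (auto simp: abs_square_le_1)
    finally show ?thesis by simp
  qed
  define q where "q j = c j * v j" for j
  have q: "\<bar>q j\<bar> \<le> 1" if "j < n" for j
    unfolding q_def abs_mult using v c[OF that] by (intro mult_le_one) auto
  \<comment> \<open>The first-order term of the increments, summed over \<open>i\<close>, is the bilinear form \<open>\<Sum>\<^sub>i r i * (A q) i\<close>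
    without its diagonal.\<close>
  define r where "r i = p i * y i" for i
  have r: "\<bar>r i\<bar> \<le> 2" if "i < n" for i
    using mult_mono[OF p[OF that] y[OF that]] by (simp add: r_def abs_mult)
  have incr: "?F y - ?F (y(i := 0))
      = c i * y i - (mat_vec n A q i - A i i * q i) * y i - (\<Sum>j\<in>{..<n} - {i}. c j * R i j)"
    if i: "i < n" for i
  proof -
    have "?F y - ?F (y(i := 0))
      = (\<Sum>j<n. c j * (y j - (y(i := 0)) j) - c j * (cond_mean \<nu> n A h y j - cond_mean \<nu> n A h (y(i := 0)) j))"
      unfolding residual_sum_def sum_subtractf[symmetric] by (intro sum.cong) (auto simp: algebra_simps)
    also have "\<dots> = c i * y i + (\<Sum>j\<in>{..<n} - {i}. - (c j * (v j * (A j i * y i) + R i j)))"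
      using i by (subst sum.remove[of _ i]) (auto simp: cond_mean_def R_def intro!: sum.cong)
    also have "\<dots> = c i * y i - (\<Sum>j\<in>{..<n} - {i}. A i j * q j) * y i - (\<Sum>j\<in>{..<n} - {i}. c j * R i j)"
      using sym i unfolding sum_negf[symmetric] sum_distrib_right q_def symmetric_matrix_def
      by (simp add: sum.distrib algebra_simps sum_negf sum_subtractf)
    also have "(\<Sum>j\<in>{..<n} - {i}. A i j * q j) = mat_vec n A q i - A i i * q i"
      using i by (simp add: local_field_mat_vec[symmetric] local_field_def)
    finally show ?thesis .
  qed
  have "(\<Sum>i<n. p i * (?F y - ?F (y(i := 0))))
    = (\<Sum>i<n. p i * (c i * y i) - r i * mat_vec n A q i + r i * (A i i * q i)
        - (\<Sum>j\<in>{..<n} - {i}. p i * (c j * R i j)))"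
    by (intro sum.cong) (auto simp: incr r_def algebra_simps sum_distrib_left)
  also have "\<dots> = (\<Sum>i<n. p i * (c i * y i)) - (\<Sum>i<n. r i * mat_vec n A q i)
      + (\<Sum>i<n. r i * (A i i * q i)) - (\<Sum>i<n. \<Sum>j\<in>{..<n} - {i}. p i * (c j * R i j))"
    by (simp add: sum_subtractf sum.distrib)
  also have "\<dots> \<le> 2 * n + 2 * \<rho> * n + 2 * \<rho> * n + 12 * \<rho>\<^sup>2 * n"
  proof -
    have "(\<Sum>i<n. p i * (c i * y i)) \<le> (\<Sum>i<n. 2)"
    proof (rule sum_mono)
      fix i assume "i \<in> {..<n}"
      then have "\<bar>p i\<bar> * (\<bar>c i\<bar> * \<bar>y i\<bar>) \<le> 2 * (1 * 1)"
        using p c y by (intro mult_mono) auto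
      then show "p i * (c i * y i) \<le> 2" by (simp add: abs_mult[symmetric])
    qed
    moreover have "\<bar>\<Sum>i<n. r i * mat_vec n A q i\<bar> \<le> 2 * \<rho> * n"
    proof -
      have "(r i)\<^sup>2 \<le> 2\<^sup>2" "(q i)\<^sup>2 \<le> 1" if "i < n" for i
        using power_mono[OF r[OF that], of 2] power_mono[OF q[OF that], of 2] by simp_all
      then have "L2_set r {..<n} \<le> sqrt (\<Sum>i<n. 2\<^sup>2)" "L2_set q {..<n} \<le> sqrt (\<Sum>i<n. 1)"
        unfolding L2_set_def by (intro real_sqrt_le_mono sum_mono; simp)+
      then have "L2_set r {..<n} * L2_set q {..<n} \<le> (2 * sqrt n) * sqrt n"
        by (intro mult_mono) (auto simp: real_sqrt_mult mult.commute)
      also have "\<dots> = 2 * n" by (simp add: mult.assoc)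
      finally have "\<rho> * (L2_set r {..<n} * L2_set q {..<n}) \<le> \<rho> * (2 * n)"
        using \<rho>0 by (intro mult_left_mono) auto
      with bilinear_form_le[OF \<rho>, of r q] show ?thesis by (simp add: mult_ac)
    qed
    moreover have "(\<Sum>i<n. r i * (A i i * q i)) \<le> (\<Sum>i<n. 2 * \<rho>)"
    proof (rule sum_mono)
      fix i assume "i \<in> {..<n}"
      then have "\<bar>r i\<bar> * (\<bar>A i i\<bar> * \<bar>q i\<bar>) \<le> 2 * (\<rho> * 1)"
        using r q entry_le[OF \<rho>, of i i] by (intro mult_mono) auto
      then show "r i * (A i i * q i) \<le> 2 * \<rho>" by (simp add: abs_mult[symmetric])
    qed
    moreover have "- (\<Sum>i<n. \<Sum>j\<in>{..<n} - {i}. p i * (c j * R i j)) \<le> 12 * \<rho>\<^sup>2 * n"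
    proof -
      have "- (\<Sum>i<n. \<Sum>j\<in>{..<n} - {i}. p i * (c j * R i j)) = (\<Sum>i<n. \<Sum>j\<in>{..<n} - {i}. - (p i * (c j * R i j)))"
        by (simp add: sum_negf)
      also have "\<dots> \<le> (\<Sum>i<n. \<Sum>j\<in>{..<n} - {i}. 12 * (A j i)\<^sup>2)"
      proof (intro sum_mono)
        fix i j assume "i \<in> {..<n}" "j \<in> {..<n} - {i}"
        then have "\<bar>p i\<bar> * (\<bar>c j\<bar> * \<bar>R i j\<bar>) \<le> 2 * (1 * (6 * (A j i)\<^sup>2))"
          using p c R by (intro mult_mono) auto
        then show "- (p i * (c j * R i j)) \<le> 12 * (A j i)\<^sup>2" by (simp add: abs_mult[symmetric])
      qed
      also have "\<dots> \<le> (\<Sum>i<n. \<Sum>j<n. 12 * (A j i)\<^sup>2)"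
        by (intro sum_mono sum_mono2) auto
      also have "\<dots> \<le> (\<Sum>i<n. 12 * \<rho>\<^sup>2)"
        unfolding sum_distrib_left[symmetric] using column_sq_le[OF \<rho>] by (intro sum_mono mult_left_mono) auto
      finally show ?thesis by (simp add: mult_ac)
    qed
    ultimately show ?thesis by (simp add: mult_ac)
  qed
  finally show ?thesis by (simp add: p_def distrib_right)
qed

abbreviation base :: "nat \<Rightarrow> (nat \<Rightarrow> real) measure" where
  "base n \<equiv> PiM {..<n} (\<lambda>_. \<nu>)"

lemma finite_measure_base: "finite_measure (base n)"
  by (intro finite_measure_PiM finite_measure_axioms) auto

lemma AE_base: "AE y in base n. \<forall>i\<in>{..<n}. \<bar>y i\<bar> \<le> 1"
  by (intro AE_finite_allI AE_PiM_coordinate finite_measure_axioms AE_bounded) auto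

lemma measurable_coordinate [measurable]: "i < n \<Longrightarrow> (\<lambda>y. y i) \<in> borel_measurable (base n)"
  by (rule measurable_compose[OF measurable_component_singleton[of i "{..<n}" "\<lambda>_. \<nu>"] id_measurable]) simp

lemma integrable_base:
  fixes f :: "(nat \<Rightarrow> real) \<Rightarrow> real"
  assumes "f \<in> borel_measurable (base n)" and "\<And>y. (\<And>i. i < n \<Longrightarrow> \<bar>y i\<bar> \<le> 1) \<Longrightarrow> \<bar>f y\<bar> \<le> K"
  shows "integrable (base n) f"
proof (rule finite_measure.integrable_const_bound[OF finite_measure_base _ assms(1), where B = K])
  show "AE y in base n. norm (f y) \<le> K"
    using AE_base by eventually_elim (use assms(2) in auto)
qed

lemma integrable_gibbs:
  fixes f :: "(nat \<Rightarrow> real) \<Rightarrow> real"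
  assumes [measurable]: "f \<in> borel_measurable (base n)"
    and f: "\<And>y. (\<And>i. i < n \<Longrightarrow> \<bar>y i\<bar> \<le> 1) \<Longrightarrow> \<bar>f y\<bar> \<le> K"
  shows "integrable (base n) (\<lambda>y. gibbs_weight n A h y * f y)"
proof (rule integrable_base)
  have [measurable]: "gibbs_weight n A h \<in> borel_measurable (base n)"
    by (rule measurable_gibbs_weight) auto
  show "(\<lambda>y. gibbs_weight n A h y * f y) \<in> borel_measurable (base n)" by measurable
  let ?E = "exp ((\<Sum>i<n. \<Sum>j<n. \<bar>A i j\<bar>) / 2 + (\<Sum>i<n. \<bar>h i\<bar>))"
  show "\<bar>gibbs_weight n A h y * f y\<bar> \<le> ?E * K" if "\<And>i. i < n \<Longrightarrow> \<bar>y i\<bar> \<le> 1" for y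
    unfolding abs_mult gibbs_weight_def abs_exp_cancel
    using gibbs_exponent_le[where A = A and h = h, OF that] f[OF that]
    by (intro mult_mono) (auto simp: abs_le_iff)
qed

lemma integrable_gibbs_weight: "integrable (base n) (gibbs_weight n A h)"
  using integrable_gibbs[of "\<lambda>_. 1" n 1 A h] by simp

lemma gibbs_normalizer_pos: "(\<integral>y. gibbs_weight n A h y \<partial>base n) > 0"
proof -
  let ?E = "exp (- ((\<Sum>i<n. \<Sum>j<n. \<bar>A i j\<bar>) / 2 + (\<Sum>i<n. \<bar>h i\<bar>)))"
  have "0 < measure (base n) (space (base n)) * ?E"
    using mass_pos by (simp add: finite_measure_PiM finite_measure_axioms mass_def)
  also have "\<dots> = (\<integral>y. ?E \<partial>base n)" by simp
  also have "\<dots> \<le> (\<integral>y. gibbs_weight n A h y \<partial>base n)"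
  proof (rule integral_mono_AE)
    show "AE y in base n. ?E \<le> gibbs_weight n A h y"
      using AE_base
    proof eventually_elim
      case (elim y)
      then show ?case unfolding gibbs_weight_def using gibbs_exponent_le[of n y A h] by (auto simp: abs_le_iff)
    qed
  qed (auto intro: integrable_gibbs_weight integrable_base)
  finally show ?thesis .
qed

text \<open>
  The integrand is linear in the residual \<open>y i - b i\<close> along coordinate \<open>i\<close>, and the Gibbs weight is a
  tilt along that coordinate whose mean is exactly \<open>b i\<close>.
\<close>

lemma conditional_centering:
  assumes sym: "symmetric_matrix n A" and i: "i < n"
    and g [measurable]: "g \<in> borel_measurable (base n)"
    and bound: "\<And>y. (\<And>i. i < n \<Longrightarrow> \<bar>y i\<bar> \<le> 1) \<Longrightarrow> \<bar>g y\<bar> \<le> K"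
    and free: "\<And>y u. g (y(i := u)) = g y"
  shows "(\<integral>y. gibbs_weight n A h y * ((y i - cond_mean \<nu> n A h y i) * g y) \<partial>base n) = 0"
proof (rule integral_PiM_eq_0[OF finite_measure_axioms i])
  have [measurable]: "(\<lambda>y. cond_mean \<nu> n A h y i) \<in> borel_measurable (base n)"
    by (rule measurable_cond_mean) (use i in auto)
  show "integrable (base n) (\<lambda>y. gibbs_weight n A h y * ((y i - cond_mean \<nu> n A h y i) * g y))"
  proof (rule integrable_gibbs[where K = "2 * K"])
    show "\<bar>(y i - cond_mean \<nu> n A h y i) * g y\<bar> \<le> 2 * K" if "\<And>i. i < n \<Longrightarrow> \<bar>y i\<bar> \<le> 1" for y
      unfolding abs_mult using abs_residual_le[of y i 1 n A h] that i bound[OF that] by (intro mult_mono) auto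
  qed (use i in measurable)
  fix y
  let ?s = "local_field n A y i + h i" and ?W = "gibbs_weight n A h (y(i := 0)) * g y"
  have "(\<integral>u. gibbs_weight n A h (y(i := u)) * (((y(i := u)) i - cond_mean \<nu> n A h (y(i := u)) i) * g (y(i := u))) \<partial>\<nu>)
    = (\<integral>u. ?W * (u ^ 1 * exp (A i i * u\<^sup>2 / 2 + ?s * u)
        - tilted_mean \<nu> (A i i) ?s * (u ^ 0 * exp (A i i * u\<^sup>2 / 2 + ?s * u))) \<partial>\<nu>)"
  proof (intro Bochner_Integration.integral_cong refl)
    fix u
    show "gibbs_weight n A h (y(i := u)) * (((y(i := u)) i - cond_mean \<nu> n A h (y(i := u)) i) * g (y(i := u)))
      = ?W * (u ^ 1 * exp (A i i * u\<^sup>2 / 2 + ?s * u)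
        - tilted_mean \<nu> (A i i) ?s * (u ^ 0 * exp (A i i * u\<^sup>2 / 2 + ?s * u)))"
      unfolding gibbs_weight_upd[OF sym i, of h y u] free cond_mean_def by (simp add: algebra_simps)
  qed
  also have "\<dots> = ?W * (moment \<nu> (A i i) 1 ?s - tilted_mean \<nu> (A i i) ?s * moment \<nu> (A i i) 0 ?s)"
    unfolding moment_def using integrable_moment[of 0 "A i i" ?s] integrable_moment[of 1 "A i i" ?s] by simp
  also have "\<dots> = 0"
    using less_imp_neq[OF moment_0_pos[of "A i i" ?s]] by (simp add: tilted_mean_def)
  finally show "(\<integral>u. gibbs_weight n A h (y(i := u)) *
      (((y(i := u)) i - cond_mean \<nu> n A h (y(i := u)) i) * g (y(i := u))) \<partial>\<nu>) = 0" .
qed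

lemma abs_residual_sum_le:
  assumes "\<And>i. i < n \<Longrightarrow> \<bar>y i\<bar> \<le> 1" "\<And>i. i < n \<Longrightarrow> \<bar>c i\<bar> \<le> 1"
  shows "\<bar>residual_sum \<nu> n A h c y\<bar> \<le> 2 * n"
proof -
  have "\<bar>residual_sum \<nu> n A h c y\<bar> \<le> (\<Sum>i<n. 2)"
    unfolding residual_sum_def
    by (intro order_trans[OF sum_abs] sum_mono abs_residual_le) (use assms in auto)
  then show ?thesis by simp
qed

text \<open>
  For \<open>F = \<Sum>\<^sub>i c\<^sub>i (y\<^sub>i - b\<^sub>i)\<close> one has \<open>E F\<^sup>2 = \<Sum>\<^sub>i c\<^sub>i E[(y\<^sub>i - b\<^sub>i) (F - F\<^sub>i)]\<close>, where \<open>F\<^sub>i\<close> is \<open>F\<close> evaluated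
  at \<open>y(i := 0)\<close>, by conditional centring; the sum inside the expectation is bounded pointwise.
\<close>

theorem residual_sum_second_moment:
  assumes sym: "symmetric_matrix n A" and \<rho>: "op_norm n A \<le> \<rho>"
    and c: "\<And>i. i < n \<Longrightarrow> \<bar>c i\<bar> \<le> 1"
  shows "(\<integral>y. gibbs_weight n A h y * (residual_sum \<nu> n A h c y)\<^sup>2 \<partial>base n)
    \<le> (2 + 4 * \<rho> + 12 * \<rho>\<^sup>2) * n * (\<integral>y. gibbs_weight n A h y \<partial>base n)"
proof -
  let ?W = "gibbs_weight n A h" and ?F = "residual_sum \<nu> n A h c"
  let ?r = "\<lambda>i y. y i - cond_mean \<nu> n A h y i"
  define C where "C = (2 + 4 * \<rho> + 12 * \<rho>\<^sup>2) * n"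
  have [measurable]: "?F \<in> borel_measurable (base n)"
    by (rule measurable_residual_sum) auto
  have mF0 [measurable]: "(\<lambda>y. ?F (y(i := 0))) \<in> borel_measurable (base n)" if "i < n" for i
    by (rule measurable_residual_sum) auto
  have [measurable]: "(\<lambda>y. cond_mean \<nu> n A h y i) \<in> borel_measurable (base n)" if "i < n" for i
    by (rule measurable_cond_mean) (use that in auto)
  have F_le: "\<bar>?F y\<bar> \<le> 2 * n" if "\<And>i. i < n \<Longrightarrow> \<bar>y i\<bar> \<le> 1" for y
    using that c by (rule abs_residual_sum_le)
  have F0_le: "\<bar>?F (y(i := 0))\<bar> \<le> 2 * n" if "\<And>i. i < n \<Longrightarrow> \<bar>y i\<bar> \<le> 1" for y i
    using that c by (intro abs_residual_sum_le) auto
  have int: "integrable (base n) (\<lambda>y. ?W y * (?r i y * f y))"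
    if [measurable]: "f \<in> borel_measurable (base n)" and f: "\<And>y. (\<And>i. i < n \<Longrightarrow> \<bar>y i\<bar> \<le> 1) \<Longrightarrow> \<bar>f y\<bar> \<le> K"
      and i: "i < n" for i f K
  proof (rule integrable_gibbs[where K = "2 * K"])
    show "\<bar>?r i y * f y\<bar> \<le> 2 * K" if "\<And>i. i < n \<Longrightarrow> \<bar>y i\<bar> \<le> 1" for y
      unfolding abs_mult using abs_residual_le[of y i 1 n A h] that i f[OF that] by (intro mult_mono) auto
  qed (use i in measurable)
  have intF: "integrable (base n) (\<lambda>y. ?W y * (?r i y * ?F y))" if "i < n" for i
    by (rule int) (use F_le that in auto)
  have intF0: "integrable (base n) (\<lambda>y. ?W y * (?r i y * ?F (y(i := 0))))" if "i < n" for i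
    by (rule int) (use F0_le that in auto)
  have zero: "(\<integral>y. ?W y * (?r i y * ?F (y(i := 0))) \<partial>base n) = 0" if "i < n" for i
    by (rule conditional_centering[OF sym that]) (use F0_le that in auto)
  have "(\<integral>y. ?W y * (?F y)\<^sup>2 \<partial>base n) = (\<integral>y. (\<Sum>i<n. c i * (?W y * (?r i y * ?F y))) \<partial>base n)"
    by (intro Bochner_Integration.integral_cong refl)
       (simp add: power2_eq_square residual_sum_def[of \<nu> n A h c] sum_distrib_left sum_distrib_right mult_ac)
  also have "\<dots> = (\<Sum>i<n. c i * (\<integral>y. ?W y * (?r i y * ?F y) \<partial>base n))"
    by (subst Bochner_Integration.integral_sum) (simp_all add: intF)
  also have "\<dots> = (\<Sum>i<n. c i * (\<integral>y. ?W y * (?r i y * ?F y) - ?W y * (?r i y * ?F (y(i := 0))) \<partial>base n))"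
    by (intro sum.cong) (auto simp: Bochner_Integration.integral_diff[OF intF intF0] zero)
  also have "\<dots> = (\<integral>y. (\<Sum>i<n. c i * (?W y * (?r i y * ?F y) - ?W y * (?r i y * ?F (y(i := 0))))) \<partial>base n)"
    by (subst Bochner_Integration.integral_sum) (simp_all add: intF intF0)
  also have "\<dots> \<le> (\<integral>y. C * ?W y \<partial>base n)"
  proof (rule integral_mono_AE)
    show "AE y in base n. (\<Sum>i<n. c i * (?W y * (?r i y * ?F y) - ?W y * (?r i y * ?F (y(i := 0))))) \<le> C * ?W y"
      using AE_base
    proof eventually_elim
      case (elim y)
      have "(\<Sum>i<n. c i * (?W y * (?r i y * ?F y) - ?W y * (?r i y * ?F (y(i := 0)))))
          = ?W y * (\<Sum>i<n. c i * ?r i y * (?F y - ?F (y(i := 0))))"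
        unfolding sum_distrib_left by (intro sum.cong) (auto simp: algebra_simps)
      also have "\<dots> \<le> ?W y * C"
        unfolding C_def using elim sum_residual_increments_le[OF sym \<rho>, of y c h] c
        by (intro mult_left_mono) (auto simp: gibbs_weight_def)
      finally show ?case by (simp add: mult.commute)
    qed
    show "integrable (base n) (\<lambda>y. \<Sum>i<n. c i * (?W y * (?r i y * ?F y) - ?W y * (?r i y * ?F (y(i := 0)))))"
      by (intro Bochner_Integration.integrable_sum integrable_mult_right Bochner_Integration.integrable_diff intF intF0) auto
    show "integrable (base n) (\<lambda>y. C * ?W y)"
      by (intro integrable_mult_right integrable_gibbs_weight)
  qed
  finally show ?thesis by (simp add: C_def)
qed

lemma nn_integral_normalized_gibbs:
  "(\<integral>\<^sup>+y. ennreal (normalized (base n) (gibbs_weight n A h) y) \<partial>base n) = 1"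
proof -
  let ?Z = "\<integral>y. gibbs_weight n A h y \<partial>base n"
  have "(\<integral>\<^sup>+y. ennreal (gibbs_weight n A h y / ?Z) \<partial>base n) = ennreal (\<integral>y. gibbs_weight n A h y / ?Z \<partial>base n)"
    using gibbs_normalizer_pos[of n A h]
    by (intro nn_integral_eq_integral integrable_divide integrable_gibbs_weight) (auto simp: gibbs_weight_def)
  then show ?thesis using gibbs_normalizer_pos[of n A h] by (simp add: normalized_def)
qed

lemma nn_integral_residual_sum_sq_le:
  assumes sym: "symmetric_matrix n A" and \<rho>: "op_norm n A \<le> \<rho>"
    and c: "\<And>i. i < n \<Longrightarrow> \<bar>c i\<bar> \<le> 1"
  shows "(\<integral>\<^sup>+y. ennreal (normalized (base n) (gibbs_weight n A h) y) * ennreal ((residual_sum \<nu> n A h c y)\<^sup>2) \<partial>base n)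
    \<le> ennreal ((2 + 4 * \<rho> + 12 * \<rho>\<^sup>2) * n)"
proof -
  let ?Z = "\<integral>y. gibbs_weight n A h y \<partial>base n" and ?F = "residual_sum \<nu> n A h c"
  have [measurable]: "?F \<in> borel_measurable (base n)"
    by (rule measurable_residual_sum) auto
  have int: "integrable (base n) (\<lambda>y. gibbs_weight n A h y * (?F y)\<^sup>2)"
  proof (rule integrable_gibbs)
    show "\<bar>(?F y)\<^sup>2\<bar> \<le> (2 * n)\<^sup>2" if "\<And>i. i < n \<Longrightarrow> \<bar>y i\<bar> \<le> 1" for y
      using power_mono[OF abs_residual_sum_le[of n y c A h], of 2] that c by simp
  qed simp
  have "(\<integral>\<^sup>+y. ennreal (normalized (base n) (gibbs_weight n A h) y) * ennreal ((?F y)\<^sup>2) \<partial>base n)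
      = (\<integral>\<^sup>+y. ennreal (gibbs_weight n A h y * (?F y)\<^sup>2 / ?Z) \<partial>base n)"
    using gibbs_normalizer_pos[of n A h]
    by (intro nn_integral_cong) (simp add: normalized_def ennreal_mult[symmetric] gibbs_weight_def)
  also have "\<dots> = ennreal (\<integral>y. gibbs_weight n A h y * (?F y)\<^sup>2 / ?Z \<partial>base n)"
    using gibbs_normalizer_pos[of n A h] int
    by (intro nn_integral_eq_integral) (auto simp: gibbs_weight_def)
  also have "\<dots> = ennreal ((\<integral>y. gibbs_weight n A h y * (?F y)\<^sup>2 \<partial>base n) / ?Z)" by simp
  also have "\<dots> \<le> ennreal ((2 + 4 * \<rho> + 12 * \<rho>\<^sup>2) * n)"
    using residual_sum_second_moment[where h = h, OF assms] gibbs_normalizer_pos[of n A h]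
    by (intro ennreal_leI) (simp add: pos_divide_le_eq)
  finally show ?thesis .
qed

end

section \<open>Measurability of a unique maximizer\<close>

locale continuous_objective =
  fixes M :: "'w measure" and f :: "'w \<Rightarrow> 'b::euclidean_space \<Rightarrow> real" and S :: "'b set"
  assumes objective_measurable [measurable]: "\<And>b. (\<lambda>w. f w b) \<in> borel_measurable M"
    and objective_continuous: "\<And>w. w \<in> space M \<Longrightarrow> continuous_on S (f w)"
    and S_closed: "closed S" and S_nonempty: "S \<noteq> {}"
begin

definition maximizer :: "'w \<Rightarrow> 'b \<Rightarrow> bool" where
  "maximizer w b \<longleftrightarrow> is_arg_max (f w) (\<lambda>b. b \<in> S) b"

lemma maximizer_iff: "maximizer w b \<longleftrightarrow> b \<in> S \<and> (\<forall>b'\<in>S. f w b' \<le> f w b)"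
  unfolding maximizer_def is_arg_max_def by (auto simp: not_less)

text \<open>
  By compactness of \<open>F\<close> a maximizer lies in \<open>F\<close> iff the supremum over \<open>F\<close> is as large as every
  value on \<open>S\<close>, and by continuity both sides can be tested on countable dense subsets. Only
  values are compared, which makes sense also on an unbounded \<open>S\<close> where the supremum may not be
  attained.
\<close>

lemma sets_maximizer_in_compact [measurable]:
  assumes F: "F \<subseteq> S" "compact F"
  shows "{w \<in> space M. \<exists>b\<in>F. maximizer w b} \<in> sets M"
proof -
  obtain D where D: "countable D" "D \<subseteq> S" "S \<subseteq> closure D" using separable[of S] by blast
  obtain E where E: "countable E" "E \<subseteq> F" "F \<subseteq> closure E" using separable[of F] by blast
  have clD: "closure D = S" using D S_closed closure_minimal by blast
  have clE: "closure E = F" using E F closure_minimal compact_imp_closed by blast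
  have "(\<exists>b\<in>F. maximizer w b) \<longleftrightarrow> (\<forall>d\<in>D. \<forall>m::nat. \<exists>e\<in>E. f w d < f w e + 1 / Suc m)"
    if w: "w \<in> space M" for w
  proof
    assume "\<exists>b\<in>F. maximizer w b"
    then obtain b where b: "b \<in> F" "\<forall>b'\<in>S. f w b' \<le> f w b" by (auto simp: maximizer_iff)
    show "\<forall>d\<in>D. \<forall>m::nat. \<exists>e\<in>E. f w d < f w e + 1 / Suc m"
    proof (intro ballI allI, rule ccontr)
      fix d m assume d: "d \<in> D" and "\<not> (\<exists>e\<in>E. f w d < f w e + 1 / Suc m)"
      then have "\<And>e. e \<in> E \<Longrightarrow> f w e \<le> f w d - 1 / Suc m" by (fastforce simp: not_less)
      moreover have "continuous_on (closure E) (f w)"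
        using objective_continuous[OF w] F clE continuous_on_subset by blast
      ultimately have "f w b \<le> f w d - 1 / Suc m"
        using continuous_le_on_closure[of E "f w" b] b clE by blast
      moreover have "f w d \<le> f w b" using b d D by auto
      ultimately show False by (smt (verit) divide_pos_pos of_nat_0_less_iff zero_less_Suc)
    qed
  next
    assume *: "\<forall>d\<in>D. \<forall>m::nat. \<exists>e\<in>E. f w d < f w e + 1 / Suc m"
    have "D \<noteq> {}" using clD S_nonempty by auto
    with * E have "F \<noteq> {}" by blast
    then obtain b where b: "b \<in> F" "\<forall>b'\<in>F. f w b' \<le> f w b"
      using continuous_attains_sup[OF F(2)] continuous_on_subset[OF objective_continuous[OF w] F(1)] by blast
    have "f w d \<le> f w b" if d: "d \<in> D" for d
    proof (rule field_le_epsilon)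
      fix e :: real assume "e > 0"
      then obtain m where m: "1 / Suc m < e" using nat_approx_posE by blast
      obtain e' where "e' \<in> E" "f w d < f w e' + 1 / Suc m" using * d by blast
      with b E m show "f w d \<le> f w b + e" by force
    qed
    then have "f w s \<le> f w b" if "s \<in> S" for s
      using continuous_le_on_closure[of D "f w" s] objective_continuous[OF w] clD that by blast
    with b F show "\<exists>b\<in>F. maximizer w b" by (auto simp: maximizer_iff)
  qed
  then have "{w \<in> space M. \<exists>b\<in>F. maximizer w b}
      = {w \<in> space M. \<forall>d\<in>D. \<forall>m::nat. \<exists>e\<in>E. f w d < f w e + 1 / Suc m}"
    by auto
  also have "\<dots> \<in> sets M"
    using D(1) E(1)
    by (intro sets.sets_Collect_countable_All' sets.sets_Collect_countable_All sets.sets_Collect_countable_Ex') measurable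
  finally show ?thesis .
qed

lemma maximizer_in_ball_iff: "(\<exists>b. b \<in> C \<and> maximizer w b) \<longleftrightarrow> (\<exists>k::nat. \<exists>b\<in>S \<inter> C \<inter> cball 0 k. maximizer w b)"
proof
  assume "\<exists>b. b \<in> C \<and> maximizer w b"
  then obtain b where b: "b \<in> C" "maximizer w b" by blast
  obtain k :: nat where "norm b \<le> k" using real_arch_simple by blast
  with b show "\<exists>k::nat. \<exists>b\<in>S \<inter> C \<inter> cball 0 k. maximizer w b"
    by (intro exI[of _ k] bexI[of _ b]) (auto simp: maximizer_iff)
qed auto

lemma sets_maximizer_in_closed [measurable]:
  assumes "closed C"
  shows "{w \<in> space M. \<exists>b. b \<in> C \<and> maximizer w b} \<in> sets M"
proof -
  have "{w \<in> space M. \<exists>b\<in>S \<inter> C \<inter> cball 0 (real k). maximizer w b} \<in> sets M" for k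
    using assms S_closed by (intro sets_maximizer_in_compact compact_Int_closed closed_Int_compact) (auto intro: closed_Int)
  then show ?thesis unfolding maximizer_in_ball_iff by (intro sets.sets_Collect_countable_Ex)
qed

text \<open>
  Two distinct maximizers are separated by a small closed ball with centre in a countable dense set
  and the complement of the open ball of twice the radius.
\<close>

lemma sets_unique_maximizer: "{w \<in> space M. \<exists>!b. maximizer w b} \<in> sets M"
proof -
  obtain D :: "'b set" where D: "countable D" "UNIV \<subseteq> closure D"
    by (rule separable[of "UNIV :: 'b set"])
  define two where "two w \<longleftrightarrow> (\<exists>c\<in>D. \<exists>m::nat. (\<exists>b. b \<in> cball c (1 / Suc m) \<and> maximizer w b)
      \<and> (\<exists>b. b \<in> - ball c (2 / Suc m) \<and> maximizer w b))" for w
  have "(\<exists>!b. maximizer w b) \<longleftrightarrow> (\<exists>b. b \<in> UNIV \<and> maximizer w b) \<and> \<not> two w" for w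
  proof
    assume *: "\<exists>!b. maximizer w b"
    have "\<not> two w"
    proof
      assume "two w"
      then obtain c m b b' where "dist c b \<le> 1 / Suc m" "maximizer w b" "2 / Suc m \<le> dist c b'" "maximizer w b'"
        unfolding two_def by (auto simp: not_less)
      moreover have "1 / real (Suc m) < 2 / real (Suc m)" by (intro divide_strict_right_mono) auto
      ultimately show False using * by force
    qed
    with * show "(\<exists>b. b \<in> UNIV \<and> maximizer w b) \<and> \<not> two w" by blast
  next
    assume *: "(\<exists>b. b \<in> UNIV \<and> maximizer w b) \<and> \<not> two w"
    then obtain b where b: "maximizer w b" by blast
    have "b' = b" if b': "maximizer w b'" for b'
    proof (rule ccontr)
      assume "b' \<noteq> b"
      then have "dist b b' / 3 > 0" by simp
      then obtain m where m: "1 / Suc m < dist b b' / 3" using nat_approx_posE by blast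
      obtain c where c: "c \<in> D" "dist c b < 1 / Suc m"
        using D(2) closure_approachable[of b D] by (metis UNIV_I divide_pos_pos of_nat_0_less_iff subsetD zero_less_Suc zero_less_one)
      have "dist b b' \<le> dist c b + dist c b'" by (simp add: dist_triangle3)
      moreover have "2 / real (Suc m) = 2 * (1 / Suc m)" by simp
      ultimately have "2 / Suc m \<le> dist c b'" using m c(2) by linarith
      with c b b' have "two w" unfolding two_def by (intro bexI[of _ c] exI[of _ m]) (auto simp: not_less intro: less_imp_le)
      with * show False by blast
    qed
    with b show "\<exists>!b. maximizer w b" by blast
  qed
  then have "{w \<in> space M. \<exists>!b. maximizer w b} = {w \<in> space M. \<exists>b. b \<in> UNIV \<and> maximizer w b} - {w \<in> space M. two w}"
    by auto
  moreover have "{w \<in> space M. two w} \<in> sets M"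
    unfolding two_def using D(1)
    by (intro sets.sets_Collect_countable_Ex' sets.sets_Collect_countable_Ex sets.sets_Collect_conj
        sets_maximizer_in_closed) auto
  ultimately show ?thesis using sets_maximizer_in_closed[of UNIV] by auto
qed

lemma measurable_unique_maximizer:
  "(\<lambda>w. if \<exists>!b. maximizer w b then THE b. maximizer w b else 0) \<in> borel_measurable M"
    (is "?g \<in> _")
proof (rule borel_measurableI)
  fix U :: "'b set" assume "open U"
  then have C: "closed (- U)" by auto
  let ?u = "\<lambda>w. \<exists>!b. maximizer w b"
  have mem: "?g w \<in> U \<longleftrightarrow> (?u w \<and> \<not> (\<exists>b. b \<in> - U \<and> maximizer w b)) \<or> (\<not> ?u w \<and> 0 \<in> U)" for w
  proof (cases "?u w")
    case True
    then obtain b where b: "maximizer w b" "\<And>b'. maximizer w b' \<Longrightarrow> b' = b" by blast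
    then have "(THE b. maximizer w b) = b" by (intro the_equality)
    then have "?g w = b" using True by simp
    moreover have "(\<exists>b'. b' \<in> - U \<and> maximizer w b') \<longleftrightarrow> b \<notin> U" using b by blast
    ultimately show ?thesis using True by simp
  qed simp
  have "?g -` U \<inter> space M = {w \<in> space M. ?g w \<in> U}" by (simp only: vimage_def Int_def mem_Collect_eq conj_commute)
  also have "\<dots> = {w \<in> space M. (?u w \<and> \<not> (\<exists>b. b \<in> - U \<and> maximizer w b)) \<or> (\<not> ?u w \<and> 0 \<in> U)}"
    by (simp only: mem)
  also have "\<dots> \<in> sets M"
    by (intro sets.sets_Collect_disj sets.sets_Collect_conj sets.sets_Collect_neg sets.sets_Collect_const
        sets_unique_maximizer sets_maximizer_in_closed C)
  finally show "?g -` U \<inter> space M \<in> sets M" .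
qed

end

section \<open>Maximizers of strictly concave functions\<close>

text \<open>
  A point outside the ball at which \<open>f\<close> is not below \<open>f b\<^sub>0\<close> would force, by concavity on the
  segment to \<open>b\<^sub>0\<close>, a point of the sphere with the same property.
\<close>

lemma strictly_concave_unique_maximizer:
  fixes f :: "'b::euclidean_space \<Rightarrow> real"
  assumes cont: "continuous_on UNIV f"
    and conc: "\<And>b b' l. b \<noteq> b' \<Longrightarrow> 0 < l \<Longrightarrow> l < 1 \<Longrightarrow>
      (1 - l) * f b + l * f b' < f ((1 - l) *\<^sub>R b + l *\<^sub>R b')"
    and S: "convex S" and r: "r > 0" "cball b\<^sub>0 r \<subseteq> S"
    and sphere: "\<And>b. dist b\<^sub>0 b = r \<Longrightarrow> f b < f b\<^sub>0"
  shows "\<exists>!b. is_arg_max f (\<lambda>b. b \<in> S) b"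
    and "is_arg_max f (\<lambda>b. b \<in> S) b \<Longrightarrow> dist b\<^sub>0 b \<le> r"
proof -
  have outside: "f b < f b\<^sub>0" if "dist b\<^sub>0 b \<ge> r" for b
  proof (cases "dist b\<^sub>0 b = r")
    case False
    define l where "l = r / dist b\<^sub>0 b"
    have "r < dist b\<^sub>0 b" using that False by simp
    then have l: "0 < l" "l < 1" using r(1)
      unfolding l_def using order.strict_trans[OF r(1) \<open>r < dist b\<^sub>0 b\<close>]
      by (simp_all only: divide_pos_pos pos_divide_less_eq mult_1)
    let ?p = "(1 - l) *\<^sub>R b\<^sub>0 + l *\<^sub>R b"
    have "b\<^sub>0 - ?p = l *\<^sub>R (b\<^sub>0 - b)" by (simp add: algebra_simps)
    then have "dist b\<^sub>0 ?p = l * dist b\<^sub>0 b" using l by (simp add: dist_norm)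
    also have "dist b\<^sub>0 b \<noteq> 0" using \<open>r < dist b\<^sub>0 b\<close> r(1) by linarith
    then have "l * dist b\<^sub>0 b = r" by (simp add: l_def)
    finally have "f ?p < f b\<^sub>0" by (rule sphere)
    moreover have "b\<^sub>0 \<noteq> b" using that r(1) by force
    then have "(1 - l) * f b\<^sub>0 + l * f b < f ?p"
      using l by (intro conc)
    ultimately have "l * f b < l * f b\<^sub>0" by (simp add: algebra_simps)
    then show ?thesis using l by simp
  qed (use sphere in simp)
  have am: "is_arg_max f (\<lambda>b. b \<in> S) b \<longleftrightarrow> b \<in> S \<and> (\<forall>b'\<in>S. f b' \<le> f b)" for b
    unfolding is_arg_max_def by (auto simp: not_less)
  have b0: "b\<^sub>0 \<in> S" using r by auto
  show near: "dist b\<^sub>0 b \<le> r" if "is_arg_max f (\<lambda>b. b \<in> S) b" for b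
  proof (rule ccontr)
    assume "\<not> dist b\<^sub>0 b \<le> r"
    then have "f b < f b\<^sub>0" by (intro outside) simp
    with that b0 show False unfolding am by (auto simp: not_less[symmetric])
  qed
  show "\<exists>!b. is_arg_max f (\<lambda>b. b \<in> S) b"
  proof (rule ex_ex1I)
    obtain b where b: "b \<in> cball b\<^sub>0 r" "\<forall>b'\<in>cball b\<^sub>0 r. f b' \<le> f b"
      using continuous_attains_sup[OF compact_cball, of b\<^sub>0 r f] continuous_on_subset[OF cont subset_UNIV] r(1)
      by (auto simp: less_imp_le)
    have "f b' \<le> f b" for b'
    proof (cases "dist b\<^sub>0 b' \<le> r")
      case False
      then have "f b' < f b\<^sub>0" by (intro outside) auto
      also have "f b\<^sub>0 \<le> f b" using b(2) r by auto
      finally show ?thesis by simp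
    qed (use b in auto)
    then show "\<exists>b. is_arg_max f (\<lambda>b. b \<in> S) b" using b r unfolding am by blast
  next
    fix b b' assume *: "is_arg_max f (\<lambda>b. b \<in> S) b" "is_arg_max f (\<lambda>b. b \<in> S) b'"
    show "b = b'"
    proof (rule ccontr)
      assume "b \<noteq> b'"
      from conc[OF this, of "1/2"] have "f b / 2 + f b' / 2 < f ((1/2) *\<^sub>R b + (1/2) *\<^sub>R b')" by simp
      moreover have "(1/2) *\<^sub>R b + (1/2) *\<^sub>R b' \<in> S"
        using * S unfolding am convex_def by auto
      ultimately show False using * unfolding am by fastforce
    qed
  qed
qed

section \<open>The smallest eigenvalue of a symmetric matrix\<close>

lemma symmetric_inner_commute:
  fixes S :: "real^'d^'d"
  assumes "transpose S = S" shows "(S *v v) \<bullet> w = v \<bullet> (S *v w)"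
  using assms by (metis dot_lmul_matrix vector_transpose_matrix)

text \<open>
  Eigenvectors for distinct eigenvalues are orthogonal. Finiteness is needed because \<open>lambda_min\<close> is
  defined by \<open>Min\<close>, which says nothing about infinite sets.
\<close>

lemma finite_eigenvalues:
  fixes S :: "real^'d^'d"
  assumes sym: "transpose S = S"
  shows "finite (eigenvalues S)"
proof -
  define e where "e l = (SOME v. v \<noteq> 0 \<and> S *v v = l *\<^sub>R v)" for l
  have e: "e l \<noteq> 0" "S *v e l = l *\<^sub>R e l" if "l \<in> eigenvalues S" for l
    using someI_ex[of "\<lambda>v. v \<noteq> 0 \<and> S *v v = l *\<^sub>R v"] that by (auto simp: e_def eigenvalues_def)
  have orth: "e l \<bullet> e m = 0" if "l \<in> eigenvalues S" "m \<in> eigenvalues S" "l \<noteq> m" for l m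
  proof -
    have "l * (e l \<bullet> e m) = m * (e l \<bullet> e m)"
      using symmetric_inner_commute[OF sym, of "e l" "e m"] e that by simp
    then show ?thesis using that by simp
  qed
  have inj: "inj_on e (eigenvalues S)"
    using orth e by (intro inj_onI) (metis inner_eq_zero_iff)
  have "pairwise orthogonal (e ` eigenvalues S)"
    using orth by (auto simp: pairwise_def orthogonal_def)
  then have "finite (e ` eigenvalues S)"
    using e by (intro independent_imp_finite pairwise_orthogonal_independent) auto
  then show ?thesis using inj finite_imageD by blast
qed

text \<open>
  The minimum of the quadratic form on the unit sphere is attained, and at a minimizer \<open>u\<close> with value
  \<open>l\<close> the form \<open>v \<bullet> (S v) - l |v|\<^sup>2\<close> is nonnegative and vanishes; its first variation must vanish as
  well, so \<open>u\<close> is an eigenvector.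
\<close>

lemma lambda_min_le_quadratic_form:
  fixes S :: "real^'d^'d"
  assumes sym: "transpose S = S"
  shows "lambda_min S * (v \<bullet> v) \<le> v \<bullet> (S *v v)"
proof -
  let ?q = "\<lambda>v. v \<bullet> (S *v v)"
  have "continuous_on (sphere 0 1) ?q"
    by (intro continuous_intros linear_continuous_on matrix_vector_mul_bounded_linear)
  moreover obtain e :: "real^'d" where "norm e = 1" using vector_choose_size[of 1] by auto
  then have "sphere (0 :: real^'d) 1 \<noteq> {}" by auto
  ultimately obtain u where u: "norm u = 1" and min: "\<And>w. norm w = 1 \<Longrightarrow> ?q u \<le> ?q w"
    using continuous_attains_inf[of "sphere (0 :: real^'d) 1" ?q] by (auto simp: compact_sphere)
  define l where "l = ?q u"
  have psd: "l * (w \<bullet> w) \<le> ?q w" for w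
  proof (cases "w = 0")
    case False
    have "l \<le> ?q ((1 / norm w) *\<^sub>R w)" unfolding l_def using False by (intro min) simp
    also have "\<dots> = ?q w / (w \<bullet> w)"
      by (simp add: matrix_vector_mult_scaleR dot_square_norm power2_eq_square)
    finally show ?thesis using False by (simp add: pos_le_divide_eq)
  qed simp
  have "S *v u = l *\<^sub>R u"
  proof -
    define g where "g = S *v u - l *\<^sub>R u"
    define k where "k = ?q g - l * (g \<bullet> g)"
    have uu: "u \<bullet> u = 1" using u by (simp add: dot_square_norm)
    have ug: "u \<bullet> (S *v g) - l * (u \<bullet> g) = g \<bullet> g"
      unfolding symmetric_inner_commute[OF sym, symmetric] by (simp add: g_def inner_diff_left)
    have *: "0 \<le> 2 * t * (g \<bullet> g) + t\<^sup>2 * k" for t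
    proof -
      have "?q (u + t *\<^sub>R g) - l * ((u + t *\<^sub>R g) \<bullet> (u + t *\<^sub>R g))
        = (?q u - l * (u \<bullet> u)) + t * ((u \<bullet> (S *v g) - l * (u \<bullet> g)) + (g \<bullet> (S *v u) - l * (u \<bullet> g))) + t\<^sup>2 * k"
        by (simp add: k_def matrix_vector_right_distrib matrix_vector_mult_scaleR inner_add_left inner_add_right
            algebra_simps power2_eq_square inner_commute[of g u])
      moreover have "g \<bullet> (S *v u) = u \<bullet> (S *v g)"
        using symmetric_inner_commute[OF sym, of u g] by (simp add: inner_commute)
      then have "(u \<bullet> (S *v g) - l * (u \<bullet> g)) + (g \<bullet> (S *v u) - l * (u \<bullet> g)) = 2 * (g \<bullet> g)"
        using ug by simp
      moreover have "?q u - l * (u \<bullet> u) = 0" using uu by (simp add: l_def)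
      ultimately have "?q (u + t *\<^sub>R g) - l * ((u + t *\<^sub>R g) \<bullet> (u + t *\<^sub>R g)) = 2 * t * (g \<bullet> g) + t\<^sup>2 * k"
        by (simp only:)
      with psd[of "u + t *\<^sub>R g"] show ?thesis by linarith
    qed
    have "g \<bullet> g = 0"
    proof (rule ccontr)
      assume "g \<bullet> g \<noteq> 0"
      then have gg: "g \<bullet> g > 0" by simp
      define K where "K = \<bar>k\<bar> + 1"
      have K: "K > 0" "k \<le> K" by (auto simp: K_def)
      \<comment> \<open>the minimizer over \<open>t\<close> of the majorant \<open>2 t |g|\<^sup>2 + t\<^sup>2 K\<close>\<close>
      let ?t = "- (g \<bullet> g) / K"
      have "2 * ?t * (g \<bullet> g) + ?t\<^sup>2 * k \<le> 2 * ?t * (g \<bullet> g) + ?t\<^sup>2 * K"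
        using K by (intro add_left_mono mult_left_mono) auto
      also have "\<dots> = - (g \<bullet> g)\<^sup>2 / K" using K by (simp add: field_simps power2_eq_square)
      also have "\<dots> < 0" using gg K by simp
      finally show False using *[of ?t] by linarith
    qed
    then show ?thesis by (simp add: g_def)
  qed
  moreover have "u \<noteq> 0" using u by auto
  ultimately have "l \<in> eigenvalues S" by (auto simp: eigenvalues_def)
  then have "lambda_min S \<le> l" unfolding lambda_min_def using finite_eigenvalues[OF sym] by simp
  then have "lambda_min S * (v \<bullet> v) \<le> l * (v \<bullet> v)" by (intro mult_right_mono) auto
  with psd[of v] show ?thesis by linarith
qed

section \<open>The pseudo-likelihood\<close>

definition predictor :: "(nat \<Rightarrow> real^'d) \<Rightarrow> (nat \<Rightarrow> real) \<Rightarrow> real \<times> (real^'d) \<Rightarrow> nat \<Rightarrow> real" where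
  "predictor x t \<beta> i = fst \<beta> * t i + x i \<bullet> snd \<beta>"

lemma predictor_inner: "predictor x t \<beta> i = (t i, x i) \<bullet> \<beta>"
  by (simp add: predictor_def inner_prod_def mult.commute)

lemma predictor_add: "predictor x t (\<beta> + u) i = predictor x t \<beta> i + predictor x t u i"
  by (simp add: predictor_inner inner_add_right)

lemma abs_predictor_le:
  assumes "\<bar>t i\<bar> \<le> 1" "norm (x i) \<le> D"
  shows "\<bar>predictor x t \<beta> i\<bar> \<le> (1 + D) * norm \<beta>"
proof -
  have "norm (t i, x i) \<le> 1 + D"
    using norm_Pair_le[of "t i" "x i"] assms by (simp add: real_norm_def)
  then have "norm (t i, x i) * norm \<beta> \<le> (1 + D) * norm \<beta>" by (intro mult_right_mono) auto
  then show ?thesis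
    using Cauchy_Schwarz_ineq2[of "(t i, x i)" \<beta>] by (simp add: predictor_inner)
qed

definition log_pl ::
  "nat \<Rightarrow> real measure \<Rightarrow> (nat \<Rightarrow> nat \<Rightarrow> real) \<Rightarrow> (nat \<Rightarrow> real^'d) \<Rightarrow> (nat \<Rightarrow> real) \<Rightarrow> (nat \<Rightarrow> real)
    \<Rightarrow> real \<times> (real^'d) \<Rightarrow> real" where
  "log_pl n \<mu> A x t y \<beta> = (\<Sum>i<n. A i i * (y i)\<^sup>2 / 2 + (local_field n A y i + predictor x t \<beta> i) * y i
      - log_partition \<mu> (A i i) (local_field n A y i + predictor x t \<beta> i))"

lemma outcome_density_eq:
  "outcome_density n \<mu> A \<beta> x t = normalized (PiM {..<n} (\<lambda>_. \<mu>)) (gibbs_weight n A (predictor x t \<beta>))"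
  by (simp add: outcome_density_def gibbs_weight_def[abs_def] predictor_def outcome_base_def split_beta)

context bounded_base
begin

lemma conditional_density_eq:
  assumes sym: "symmetric_matrix n A" and i: "i < n"
  shows "conditional_density n \<nu> A \<beta> x t y i = exp (A i i * (y i)\<^sup>2 / 2
    + (local_field n A y i + predictor x t \<beta> i) * y i
    - log_partition \<nu> (A i i) (local_field n A y i + predictor x t \<beta> i))"
proof -
  let ?W = "gibbs_weight n A (predictor x t \<beta>)"
  let ?Z = "\<integral>z. ?W z \<partial>base n"
  let ?s = "local_field n A y i + predictor x t \<beta> i"
  have upd: "outcome_density n \<nu> A \<beta> x t (y(i := u))
      = ?W (y(i := 0)) / ?Z * exp (A i i * u\<^sup>2 / 2 + ?s * u)" for u
    unfolding outcome_density_eq normalized_def gibbs_weight_upd[OF sym i, of _ y u] by simp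
  have "?W (y(i := 0)) / ?Z > 0"
    by (intro divide_pos_pos gibbs_normalizer_pos) (simp add: gibbs_weight_def)
  then have nz: "?W (y(i := 0)) / ?Z \<noteq> 0" by (rule less_imp_neq[symmetric])
  have "(\<integral>u. exp (A i i * u\<^sup>2 / 2 + ?s * u) \<partial>\<nu>) = moment \<nu> (A i i) 0 ?s"
    by (simp add: moment_def)
  moreover have "outcome_density n \<nu> A \<beta> x t (y(i := y i)) / (\<integral>u. outcome_density n \<nu> A \<beta> x t (y(i := u)) \<partial>\<nu>)
      = exp (A i i * (y i)\<^sup>2 / 2 + ?s * y i) / (\<integral>u. exp (A i i * u\<^sup>2 / 2 + ?s * u) \<partial>\<nu>)"
    unfolding upd integral_mult_right_zero by (rule nonzero_mult_divide_mult_cancel_left[OF nz])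
  ultimately show ?thesis
    using moment_0_pos[of "A i i" ?s]
    by (simp add: conditional_density_def normalized_def log_partition_def exp_diff del: fun_upd_triv)
qed

lemma pseudo_likelihood_eq:
  assumes "symmetric_matrix n A"
  shows "pseudo_likelihood n \<nu> A (x, t, y) \<beta> = exp (log_pl n \<nu> A x t y \<beta>)"
  unfolding pseudo_likelihood_def log_pl_def prod.case exp_sum[OF finite_lessThan]
  by (intro prod.cong conditional_density_eq[OF assms]) auto

lemma continuous_on_log_pl: "continuous_on UNIV (log_pl n \<nu> A x t y)"
  unfolding log_pl_def[abs_def] predictor_inner
  by (intro continuous_intros continuous_on_compose2[OF continuous_on_log_partition]) auto

text \<open>
  A single site whose predictor separates \<open>b\<close> from \<open>b'\<close> makes the inequality strict.
\<close>

lemma log_pl_strictly_concave: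
  assumes nondeg: "\<And>u. u \<noteq> 0 \<Longrightarrow> (\<Sum>i<n. (predictor x t u i)\<^sup>2) > 0"
    and "b \<noteq> b'" and l: "0 < l" "l < 1"
  shows "(1 - l) * log_pl n \<nu> A x t y b + l * log_pl n \<nu> A x t y b' < log_pl n \<nu> A x t y ((1 - l) *\<^sub>R b + l *\<^sub>R b')"
proof -
  define s where "s \<beta> i = local_field n A y i + predictor x t \<beta> i" for \<beta> i
  define T where "T i \<sigma> = A i i * (y i)\<^sup>2 / 2 + \<sigma> * y i - log_partition \<nu> (A i i) \<sigma>" for i \<sigma>
  have log_pl: "log_pl n \<nu> A x t y \<beta> = (\<Sum>i<n. T i (s \<beta> i))" for \<beta>
    by (simp add: log_pl_def T_def s_def)
  have s: "s ((1 - l) *\<^sub>R b + l *\<^sub>R b') i = (1 - l) * s b i + l * s b' i" for i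
    by (simp add: s_def predictor_inner inner_add_right algebra_simps)
  have T: "(1 - l) * T i \<sigma> + l * T i \<sigma>' < T i ((1 - l) * \<sigma> + l * \<sigma>')" if "\<sigma> \<noteq> \<sigma>'" for i \<sigma> \<sigma>'
    using log_partition_strictly_convex[OF that l, of "A i i"] by (simp add: T_def field_simps)
  have Tle: "(1 - l) * T i \<sigma> + l * T i \<sigma>' \<le> T i ((1 - l) * \<sigma> + l * \<sigma>')" for i \<sigma> \<sigma>'
  proof (cases "\<sigma> = \<sigma>'")
    case True
    then show ?thesis by (simp add: algebra_simps)
  qed (use T[of \<sigma> \<sigma>' i] in simp)
  have "\<exists>i<n. predictor x t (b - b') i \<noteq> 0"
  proof (rule ccontr)
    assume "\<not> (\<exists>i<n. predictor x t (b - b') i \<noteq> 0)"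
    then have "(\<Sum>i<n. (predictor x t (b - b') i)\<^sup>2) = 0" by simp
    with nondeg[of "b - b'"] \<open>b \<noteq> b'\<close> show False by simp
  qed
  then obtain i where i: "i < n" "s b i \<noteq> s b' i"
    by (auto simp: s_def predictor_inner inner_diff_right)
  have "(\<Sum>i<n. (1 - l) * T i (s b i) + l * T i (s b' i)) < (\<Sum>i<n. T i ((1 - l) * s b i + l * s b' i))"
    using T[OF i(2), of i] i(1) by (intro sum_strict_mono_ex1 ballI Tle bexI[of _ i]) auto
  then show ?thesis unfolding log_pl s by (simp add: sum.distrib sum_distrib_left)
qed

text \<open>
  A lower bound with a weight that is linear in \<open>m\<^sup>2\<close> holds for every local field \<open>m\<close>, trivially if
  \<open>|m| > K\<close>. It replaces counting the sites with a large field and sums directly against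
  \<open>sum_local_field_sq_le\<close>.
\<close>

lemma tilted_var_ge_weighted:
  assumes "\<bar>a\<bar> \<le> \<rho>" "\<bar>s\<bar> \<le> S" "K > 0"
  shows "var_bound \<rho> (K + S) * (1 - m\<^sup>2 / K\<^sup>2) \<le> tilted_var \<nu> a (m + s)"
proof (cases "\<bar>m\<bar> \<le> K")
  case True
  have "var_bound \<rho> (K + S) * (1 - m\<^sup>2 / K\<^sup>2) \<le> var_bound \<rho> (K + S) * 1"
    using var_bound_pos[of \<rho> "K + S"] by (intro mult_left_mono) auto
  also have "\<dots> \<le> var_bound a (m + s)"
    using var_bound_antimono[of a \<rho> "m + s" "K + S"] assms True by auto
  also have "\<dots> \<le> tilted_var \<nu> a (m + s)" by (rule tilted_var_ge)
  finally show ?thesis .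
next
  case False
  then have "K\<^sup>2 \<le> m\<^sup>2" using assms(3) power_mono[of K "\<bar>m\<bar>" 2] by simp
  then have "1 - m\<^sup>2 / K\<^sup>2 \<le> 0" using assms(3) by simp
  then have "var_bound \<rho> (K + S) * (1 - m\<^sup>2 / K\<^sup>2) \<le> 0"
    using var_bound_pos[of \<rho> "K + S"] by (simp add: mult_nonneg_nonpos)
  then show ?thesis using tilted_var_pos[of a "m + s"] by linarith
qed

lemma sum_tilted_var_ge:
  assumes \<rho>: "op_norm n A \<le> \<rho>" and y: "\<And>i. i < n \<Longrightarrow> \<bar>y i\<bar> \<le> 1"
    and h: "\<And>i. i < n \<Longrightarrow> \<bar>h i\<bar> \<le> H" and K: "K > 0"
  shows "var_bound \<rho> (K + H) * (1 - 4 * \<rho>\<^sup>2 / K\<^sup>2) * n \<le> (\<Sum>i<n. tilted_var \<nu> (A i i) (local_field n A y i + h i))"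
proof -
  let ?\<delta> = "var_bound \<rho> (K + H)"
  have "?\<delta> * (1 - 4 * \<rho>\<^sup>2 / K\<^sup>2) * n = ?\<delta> * (n - (4 * \<rho>\<^sup>2 * n) / K\<^sup>2)"
    by (simp add: algebra_simps)
  also have "\<dots> \<le> ?\<delta> * (n - (\<Sum>i<n. (local_field n A y i)\<^sup>2) / K\<^sup>2)"
    using var_bound_pos[of \<rho> "K + H"] sum_local_field_sq_le[OF \<rho> y]
    by (intro mult_left_mono diff_left_mono divide_right_mono) auto
  also have "\<dots> = (\<Sum>i<n. ?\<delta> * (1 - (local_field n A y i)\<^sup>2 / K\<^sup>2))"
    by (simp add: sum_distrib_left[symmetric] sum_subtractf sum_divide_distrib)
  also have "\<dots> \<le> (\<Sum>i<n. tilted_var \<nu> (A i i) (local_field n A y i + h i))"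
    using entry_le[OF \<rho>] h K by (intro sum_mono tilted_var_ge_weighted) auto
  finally show ?thesis .
qed

text \<open>
  Second-order expansion at each site, with the variance bounded below by the weighted bound. The
  choice of \<open>K\<close> makes the sites with a large local field cost at most half of the design curvature
  \<open>\<kappa>\<close>.
\<close>

lemma log_pl_increment_le:
  assumes \<rho>: "op_norm n A \<le> \<rho>" and y: "\<And>i. i < n \<Longrightarrow> \<bar>y i\<bar> \<le> 1"
    and t: "\<And>i. i < n \<Longrightarrow> \<bar>t i\<bar> \<le> 1" and x: "\<And>i. i < n \<Longrightarrow> norm (x i) \<le> D" and D: "D \<ge> 0"
    and K: "K > 0" "4 * (1 + D)\<^sup>2 * \<rho>\<^sup>2 / K\<^sup>2 \<le> \<kappa> / 2"
    and \<kappa>: "\<kappa> * n * (norm u)\<^sup>2 \<le> (\<Sum>i<n. (predictor x t u i)\<^sup>2)"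
    and u: "norm u \<le> 1"
  shows "log_pl n \<nu> A x t y (\<beta> + u) - log_pl n \<nu> A x t y \<beta>
    \<le> residual_sum \<nu> n A (predictor x t \<beta>) (predictor x t u) y
      - var_bound \<rho> (K + (1 + D) * (norm \<beta> + 1)) * \<kappa> / 4 * n * (norm u)\<^sup>2"
proof -
  let ?S = "(1 + D) * (norm \<beta> + 1)"
  define \<delta> where "\<delta> = var_bound \<rho> (K + ?S)"
  have \<delta>: "\<delta> > 0" unfolding \<delta>_def by (rule var_bound_pos)
  define m where "m i = local_field n A y i" for i
  define s where "s i = predictor x t \<beta> i" for i
  define e where "e i = predictor x t u i" for i
  have e: "\<bar>e i\<bar> \<le> (1 + D) * norm u" and s: "\<bar>s i\<bar> \<le> (1 + D) * norm \<beta>" if "i < n" for i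
    unfolding e_def s_def using t x that by (auto intro!: abs_predictor_le)
  have e2: "(e i)\<^sup>2 \<le> (1 + D)\<^sup>2 * (norm u)\<^sup>2" if "i < n" for i
    using power_mono[OF e[OF that], of 2] by (simp add: power_mult_distrib)
  have increment: "(m i + s i + e i) * y i - log_partition \<nu> (A i i) (m i + s i + e i)
      - ((m i + s i) * y i - log_partition \<nu> (A i i) (m i + s i))
    \<le> e i * (y i - tilted_mean \<nu> (A i i) (m i + s i)) - \<delta> / 2 * ((e i)\<^sup>2 - (m i)\<^sup>2 * ((1 + D)\<^sup>2 * (norm u)\<^sup>2) / K\<^sup>2)"
    if i: "i < n" for i
  proof -
    obtain r where r: "\<bar>r - (m i + s i)\<bar> \<le> \<bar>e i\<bar>"
      and eq: "log_partition \<nu> (A i i) (m i + s i + e i) = log_partition \<nu> (A i i) (m i + s i)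
        + tilted_mean \<nu> (A i i) (m i + s i) * e i + tilted_var \<nu> (A i i) r / 2 * (e i)\<^sup>2"
      using log_partition_taylor by blast
    have "\<bar>e i\<bar> \<le> (1 + D) * 1" using e[OF i] mult_left_mono[OF u, of "1 + D"] D by linarith
    then have "\<bar>r - m i\<bar> \<le> ?S" using r s[OF i] by (simp add: distrib_left)
    then have "\<delta> * (1 - (m i)\<^sup>2 / K\<^sup>2) \<le> tilted_var \<nu> (A i i) (m i + (r - m i))"
      unfolding \<delta>_def using entry_le[OF \<rho> i i] K by (intro tilted_var_ge_weighted) auto
    then have "\<delta> * (1 - (m i)\<^sup>2 / K\<^sup>2) * (e i)\<^sup>2 \<le> tilted_var \<nu> (A i i) r * (e i)\<^sup>2"
      by (intro mult_right_mono) auto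
    moreover have "\<delta> * ((m i)\<^sup>2 / K\<^sup>2) * (e i)\<^sup>2 \<le> \<delta> * ((m i)\<^sup>2 / K\<^sup>2) * ((1 + D)\<^sup>2 * (norm u)\<^sup>2)"
      using \<delta> e2[OF i] by (intro mult_left_mono) auto
    ultimately have "\<delta> * ((e i)\<^sup>2 - (m i)\<^sup>2 * ((1 + D)\<^sup>2 * (norm u)\<^sup>2) / K\<^sup>2) \<le> tilted_var \<nu> (A i i) r * (e i)\<^sup>2"
      by (simp add: algebra_simps)
    then show ?thesis unfolding eq by (simp add: algebra_simps)
  qed
  have "log_pl n \<nu> A x t y (\<beta> + u) - log_pl n \<nu> A x t y \<beta>
    = (\<Sum>i<n. (m i + s i + e i) * y i - log_partition \<nu> (A i i) (m i + s i + e i)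
      - ((m i + s i) * y i - log_partition \<nu> (A i i) (m i + s i)))"
    unfolding log_pl_def sum_subtractf[symmetric] predictor_add m_def s_def e_def
    by (intro sum.cong) (auto simp: add.assoc)
  also have "\<dots> \<le> (\<Sum>i<n. e i * (y i - tilted_mean \<nu> (A i i) (m i + s i))
      - \<delta> / 2 * ((e i)\<^sup>2 - (m i)\<^sup>2 * ((1 + D)\<^sup>2 * (norm u)\<^sup>2) / K\<^sup>2))"
    by (intro sum_mono increment) auto
  also have "\<dots> = residual_sum \<nu> n A (predictor x t \<beta>) (predictor x t u) y
      - \<delta> / 2 * ((\<Sum>i<n. (e i)\<^sup>2) - (\<Sum>i<n. (m i)\<^sup>2) * ((1 + D)\<^sup>2 * (norm u)\<^sup>2) / K\<^sup>2)"
    unfolding residual_sum_def cond_mean_def sum_subtractf m_def s_def e_def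
    by (simp only: sum_distrib_left[symmetric] sum_subtractf sum_distrib_right[symmetric] sum_divide_distrib[symmetric])
  also have "\<dots> \<le> residual_sum \<nu> n A (predictor x t \<beta>) (predictor x t u) y - \<delta> / 2 * (\<kappa> / 2 * n * (norm u)\<^sup>2)"
  proof -
    have "(\<Sum>i<n. (m i)\<^sup>2) * ((1 + D)\<^sup>2 * (norm u)\<^sup>2) / K\<^sup>2 \<le> (4 * \<rho>\<^sup>2 * n) * ((1 + D)\<^sup>2 * (norm u)\<^sup>2) / K\<^sup>2"
      unfolding m_def using sum_local_field_sq_le[OF \<rho> y] by (intro divide_right_mono mult_right_mono) auto
    also have "\<dots> = 4 * (1 + D)\<^sup>2 * \<rho>\<^sup>2 / K\<^sup>2 * (n * (norm u)\<^sup>2)" by simp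
    also have "\<dots> \<le> \<kappa> / 2 * (n * (norm u)\<^sup>2)" using K by (intro mult_right_mono) auto
    finally have "\<kappa> / 2 * n * (norm u)\<^sup>2 \<le> (\<Sum>i<n. (e i)\<^sup>2) - (\<Sum>i<n. (m i)\<^sup>2) * ((1 + D)\<^sup>2 * (norm u)\<^sup>2) / K\<^sup>2"
      using \<kappa> unfolding e_def by (simp add: algebra_simps)
    then show ?thesis using \<delta> by (intro diff_left_mono mult_left_mono) auto
  qed
  finally show ?thesis by (simp add: \<delta>_def)
qed

text \<open>
  At distance \<open>r\<close> the linear term is at most \<open>k \<surd>n r\<close> and the quadratic one equals
  \<open>\<delta> n r\<^sup>2 = 2 k \<surd>n r\<close>.
\<close>

lemma MPL_close:
  fixes \<Theta> :: "(real \<times> (real^'d)) set"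
  assumes sym: "symmetric_matrix n A"
    and \<rho>: "op_norm n A \<le> \<rho>" and y: "\<And>i. i < n \<Longrightarrow> \<bar>y i\<bar> \<le> 1"
    and t: "\<And>i. i < n \<Longrightarrow> \<bar>t i\<bar> \<le> 1" and x: "\<And>i. i < n \<Longrightarrow> norm (x i) \<le> D" and D: "D \<ge> 0"
    and K: "K > 0" "4 * (1 + D)\<^sup>2 * \<rho>\<^sup>2 / K\<^sup>2 \<le> \<kappa> / 2"
    and \<kappa>: "\<And>u. \<kappa> * n * (norm u)\<^sup>2 \<le> (\<Sum>i<n. (predictor x t u i)\<^sup>2)" "\<kappa> > 0"
    and score: "\<And>u. \<bar>residual_sum \<nu> n A (predictor x t \<beta>) (predictor x t u) y\<bar> \<le> k * sqrt n * norm u" "k > 0"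
    and \<delta>: "\<delta> = var_bound \<rho> (K + (1 + D) * (norm \<beta> + 1)) * \<kappa> / 4"
    and n: "n > 0" and r: "r = 2 * k / (\<delta> * sqrt n)" "r \<le> 1" "cball \<beta> r \<subseteq> \<Theta>"
    and \<Theta>: "convex \<Theta>"
  shows "MPL_exists n \<nu> A \<Theta> (x, t, y)"
    and "norm (MPL_estimator n \<nu> A \<Theta> (x, t, y) - \<beta>) \<le> r"
proof -
  let ?l = "log_pl n \<nu> A x t y"
  have \<delta>0: "\<delta> > 0" unfolding \<delta> using var_bound_pos \<kappa>(2) by simp
  have r0: "r > 0" unfolding r using score(2) \<delta>0 n by simp
  have nondeg: "(\<Sum>i<n. (predictor x t u i)\<^sup>2) > 0" if "u \<noteq> 0" for u
    using \<kappa>(1)[of u] \<kappa>(2) n that by (smt (verit) mult_pos_pos of_nat_0_less_iff zero_less_norm_iff zero_less_power)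
  have sphere: "?l b < ?l \<beta>" if b: "dist \<beta> b = r" for b
  proof -
    have nu: "norm (b - \<beta>) = r" using b by (simp add: dist_norm norm_minus_commute)
    have "?l (\<beta> + (b - \<beta>)) - ?l \<beta> \<le> residual_sum \<nu> n A (predictor x t \<beta>) (predictor x t (b - \<beta>)) y
        - \<delta> * n * (norm (b - \<beta>))\<^sup>2"
      unfolding \<delta> using nu r
      by (intro log_pl_increment_le[OF \<rho> y t x D K \<kappa>(1)]) auto
    also have "\<dots> \<le> k * sqrt n * r - \<delta> * n * r\<^sup>2"
      using score(1)[of "b - \<beta>"] unfolding nu by simp
    also have "\<delta> * n * r\<^sup>2 = (\<delta> * sqrt n * r) * (sqrt n * r)"
      by (simp add: power2_eq_square)
    also have "\<delta> * sqrt n * r = 2 * k" unfolding r using \<delta>0 n by simp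
    finally have "?l b - ?l \<beta> \<le> - (k * (sqrt n * r))" by (simp add: algebra_simps)
    moreover have "k * (sqrt n * r) > 0" using score(2) n r0 by simp
    ultimately show ?thesis by simp
  qed
  have conc: "(1 - l) * ?l b + l * ?l b' < ?l ((1 - l) *\<^sub>R b + l *\<^sub>R b')" if "b \<noteq> b'" "0 < l" "l < 1" for b b' l
    using that by (intro log_pl_strictly_concave nondeg)
  have max: "\<exists>!b. is_arg_max ?l (\<lambda>\<beta>. \<beta> \<in> \<Theta>) b"
    by (rule strictly_concave_unique_maximizer(1)[OF continuous_on_log_pl conc \<Theta> r0 r(3) sphere])
  have eq: "is_arg_max (pseudo_likelihood n \<nu> A (x, t, y)) (\<lambda>\<beta>. \<beta> \<in> \<Theta>) = is_arg_max ?l (\<lambda>\<beta>. \<beta> \<in> \<Theta>)"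
    by (simp add: fun_eq_iff is_arg_max_def pseudo_likelihood_eq[OF sym])
  show ex: "MPL_exists n \<nu> A \<Theta> (x, t, y)"
    unfolding MPL_exists_def eq by (rule max)
  have "is_arg_max ?l (\<lambda>\<beta>. \<beta> \<in> \<Theta>) (MPL_estimator n \<nu> A \<Theta> (x, t, y))"
    using ex theI'[OF max] by (simp add: MPL_estimator_def eq)
  then have "dist \<beta> (MPL_estimator n \<nu> A \<Theta> (x, t, y)) \<le> r"
    by (rule strictly_concave_unique_maximizer(2)[OF continuous_on_log_pl conc \<Theta> r0 r(3) sphere, rotated -1])
  then show "norm (MPL_estimator n \<nu> A \<Theta> (x, t, y) - \<beta>) \<le> r"
    by (simp add: dist_norm norm_minus_commute)
qed

end

section \<open>Nondegeneracy of the design\<close>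

text \<open>
  Two lower bounds for \<open>q = \<Sum>\<^sub>i (a t\<^sub>i + x\<^sub>i \<bullet> v)\<^sup>2\<close> are averaged. Dropping the treatments costs \<open>n a\<^sup>2\<close> and
  gives a multiple of \<open>n |v|\<^sup>2\<close>, useful when \<open>a\<close> is small. Replacing \<open>t\<^sub>i\<close> by a conditional mean \<open>b\<^sub>i\<close>
  plus a fluctuation gives \<open>a\<^sup>2 \<Sum>\<^sub>i (1 - b\<^sub>i\<^sup>2)\<close> up to a cross term that is linear in the residuals,
  useful when \<open>a\<close> is large.
\<close>

lemma design_nondegenerate:
  fixes x :: "nat \<Rightarrow> real^'d" and c \<delta> \<epsilon> \<eta> :: real
  assumes t: "\<And>i. i < n \<Longrightarrow> (t i)\<^sup>2 = 1"
    and covariates: "\<And>v. c / 2 * n * (norm v)\<^sup>2 \<le> (\<Sum>i<n. (x i \<bullet> v)\<^sup>2)"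
    and cross: "\<And>v. \<bar>\<Sum>i<n. (t i - b i) * (x i \<bullet> v)\<bar> \<le> \<epsilon> * n * norm v"
    and spins: "\<delta> * n \<le> (\<Sum>i<n. 1 - (b i)\<^sup>2)"
    and "c > 0" "\<delta> > 0" "\<epsilon> \<ge> 0"
    and \<eta>: "\<eta> = min (\<delta> / 2) (\<delta> / (2 * (1 + \<delta>)) * (c / 4))" and \<epsilon>: "\<epsilon> \<le> \<eta> / 2"
  shows "\<eta> / 2 * n * (norm u)\<^sup>2 \<le> (\<Sum>i<n. (predictor x t u i)\<^sup>2)"
proof -
  obtain a v where u: "u = (a, v)" by fastforce
  define q where "q = (\<Sum>i<n. (predictor x t u i)\<^sup>2)"
  \<comment> \<open>The loss in the first bound and the reduced weight of the second together take half of
    \<open>\<delta> n a\<^sup>2\<close>.\<close>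
  define w where "w = \<delta> / (2 * (1 + \<delta>))"
  have w: "0 < w" "w < 1" "w * (1 + \<delta>) = \<delta> / 2" using \<open>\<delta> > 0\<close> by (auto simp: w_def field_simps)
  have nu: "(norm u)\<^sup>2 = a\<^sup>2 + (norm v)\<^sup>2" by (simp add: u norm_Pair)
  have pred: "(predictor x t u i)\<^sup>2 = a\<^sup>2 * (t i)\<^sup>2 + 2 * (a * t i * (x i \<bullet> v)) + (x i \<bullet> v)\<^sup>2" for i
    by (simp add: predictor_def u power2_eq_square algebra_simps)
  have i: "c / 4 * n * (norm v)\<^sup>2 - n * a\<^sup>2 \<le> q"
  proof -
    have "(\<Sum>i<n. (x i \<bullet> v)\<^sup>2 / 2 - a\<^sup>2) \<le> q"
      unfolding q_def
    proof (rule sum_mono)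
      fix i assume "i \<in> {..<n}"
      then have "a\<^sup>2 * (t i)\<^sup>2 = a\<^sup>2" using t by simp
      moreover have "0 \<le> (2 * (a * t i) + x i \<bullet> v)\<^sup>2" by simp
      then have "0 \<le> 4 * (a\<^sup>2 * (t i)\<^sup>2) + 4 * (a * t i * (x i \<bullet> v)) + (x i \<bullet> v)\<^sup>2"
        by (simp add: power2_eq_square algebra_simps)
      ultimately show "(x i \<bullet> v)\<^sup>2 / 2 - a\<^sup>2 \<le> (predictor x t u i)\<^sup>2"
        unfolding pred using zero_le_power2[of "x i \<bullet> v"] by linarith
    qed
    then show ?thesis using covariates[of v] by (simp add: sum_subtractf sum_divide_distrib[symmetric])
  qed
  have ii: "\<delta> * n * a\<^sup>2 - \<epsilon> * n * (norm u)\<^sup>2 \<le> q"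
  proof -
    have "q = (\<Sum>i<n. a\<^sup>2 * (1 - (b i)\<^sup>2) + (a * b i + x i \<bullet> v)\<^sup>2 + 2 * a * ((t i - b i) * (x i \<bullet> v)))"
      unfolding q_def
    proof (rule sum.cong)
      fix i assume "i \<in> {..<n}"
      then have at: "a\<^sup>2 * (t i)\<^sup>2 = a\<^sup>2" using t by simp
      show "(predictor x t u i)\<^sup>2
          = a\<^sup>2 * (1 - (b i)\<^sup>2) + (a * b i + x i \<bullet> v)\<^sup>2 + 2 * a * ((t i - b i) * (x i \<bullet> v))"
        unfolding pred at by (simp add: power2_eq_square algebra_simps)
    qed simp
    also have "\<dots> = a\<^sup>2 * (\<Sum>i<n. 1 - (b i)\<^sup>2) + (\<Sum>i<n. (a * b i + x i \<bullet> v)\<^sup>2) + 2 * a * (\<Sum>i<n. (t i - b i) * (x i \<bullet> v))"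
      by (simp only: sum.distrib sum_distrib_left)
    finally have q: "q = a\<^sup>2 * (\<Sum>i<n. 1 - (b i)\<^sup>2) + (\<Sum>i<n. (a * b i + x i \<bullet> v)\<^sup>2) + 2 * a * (\<Sum>i<n. (t i - b i) * (x i \<bullet> v))" .
    have "a\<^sup>2 * (\<delta> * n) \<le> a\<^sup>2 * (\<Sum>i<n. 1 - (b i)\<^sup>2)" using spins by (intro mult_left_mono) auto
    moreover have "(\<Sum>i<n. (a * b i + x i \<bullet> v)\<^sup>2) \<ge> 0" by (intro sum_nonneg) auto
    moreover have "\<bar>2 * a * (\<Sum>i<n. (t i - b i) * (x i \<bullet> v))\<bar> \<le> 2 * \<bar>a\<bar> * (\<epsilon> * n * norm v)"
      unfolding abs_mult using cross[of v] by (intro mult_mono) auto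
    moreover have "2 * \<bar>a\<bar> * (\<epsilon> * n * norm v) \<le> \<epsilon> * n * (norm u)\<^sup>2"
    proof -
      have "2 * \<bar>a\<bar> * norm v \<le> (norm u)\<^sup>2"
        using sum_squares_bound[of "\<bar>a\<bar>" "norm v"] by (simp add: nu)
      then have "\<epsilon> * n * (2 * \<bar>a\<bar> * norm v) \<le> \<epsilon> * n * (norm u)\<^sup>2"
        using \<open>\<epsilon> \<ge> 0\<close> by (intro mult_left_mono) auto
      then show ?thesis by (simp add: mult_ac)
    qed
    ultimately show ?thesis unfolding q by (simp add: mult_ac)
  qed
  have "w * (c / 4 * n * (norm v)\<^sup>2 - n * a\<^sup>2) + (1 - w) * (\<delta> * n * a\<^sup>2 - \<epsilon> * n * (norm u)\<^sup>2) \<le> w * q + (1 - w) * q"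
    using i ii w by (intro add_mono mult_left_mono) auto
  also have "\<dots> = q" by (simp add: algebra_simps)
  finally have 1: "w * (c / 4 * n * (norm v)\<^sup>2 - n * a\<^sup>2) + (1 - w) * (\<delta> * n * a\<^sup>2 - \<epsilon> * n * (norm u)\<^sup>2) \<le> q" .
  have "(1 - w) * (\<epsilon> * n * (norm u)\<^sup>2) \<le> 1 * (\<epsilon> * n * (norm u)\<^sup>2)"
    using w \<open>\<epsilon> \<ge> 0\<close> by (intro mult_right_mono) auto
  moreover have "w * (c / 4 * n * (norm v)\<^sup>2 - n * a\<^sup>2) + (1 - w) * (\<delta> * n * a\<^sup>2 - \<epsilon> * n * (norm u)\<^sup>2)
      = w * (c / 4) * (n * (norm v)\<^sup>2) + (\<delta> - w * (1 + \<delta>)) * (n * a\<^sup>2) - (1 - w) * (\<epsilon> * n * (norm u)\<^sup>2)"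
    by (simp add: algebra_simps)
  moreover have "\<delta> - w * (1 + \<delta>) = \<delta> / 2" using w(3) by simp
  ultimately have 2: "w * (c / 4) * (n * (norm v)\<^sup>2) + \<delta> / 2 * (n * a\<^sup>2) - \<epsilon> * n * (norm u)\<^sup>2 \<le> q"
    using 1 unfolding \<open>\<delta> - w * (1 + \<delta>) = \<delta> / 2\<close>[symmetric] by linarith
  have "\<eta> * (n * (norm v)\<^sup>2) \<le> w * (c / 4) * (n * (norm v)\<^sup>2)" "\<eta> * (n * a\<^sup>2) \<le> \<delta> / 2 * (n * a\<^sup>2)"
    unfolding \<eta> w_def by (intro mult_right_mono min.cobounded1 min.cobounded2; simp)+
  moreover have "\<epsilon> * (n * (norm u)\<^sup>2) \<le> \<eta> / 2 * (n * (norm u)\<^sup>2)"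
    using \<epsilon> by (intro mult_right_mono) auto
  ultimately show ?thesis using 2 unfolding q_def nu by (simp add: algebra_simps)
qed

lemma spin_base: "bounded_base (count_space {-1, 1}) 2"
proof (intro bounded_base.intro finite_measureI bounded_base_axioms.intro)
  show "2 \<le> (\<integral>u. (u - c)\<^sup>2 \<partial>count_space {- 1, 1})" for c :: real
    by (simp add: lebesgue_integral_count_space_finite power2_eq_square algebra_simps)
qed (simp_all add: AE_count_space)

text \<open>
  Since \<open>u\<^sup>2 = 1\<close> on the support.
\<close>

lemma spin_tilted_var: "tilted_var (count_space {-1, 1}) a s = 1 - (tilted_mean (count_space {-1, 1}) a s)\<^sup>2"
proof -
  interpret bounded_base "count_space {-1, 1}" 2 by (rule spin_base)
  have "moment (count_space {-1, 1}) a 2 s = moment (count_space {-1, 1}) a 0 s"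
    unfolding moment_def by (intro Bochner_Integration.integral_cong) auto
  then show ?thesis using less_imp_neq[OF moment_0_pos[of a s]] by (simp add: tilted_var_def)
qed

section \<open>The joint law\<close>

interpretation spin: bounded_base "count_space {-1, 1}" 2 by (rule spin_base)

text \<open>
  As rules of the measurability prover these facts would propose the base measures, instead of the
  Borel sets, as codomains.
\<close>

declare spin.id_measurable [measurable del] spin.measurable_coordinate [measurable del]

lemma treatment_base_eq: "treatment_base n = spin.base n"
  by (simp add: treatment_base_def)

lemma treatment_density_eq:
  "treatment_density n Q \<gamma> x = normalized (treatment_base n) (gibbs_weight n Q (\<lambda>i. x i \<bullet> \<gamma>))"
  by (simp add: treatment_density_def gibbs_weight_def[abs_def])

lemma cube_measurable [measurable]: "cube r \<in> sets borel" by (simp add: cube_def)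

lemma cube_1_D:
  fixes z :: "real^'d"
  assumes "z \<in> cube 1" shows "\<bar>z $ k\<bar> \<le> 1" "norm z \<le> CARD('d)"
proof -
  have *: "\<bar>z $ j\<bar> \<le> 1" for j
    using assms by (auto simp: cube_def mem_box_cart abs_le_iff minus_le_iff)
  then show "\<bar>z $ k\<bar> \<le> 1" .
  have "norm z \<le> (\<Sum>k\<in>UNIV. \<bar>z $ k\<bar>)" by (rule norm_le_l1_cart)
  also have "\<dots> \<le> (\<Sum>k\<in>(UNIV::'d set). 1)" by (intro sum_mono *)
  finally show "norm z \<le> CARD('d)" by simp
qed

lemma sum_abs_components_le: "(\<Sum>k\<in>UNIV. \<bar>v $ k\<bar>) \<le> CARD('d) * norm v" for v :: "real^'d"
proof -
  have "(\<Sum>k\<in>UNIV. \<bar>v $ k\<bar>) \<le> (\<Sum>k\<in>(UNIV::'d set). norm v)"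
    by (intro sum_mono component_le_norm_cart)
  then show ?thesis by simp
qed

lemma abs_sum_components_le:
  fixes v :: "real^'d"
  assumes "\<And>k. \<bar>f k\<bar> \<le> a"
  shows "\<bar>\<Sum>k\<in>UNIV. v $ k * f k\<bar> \<le> a * (CARD('d) * norm v)"
proof -
  have "\<bar>\<Sum>k\<in>UNIV. v $ k * f k\<bar> \<le> (\<Sum>k\<in>UNIV. \<bar>v $ k\<bar> * a)"
    by (rule order_trans[OF sum_abs]) (auto simp: abs_mult intro!: sum_mono mult_left_mono assms)
  also have "\<dots> = (\<Sum>k\<in>UNIV. \<bar>v $ k\<bar>) * a" by (simp add: sum_distrib_right)
  also have "\<dots> \<le> (CARD('d) * norm v) * a"
    using sum_abs_components_le[of v] order_trans[OF abs_ge_zero assms] by (intro mult_right_mono) auto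
  finally show ?thesis by (simp add: mult.commute)
qed

text \<open>
  Chebyshev's inequality for second moments given as nonnegative integrals, which is the form in
  which Tonelli's theorem delivers them.
\<close>

lemma measure_abs_gt_le:
  assumes [measurable]: "F \<in> borel_measurable M" and a: "a > 0" and "C \<ge> 0"
    and F: "(\<integral>\<^sup>+w. ennreal ((F w)\<^sup>2) \<partial>M) \<le> ennreal C"
  shows "measure M {w \<in> space M. a < \<bar>F w\<bar>} \<le> C / a\<^sup>2"
proof -
  have "emeasure M {w \<in> space M. a < \<bar>F w\<bar>} \<le> emeasure M {w \<in> space M. 1 \<le> ennreal (1 / a\<^sup>2) * ennreal ((F w)\<^sup>2)}"
  proof (rule emeasure_mono)
    show "{w \<in> space M. a < \<bar>F w\<bar>} \<subseteq> {w \<in> space M. 1 \<le> ennreal (1 / a\<^sup>2) * ennreal ((F w)\<^sup>2)}"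
    proof clarify
      fix w assume "a < \<bar>F w\<bar>"
      then have "a\<^sup>2 \<le> (F w)\<^sup>2" using a power_mono[of a "\<bar>F w\<bar>" 2] by simp
      then have "1 \<le> 1 / a\<^sup>2 * (F w)\<^sup>2" using a by simp
      then have "ennreal 1 \<le> ennreal (1 / a\<^sup>2 * (F w)\<^sup>2)" by (rule ennreal_leI)
      then show "1 \<le> ennreal (1 / a\<^sup>2) * ennreal ((F w)\<^sup>2)" using a by (simp add: ennreal_mult[symmetric])
    qed
  qed measurable
  also have "\<dots> \<le> ennreal (1 / a\<^sup>2) * (\<integral>\<^sup>+w. ennreal ((F w)\<^sup>2) * indicator (space M) w \<partial>M)"
    by (rule nn_integral_Markov_inequality) auto
  also have "(\<integral>\<^sup>+w. ennreal ((F w)\<^sup>2) * indicator (space M) w \<partial>M) = (\<integral>\<^sup>+w. ennreal ((F w)\<^sup>2) \<partial>M)"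
    by (intro nn_integral_cong) simp
  also have "ennreal (1 / a\<^sup>2) * (\<integral>\<^sup>+w. ennreal ((F w)\<^sup>2) \<partial>M) \<le> ennreal (1 / a\<^sup>2) * ennreal C"
    by (intro mult_left_mono F) auto
  also have "\<dots> = ennreal (C / a\<^sup>2)" using a \<open>C \<ge> 0\<close> by (simp add: ennreal_mult[symmetric])
  finally show ?thesis using \<open>C \<ge> 0\<close> unfolding measure_def by (intro enn2real_leI) auto
qed

lemma nn_integral_centered_sum_sq_le:
  fixes g :: "'a \<Rightarrow> real" and n :: nat
  assumes "prob_space M" and g [measurable]: "g \<in> borel_measurable M"
    and bound: "AE z in M. \<bar>g z\<bar> \<le> K" and K: "K \<ge> 0" and centered: "(\<integral>z. g z \<partial>M) = 0"
  shows "(\<integral>\<^sup>+x. ennreal ((\<Sum>i<n. g (x i))\<^sup>2) \<partial>PiM {..<n} (\<lambda>_. M)) \<le> ennreal (K\<^sup>2 * n)"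
proof -
  interpret M: prob_space M by fact
  let ?P = "PiM {..<n} (\<lambda>_. M)"
  interpret P: prob_space ?P by (intro prob_space_PiM assms)
  have mg [measurable]: "(\<lambda>x. g (x i)) \<in> borel_measurable ?P" if "i < n" for i
    by (rule measurable_compose[OF measurable_component_singleton[of i "{..<n}" "\<lambda>_. M"] g]) (use that in auto)
  have AE: "AE x in ?P. \<forall>i\<in>{..<n}. \<bar>g (x i)\<bar> \<le> K"
    by (intro AE_finite_allI AE_PiM_coordinate M.finite_measure_axioms bound) auto
  have int: "integrable ?P (\<lambda>x. g (x i) * g (x j))" if "i < n" "j < n" for i j
  proof (rule P.integrable_const_bound[where B = "K * K"])
    show "AE x in ?P. norm (g (x i) * g (x j)) \<le> K * K"
      using AE by eventually_elim (use that K in \<open>auto simp: abs_mult intro!: mult_mono\<close>)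
  qed (use that in measurable)
  have off: "(\<integral>x. g (x i) * g (x j) \<partial>?P) = 0" if "i < n" "j < n" "i \<noteq> j" for i j
    by (rule integral_PiM_eq_0[OF M.finite_measure_axioms that(1) int[OF that(1,2)]]) (use that centered in simp)
  have diag: "(\<integral>x. g (x i) * g (x i) \<partial>?P) \<le> K\<^sup>2" if "i < n" for i
  proof -
    have "(\<integral>x. g (x i) * g (x i) \<partial>?P) \<le> (\<integral>x. K * K \<partial>?P)"
    proof (rule integral_mono_AE[OF int[OF that that]])
      show "AE x in ?P. g (x i) * g (x i) \<le> K * K"
        using AE
      proof eventually_elim
        case (elim x)
        then have "\<bar>g (x i)\<bar> * \<bar>g (x i)\<bar> \<le> K * K" using that K by (intro mult_mono) auto
        then show ?case by simp
      qed
    qed simp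
    then show ?thesis by (simp add: P.prob_space power2_eq_square)
  qed
  have sq: "(\<Sum>i<n. g (x i))\<^sup>2 = (\<Sum>i<n. \<Sum>j<n. g (x i) * g (x j))" for x
    by (simp add: power2_eq_square sum_product)
  have "(\<integral>\<^sup>+x. ennreal ((\<Sum>i<n. g (x i))\<^sup>2) \<partial>?P) = ennreal (\<integral>x. (\<Sum>i<n. g (x i))\<^sup>2 \<partial>?P)"
  proof (rule nn_integral_eq_integral)
    show "integrable ?P (\<lambda>x. (\<Sum>i<n. g (x i))\<^sup>2)"
      unfolding sq by (intro Bochner_Integration.integrable_sum int) auto
  qed simp
  also have "(\<integral>x. (\<Sum>i<n. g (x i))\<^sup>2 \<partial>?P) = (\<Sum>i<n. \<Sum>j<n. \<integral>x. g (x i) * g (x j) \<partial>?P)"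
    unfolding sq by (subst Bochner_Integration.integral_sum; (intro Bochner_Integration.integrable_sum int; simp)?)
      (intro sum.cong refl Bochner_Integration.integral_sum int; simp)
  also have "\<dots> = (\<Sum>i<n. \<integral>x. g (x i) * g (x i) \<partial>?P)"
    using off by (intro sum.cong refl) (subst sum.remove, auto intro!: sum.neutral)
  also have "\<dots> \<le> (\<Sum>i<n. K\<^sup>2)" by (intro sum_mono diag) auto
  finally show ?thesis by (simp add: mult.commute ennreal_leI)
qed

text \<open>
  One sample of size \<open>n\<close>. The bound \<open>\<rho>\<close> is shared by both matrices and will not depend on \<open>n\<close>, so
  that all constants derived from it are uniform in \<open>n\<close>.
\<close>

locale sample_model = outcome: bounded_base \<mu> v\<^sub>0 for \<mu> v\<^sub>0 +
  fixes n :: nat and PX :: "(real^'d) measure" and Q A :: "nat \<Rightarrow> nat \<Rightarrow> real"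
    and \<gamma> :: "real^'d" and \<beta> :: "real \<times> (real^'d)" and \<rho> :: real
  assumes PX_prob: "prob_space PX" and PX_sets [measurable_cong]: "sets PX = sets borel"
    and PX_cube: "AE z in PX. z \<in> cube 1"
    and \<mu>_prob: "prob_space \<mu>"
    and A_sym: "symmetric_matrix n A" and A_norm: "op_norm n A \<le> \<rho>"
    and Q_sym: "symmetric_matrix n Q" and Q_norm: "op_norm n Q \<le> \<rho>"
begin

declare outcome.id_measurable [measurable del] outcome.measurable_coordinate [measurable del]

abbreviation "XB \<equiv> PiM {..<n} (\<lambda>_. PX)"
abbreviation "TB \<equiv> treatment_base n"
abbreviation "YB \<equiv> outcome_base n \<mu>"
abbreviation "td \<equiv> treatment_density n Q \<gamma>"
abbreviation "od \<equiv> outcome_density n \<mu> A \<beta>"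
abbreviation "base3 \<equiv> XB \<Otimes>\<^sub>M TB \<Otimes>\<^sub>M YB"
abbreviation "law \<equiv> model_law n PX Q \<gamma> \<mu> A \<beta>"
abbreviation "C\<^sub>\<rho> \<equiv> 2 + 4 * \<rho> + 12 * \<rho>\<^sup>2"

lemma \<rho>_nonneg: "\<rho> \<ge> 0" using op_norm_nonneg[of n A] A_norm by linarith

lemma YB_eq: "YB = outcome.base n" by (simp add: outcome_base_def)

sublocale XB: prob_space XB by (intro prob_space_PiM PX_prob)
sublocale TB: finite_measure TB unfolding treatment_base_eq by (rule spin.finite_measure_base)
sublocale YB: finite_measure YB unfolding YB_eq by (rule outcome.finite_measure_base)

lemma sets_law [simp, measurable_cong]: "sets law = sets base3"
  by (simp add: model_law_def)

lemma space_law: "space law = space XB \<times> space TB \<times> space YB"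
  by (simp add: model_law_def space_pair_measure)

lemma measurable_x: "i < n \<Longrightarrow> (\<lambda>x. x i) \<in> borel_measurable XB"
  using measurable_component_singleton[of i "{..<n}" "\<lambda>_. PX"] measurable_cong_sets[OF refl PX_sets] by auto

lemma measurable_t: "i < n \<Longrightarrow> (\<lambda>t. t i) \<in> borel_measurable TB"
  unfolding treatment_base_eq by (rule spin.measurable_coordinate)

lemma measurable_y: "i < n \<Longrightarrow> (\<lambda>y. y i) \<in> borel_measurable YB"
  unfolding YB_eq by (rule outcome.measurable_coordinate)

lemma measurable_predictor:
  assumes "i < n" "f \<in> measurable M XB" "g \<in> measurable M TB"
  shows "(\<lambda>w. predictor (f w) (g w) b i) \<in> borel_measurable M"
proof -
  have [measurable]: "(\<lambda>w. f w i) \<in> borel_measurable M" "(\<lambda>w. g w i) \<in> borel_measurable M"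
    using measurable_compose[OF assms(2) measurable_x[OF assms(1)]]
      measurable_compose[OF assms(3) measurable_t[OF assms(1)]] by auto
  show ?thesis unfolding predictor_def by measurable
qed

lemma measurable_treatment_density:
  "(\<lambda>(x, t). td x t) \<in> borel_measurable (XB \<Otimes>\<^sub>M TB)"
proof -
  have W [measurable]: "(\<lambda>(x, t). gibbs_weight n Q (\<lambda>i. x i \<bullet> \<gamma>) t) \<in> borel_measurable (XB \<Otimes>\<^sub>M TB)"
    unfolding split_beta'
  proof (rule measurable_gibbs_weight)
    fix j assume j: "j < n"
    show "(\<lambda>w. snd w j) \<in> borel_measurable (XB \<Otimes>\<^sub>M TB)"
      by (rule measurable_compose[OF measurable_snd measurable_t[OF j]])
    have "(\<lambda>w. fst w j) \<in> borel_measurable (XB \<Otimes>\<^sub>M TB)"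
      by (rule measurable_compose[OF measurable_fst measurable_x[OF j]])
    then show "(\<lambda>w. fst w j \<bullet> \<gamma>) \<in> borel_measurable (XB \<Otimes>\<^sub>M TB)" by measurable
  qed
  have [measurable]: "(\<lambda>x. \<integral>t. gibbs_weight n Q (\<lambda>i. x i \<bullet> \<gamma>) t \<partial>TB) \<in> borel_measurable XB"
    by (rule TB.borel_measurable_lebesgue_integral[OF W])
  show ?thesis unfolding treatment_density_eq normalized_def by measurable
qed

lemma measurable_outcome_density:
  "(\<lambda>(x, t, y). od x t y) \<in> borel_measurable base3"
proof -
  have W1: "(\<lambda>w. gibbs_weight n A (predictor (fst (fst w)) (snd (fst w)) \<beta>) (snd w))
      \<in> borel_measurable ((XB \<Otimes>\<^sub>M TB) \<Otimes>\<^sub>M YB)"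
  proof (rule measurable_gibbs_weight)
    fix j assume j: "j < n"
    show "(\<lambda>w. snd w j) \<in> borel_measurable ((XB \<Otimes>\<^sub>M TB) \<Otimes>\<^sub>M YB)"
      by (rule measurable_compose[OF measurable_snd measurable_y[OF j]])
    show "(\<lambda>w. predictor (fst (fst w)) (snd (fst w)) \<beta> j) \<in> borel_measurable ((XB \<Otimes>\<^sub>M TB) \<Otimes>\<^sub>M YB)"
      by (rule measurable_predictor[OF j]) measurable
  qed
  have "(\<lambda>w. \<integral>y. gibbs_weight n A (predictor (fst w) (snd w) \<beta>) y \<partial>YB) \<in> borel_measurable (XB \<Otimes>\<^sub>M TB)"
    by (rule YB.borel_measurable_lebesgue_integral) (use W1 in \<open>simp add: split_beta'\<close>)
  from measurable_compose[OF _ this, of "\<lambda>w. (fst w, fst (snd w))" base3]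
  have Z: "(\<lambda>w. \<integral>y. gibbs_weight n A (predictor (fst w) (fst (snd w)) \<beta>) y \<partial>YB) \<in> borel_measurable base3"
    by simp
  from measurable_compose[OF _ W1, of "\<lambda>w. ((fst w, fst (snd w)), snd (snd w))" base3]
  have W: "(\<lambda>w. gibbs_weight n A (predictor (fst w) (fst (snd w)) \<beta>) (snd (snd w))) \<in> borel_measurable base3"
    by simp
  show ?thesis
    unfolding outcome_density_eq normalized_def split_beta'
    using borel_measurable_divide[OF W Z] by (simp add: outcome_base_def)
qed

text \<open>
  The defining density is disintegrated: the two normalized factors act as probability kernels for
  the treatments given the covariates and the outcomes given both.
\<close>

lemma nn_integral_law:
  assumes [measurable]: "f \<in> borel_measurable base3"
  shows "(\<integral>\<^sup>+w. f w \<partial>law) = (\<integral>\<^sup>+x. \<integral>\<^sup>+t. ennreal (td x t)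
      * (\<integral>\<^sup>+y. ennreal (od x t y) * f (x, t, y) \<partial>YB) \<partial>TB \<partial>XB)"
proof -
  interpret TY: pair_sigma_finite TB YB by unfold_locales
  interpret TY: sigma_finite_measure "TB \<Otimes>\<^sub>M YB" by (rule TY.sigma_finite_measure_axioms)
  note [measurable] = measurable_outcome_density
  have td: "(\<lambda>w. td (fst w) (fst (snd w))) \<in> borel_measurable base3"
    using measurable_compose[OF _ measurable_treatment_density, of "\<lambda>w. (fst w, fst (snd w))" base3] by simp
  define D where "D = (\<lambda>(x, t, y). ennreal (td x t * od x t y))"
  have D [measurable]: "D \<in> borel_measurable base3"
    unfolding D_def split_beta' using td measurable_outcome_density by (simp add: split_beta')
  have td0: "td x t \<ge> 0" for x t
    unfolding treatment_density_eq normalized_def treatment_base_eq using spin.gibbs_normalizer_pos[of n Q]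
    by (intro divide_nonneg_nonneg) (auto simp: gibbs_weight_def intro: less_imp_le)
  have sec: "(\<lambda>z. D (x, z) * f (x, z)) \<in> borel_measurable (TB \<Otimes>\<^sub>M YB)" if "x \<in> space XB" for x
    using that by measurable
  have odf: "(\<lambda>y. ennreal (od x t y) * f (x, t, y)) \<in> borel_measurable YB"
    if "x \<in> space XB" "t \<in> space TB" for x t
  proof -
    have "(\<lambda>w. ennreal ((\<lambda>(x, t, y). od x t y) w) * f w) \<in> borel_measurable base3" by measurable
    from measurable_compose[OF _ this, of "\<lambda>y. (x, t, y)" YB] that show ?thesis by simp
  qed
  have "(\<integral>\<^sup>+w. f w \<partial>law) = (\<integral>\<^sup>+w. D w * f w \<partial>base3)"
    unfolding model_law_def D_def[symmetric] by (rule nn_integral_density) measurable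
  also have "\<dots> = (\<integral>\<^sup>+x. \<integral>\<^sup>+z. D (x, z) * f (x, z) \<partial>(TB \<Otimes>\<^sub>M YB) \<partial>XB)"
    by (rule TY.nn_integral_fst[symmetric]) measurable
  also have "\<dots> = (\<integral>\<^sup>+x. \<integral>\<^sup>+t. \<integral>\<^sup>+y. D (x, t, y) * f (x, t, y) \<partial>YB \<partial>TB \<partial>XB)"
    by (intro nn_integral_cong YB.nn_integral_fst[symmetric] sec)
  also have "\<dots> = (\<integral>\<^sup>+x. \<integral>\<^sup>+t. ennreal (td x t)
      * (\<integral>\<^sup>+y. ennreal (od x t y) * f (x, t, y) \<partial>YB) \<partial>TB \<partial>XB)"
    by (intro nn_integral_cong)
       (subst nn_integral_cmult[symmetric], auto intro!: nn_integral_cong odf simp: D_def ennreal_mult' td0 mult.assoc)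
  finally show ?thesis .
qed

lemma nn_integral_outcome_density: "(\<integral>\<^sup>+y. ennreal (od x t y) \<partial>YB) = 1"
  unfolding outcome_density_eq YB_eq by (rule outcome.nn_integral_normalized_gibbs)

lemma nn_integral_treatment_density: "(\<integral>\<^sup>+t. ennreal (td x t) \<partial>TB) = 1"
  unfolding treatment_density_eq treatment_base_eq by (rule spin.nn_integral_normalized_gibbs)

lemma measurable_od: "x \<in> space XB \<Longrightarrow> t \<in> space TB \<Longrightarrow> od x t \<in> borel_measurable YB"
  using measurable_compose[OF _ measurable_outcome_density, of "\<lambda>y. (x, t, y)" YB] by simp

lemma measurable_td: "x \<in> space XB \<Longrightarrow> td x \<in> borel_measurable TB"
  using measurable_compose[OF _ measurable_treatment_density, of "\<lambda>t. (x, t)" TB] by simp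

text \<open>
  Averaging a conditional bound. It is required for almost every \<open>x\<close> only, because the covariates lie
  in the unit cube merely almost surely.
\<close>

lemma nn_integral_law_le:
  assumes "f \<in> borel_measurable base3"
    and "AE x in XB. \<forall>t\<in>space TB. (\<integral>\<^sup>+y. ennreal (od x t y) * f (x, t, y) \<partial>YB) \<le> C"
  shows "(\<integral>\<^sup>+w. f w \<partial>law) \<le> C"
proof -
  have "(\<integral>\<^sup>+w. f w \<partial>law) \<le> (\<integral>\<^sup>+x. C \<partial>XB)"
    unfolding nn_integral_law[OF assms(1)]
  proof (rule nn_integral_mono_AE)
    show "AE x in XB. (\<integral>\<^sup>+t. ennreal (td x t)
        * (\<integral>\<^sup>+y. ennreal (od x t y) * f (x, t, y) \<partial>YB) \<partial>TB) \<le> C"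
      using assms(2) AE_space
    proof eventually_elim
      case (elim x)
      have "(\<integral>\<^sup>+t. ennreal (td x t)
          * (\<integral>\<^sup>+y. ennreal (od x t y) * f (x, t, y) \<partial>YB) \<partial>TB)
        \<le> (\<integral>\<^sup>+t. ennreal (td x t) * C \<partial>TB)"
        using elim by (intro nn_integral_mono mult_left_mono) auto
      also have "\<dots> = C"
        using nn_integral_treatment_density[of x] measurable_td[OF elim(2)] by (subst nn_integral_multc) auto
      finally show ?case .
    qed
  qed
  then show ?thesis by (simp add: XB.emeasure_space_1)
qed

lemma nn_integral_law_xt:
  assumes f: "f \<in> borel_measurable (XB \<Otimes>\<^sub>M TB)"
  shows "(\<integral>\<^sup>+w. f (fst w, fst (snd w)) \<partial>law) = (\<integral>\<^sup>+x. \<integral>\<^sup>+t. ennreal (td x t) * f (x, t) \<partial>TB \<partial>XB)"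
proof -
  have "(\<lambda>w. f (fst w, fst (snd w))) \<in> borel_measurable base3"
    using measurable_compose[OF _ f, of "\<lambda>w. (fst w, fst (snd w))" base3] by simp
  then have "(\<integral>\<^sup>+w. f (fst w, fst (snd w)) \<partial>law) = (\<integral>\<^sup>+x. \<integral>\<^sup>+t. ennreal (td x t)
      * (\<integral>\<^sup>+y. ennreal (od x t y) * f (x, t) \<partial>YB) \<partial>TB \<partial>XB)"
    by (subst nn_integral_law) auto
  also have "\<dots> = (\<integral>\<^sup>+x. \<integral>\<^sup>+t. ennreal (td x t) * f (x, t) \<partial>TB \<partial>XB)"
    by (intro nn_integral_cong) (subst nn_integral_multc, auto intro!: measurable_compose[OF measurable_od measurable_ennreal] simp: nn_integral_outcome_density)
  finally show ?thesis .
qed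

lemma nn_integral_law_x:
  assumes f: "f \<in> borel_measurable XB"
  shows "(\<integral>\<^sup>+w. f (fst w) \<partial>law) = (\<integral>\<^sup>+x. f x \<partial>XB)"
proof -
  have "(\<lambda>z. f (fst z)) \<in> borel_measurable (XB \<Otimes>\<^sub>M TB)" using f by measurable
  then have "(\<integral>\<^sup>+w. f (fst w) \<partial>law) = (\<integral>\<^sup>+x. \<integral>\<^sup>+t. ennreal (td x t) * f x \<partial>TB \<partial>XB)"
    using nn_integral_law_xt[of "\<lambda>z. f (fst z)"] by simp
  also have "\<dots> = (\<integral>\<^sup>+x. f x \<partial>XB)"
    by (intro nn_integral_cong) (subst nn_integral_multc, auto intro!: measurable_compose[OF measurable_td measurable_ennreal] simp: nn_integral_treatment_density)
  finally show ?thesis .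
qed

sublocale law: prob_space law
proof
  have "emeasure law (space law) = (\<integral>\<^sup>+w. 1 \<partial>law)" by simp
  also have "\<dots> = 1" using nn_integral_law_x[of "\<lambda>_. 1"] by (simp add: XB.emeasure_space_1)
  finally show "emeasure law (space law) = 1" .
qed

lemma AE_x: "AE x in XB. \<forall>i\<in>{..<n}. x i \<in> cube 1"
  by (intro AE_finite_allI AE_PiM_coordinate prob_space.finite_measure PX_prob PX_cube) auto

lemma AE_law_x: "AE w in law. \<forall>i\<in>{..<n}. fst w i \<in> cube 1"
proof -
  let ?B = "{x \<in> space XB. \<exists>i\<in>{..<n}. x i \<notin> cube 1}"
  have B [measurable]: "?B \<in> sets XB"
    using measurable_x by (intro sets.sets_Collect_finite_Ex) (auto intro!: measurable_sets_borel[of _ _ "- cube 1"] simp: )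
  have "(\<integral>\<^sup>+w. indicator ?B (fst w) \<partial>law) = (\<integral>\<^sup>+x. indicator ?B x \<partial>XB)"
    by (rule nn_integral_law_x) measurable
  also have "\<dots> = 0"
    using AE_x by (subst nn_integral_0_iff_AE) (auto elim!: eventually_mono simp: indicator_def)
  finally have "AE w in law. indicator ?B (fst w) = (0::ennreal)"
    by (subst (asm) nn_integral_0_iff_AE) (auto intro!: measurable_compose[OF measurable_fst] borel_measurable_indicator)
  then show ?thesis
    using AE_space by eventually_elim (auto simp: indicator_def space_law split: if_splits)
qed

lemma AE_law_y: "AE w in law. \<forall>i\<in>{..<n}. \<bar>snd (snd w) i\<bar> \<le> 1"
proof -
  let ?B = "{y \<in> space YB. \<exists>i\<in>{..<n}. \<not> \<bar>y i\<bar> \<le> 1}"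
  have B [measurable]: "?B \<in> sets YB"
  proof (intro sets.sets_Collect_finite_Ex)
    fix i assume "i \<in> {..<n}"
    then have [measurable]: "(\<lambda>y. y i) \<in> borel_measurable YB" by (intro measurable_y) auto
    show "{y \<in> space YB. \<not> \<bar>y i\<bar> \<le> 1} \<in> sets YB" by measurable
  qed auto
  have [measurable]: "(\<lambda>w. indicator ?B (snd (snd w)) :: ennreal) \<in> borel_measurable base3" by measurable
  have "(\<integral>\<^sup>+w. indicator ?B (snd (snd w)) \<partial>law) \<le> 0"
  proof (rule nn_integral_law_le)
    have "(\<integral>\<^sup>+y. ennreal (od x t y) * indicator ?B y \<partial>YB) = (\<integral>\<^sup>+y. 0 \<partial>YB)" for x t
    proof (rule nn_integral_cong_AE)
      show "AE y in YB. ennreal (od x t y) * indicator ?B y = 0"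
        using outcome.AE_base[of n] unfolding YB_eq by eventually_elim (auto simp: indicator_def)
    qed
    then show "AE x in XB. \<forall>t\<in>space TB. (\<integral>\<^sup>+y. ennreal (od x t y)
        * indicator ?B (snd (snd (x, t, y))) \<partial>YB) \<le> 0" by simp
  qed measurable
  then have "(\<integral>\<^sup>+w. indicator ?B (snd (snd w)) \<partial>law) = 0" by simp
  then have "AE w in law. indicator ?B (snd (snd w)) = (0::ennreal)"
    by (subst (asm) nn_integral_0_iff_AE) auto
  then show ?thesis
    using AE_space by eventually_elim (auto simp: indicator_def space_law split: if_splits)
qed

lemma space_TB_D: "t \<in> space TB \<Longrightarrow> i < n \<Longrightarrow> t i = 1 \<or> t i = -1"
  by (auto simp: treatment_base_def space_PiM PiE_iff)

abbreviation score ::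
  "((nat \<Rightarrow> real^'d) \<Rightarrow> (nat \<Rightarrow> real) \<Rightarrow> nat \<Rightarrow> real) \<Rightarrow> (nat \<Rightarrow> real^'d) \<times> (nat \<Rightarrow> real) \<times> (nat \<Rightarrow> real) \<Rightarrow> real" where
  "score c \<equiv> \<lambda>w. residual_sum \<mu> n A (predictor (fst w) (fst (snd w)) \<beta>) (c (fst w) (fst (snd w))) (snd (snd w))"

abbreviation spin_score :: "'d \<Rightarrow> (nat \<Rightarrow> real^'d) \<times> (nat \<Rightarrow> real) \<times> (nat \<Rightarrow> real) \<Rightarrow> real" where
  "spin_score k \<equiv> \<lambda>w. residual_sum (count_space {-1, 1}) n Q (\<lambda>i. fst w i \<bullet> \<gamma>) (\<lambda>i. fst w i $ k) (fst (snd w))"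

definition second_moment :: "'d \<Rightarrow> 'd \<Rightarrow> real" where
  "second_moment j k = (\<integral>z. z $ j * z $ k \<partial>PX)"

abbreviation covariate_error :: "'d \<Rightarrow> 'd \<Rightarrow> (nat \<Rightarrow> real^'d) \<times> (nat \<Rightarrow> real) \<times> (nat \<Rightarrow> real) \<Rightarrow> real" where
  "covariate_error j k \<equiv> \<lambda>w. \<Sum>i<n. fst w i $ j * fst w i $ k - second_moment j k"

lemma score_second_moment:
  assumes c: "\<And>i. i < n \<Longrightarrow> (\<lambda>w. c (fst w) (fst (snd w)) i) \<in> borel_measurable base3"
    and bound: "AE x in XB. \<forall>t\<in>space TB. \<forall>i<n. \<bar>c x t i\<bar> \<le> 1"
  shows "score c \<in> borel_measurable base3"
    and "a > 0 \<Longrightarrow> measure law {w \<in> space law. a < \<bar>score c w\<bar>} \<le> C\<^sub>\<rho> * n / a\<^sup>2"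
proof -
  let ?F = "score c"
  show F [measurable]: "?F \<in> borel_measurable base3"
  proof (rule outcome.measurable_residual_sum[OF _ _ c])
    fix j assume j: "j < n"
    show "(\<lambda>w. snd (snd w) j) \<in> borel_measurable base3"
      by (rule measurable_compose[OF _ measurable_y[OF j]]) measurable
    show "(\<lambda>w. predictor (fst w) (fst (snd w)) \<beta> j) \<in> borel_measurable base3"
      by (rule measurable_predictor[OF j]) measurable
  qed
  have "(\<integral>\<^sup>+w. ennreal ((?F w)\<^sup>2) \<partial>law) \<le> ennreal (C\<^sub>\<rho> * n)"
  proof (rule nn_integral_law_le)
    show "AE x in XB. \<forall>t\<in>space TB. (\<integral>\<^sup>+y. ennreal (od x t y) * ennreal ((?F (x, t, y))\<^sup>2) \<partial>YB)
        \<le> ennreal (C\<^sub>\<rho> * n)"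
      using bound
    proof eventually_elim
      case (elim x)
      then show ?case
        unfolding outcome_density_eq YB_eq fst_conv snd_conv
        by (intro ballI outcome.nn_integral_residual_sum_sq_le A_sym A_norm) auto
    qed
  qed measurable
  then show "measure law {w \<in> space law. a < \<bar>?F w\<bar>} \<le> C\<^sub>\<rho> * n / a\<^sup>2" if "a > 0"
    using that \<rho>_nonneg by (intro measure_abs_gt_le) auto
qed

lemma spin_residual_second_moment:
  fixes k :: 'd
  shows "spin_score k \<in> borel_measurable base3"
    and "a > 0 \<Longrightarrow> measure law {w \<in> space law. a < \<bar>spin_score k w\<bar>} \<le> C\<^sub>\<rho> * n / a\<^sup>2"
proof -
  let ?F = "spin_score k"
  define G where "G w = residual_sum (count_space {-1, 1}) n Q (\<lambda>i. fst w i \<bullet> \<gamma>) (\<lambda>i. fst w i $ k) (snd w)"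
    for w :: "(nat \<Rightarrow> real^'d) \<times> (nat \<Rightarrow> real)"
  have G [measurable]: "G \<in> borel_measurable (XB \<Otimes>\<^sub>M TB)"
    unfolding G_def
  proof (rule spin.measurable_residual_sum)
    fix j assume j: "j < n"
    show "(\<lambda>w. snd w j) \<in> borel_measurable (XB \<Otimes>\<^sub>M TB)"
      by (rule measurable_compose[OF measurable_snd measurable_t[OF j]])
    have x: "(\<lambda>w. fst w j) \<in> borel_measurable (XB \<Otimes>\<^sub>M TB)"
      by (rule measurable_compose[OF measurable_fst measurable_x[OF j]])
    show "(\<lambda>w. fst w j \<bullet> \<gamma>) \<in> borel_measurable (XB \<Otimes>\<^sub>M TB)"
      by (rule borel_measurable_inner[OF x borel_measurable_const])
    show "(\<lambda>w. fst w j $ k) \<in> borel_measurable (XB \<Otimes>\<^sub>M TB)"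
      by (rule measurable_compose[OF x]) measurable
  qed
  have FG: "?F = (\<lambda>w. G (fst w, fst (snd w)))" by (simp add: G_def)
  show F [measurable]: "?F \<in> borel_measurable base3" unfolding FG by measurable
  have "(\<integral>\<^sup>+w. ennreal ((?F w)\<^sup>2) \<partial>law) = (\<integral>\<^sup>+x. \<integral>\<^sup>+t. ennreal (td x t) * ennreal ((G (x, t))\<^sup>2) \<partial>TB \<partial>XB)"
  proof -
    have "(\<lambda>z. ennreal ((G z)\<^sup>2)) \<in> borel_measurable (XB \<Otimes>\<^sub>M TB)" by measurable
    from nn_integral_law_xt[OF this] show ?thesis by (simp add: G_def)
  qed
  also have "\<dots> \<le> (\<integral>\<^sup>+x. ennreal (C\<^sub>\<rho> * n) \<partial>XB)"
  proof (rule nn_integral_mono_AE)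
    show "AE x in XB. (\<integral>\<^sup>+t. ennreal (td x t) * ennreal ((G (x, t))\<^sup>2) \<partial>TB) \<le> ennreal (C\<^sub>\<rho> * n)"
      using AE_x
    proof eventually_elim
      case (elim x)
      then show ?case
        unfolding treatment_density_eq treatment_base_eq G_def fst_conv snd_conv
        using cube_1_D(1) by (intro spin.nn_integral_residual_sum_sq_le Q_sym Q_norm) auto
    qed
  qed
  also have "\<dots> = ennreal (C\<^sub>\<rho> * n)" by (simp add: XB.emeasure_space_1)
  finally show "measure law {w \<in> space law. a < \<bar>?F w\<bar>} \<le> C\<^sub>\<rho> * n / a\<^sup>2" if "a > 0"
    using that \<rho>_nonneg by (intro measure_abs_gt_le) auto
qed

lemma measurable_component [measurable]: "(\<lambda>z. z $ k) \<in> borel_measurable PX"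
  by measurable

lemma AE_component: "AE z in PX. \<bar>z $ k\<bar> \<le> 1"
  using PX_cube by eventually_elim (rule cube_1_D(1))

lemma AE_component_product: "AE z in PX. \<bar>z $ j * z $ k\<bar> \<le> 1"
  using PX_cube by eventually_elim (auto simp: abs_mult intro!: mult_le_one cube_1_D(1))

lemma integrable_component: "integrable PX (\<lambda>z. z $ k)"
  by (rule finite_measure.integrable_const_bound[OF prob_space.finite_measure[OF PX_prob], where B = 1])
     (use AE_component in auto)

lemma integrable_component_product: "integrable PX (\<lambda>z. z $ j * z $ k)"
  by (rule finite_measure.integrable_const_bound[OF prob_space.finite_measure[OF PX_prob], where B = 1])
     (use AE_component_product in auto)

lemma covariate_second_moment:
  shows "covariate_error j k \<in> borel_measurable base3"
    and "a > 0 \<Longrightarrow> measure law {w \<in> space law. a < \<bar>covariate_error j k w\<bar>} \<le> 4 * real n / a\<^sup>2"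
proof -
  let ?F = "covariate_error j k"
  interpret PX: prob_space PX by (rule PX_prob)
  define g where "g z = z $ j * z $ k - second_moment j k" for z :: "real^'d"
  have g [measurable]: "g \<in> borel_measurable PX" unfolding g_def by measurable
  have m: "\<bar>second_moment j k\<bar> \<le> 1"
  proof -
    have "\<bar>second_moment j k\<bar> \<le> (\<integral>z. \<bar>z $ j * z $ k\<bar> \<partial>PX)"
      unfolding second_moment_def by (rule integral_abs_bound)
    also have "\<dots> \<le> (\<integral>z. 1 \<partial>PX)"
      by (intro integral_mono_AE integrable_abs integrable_component_product AE_component_product) auto
    finally show ?thesis by (simp add: PX.prob_space)
  qed
  have mG [measurable]: "(\<lambda>x. \<Sum>i<n. g (x i)) \<in> borel_measurable XB"
    by (intro borel_measurable_sum measurable_compose[OF measurable_component_singleton[of _ "{..<n}" "\<lambda>_. PX"] g]) auto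
  have "(\<lambda>w. \<Sum>i<n. g (fst w i)) \<in> borel_measurable base3"
    by (rule measurable_compose[OF measurable_fst mG])
  then show F [measurable]: "?F \<in> borel_measurable base3" by (simp add: g_def)
  have "(\<integral>\<^sup>+w. ennreal ((?F w)\<^sup>2) \<partial>law) = (\<integral>\<^sup>+x. ennreal ((\<Sum>i<n. g (x i))\<^sup>2) \<partial>XB)"
    using nn_integral_law_x[of "\<lambda>x. ennreal ((\<Sum>i<n. g (x i))\<^sup>2)"] by (simp add: g_def)
  also have "\<dots> \<le> ennreal (2\<^sup>2 * real n)"
  proof (rule nn_integral_centered_sum_sq_le[OF PX_prob g])
    show "AE z in PX. \<bar>g z\<bar> \<le> 2"
      using AE_component_product[of j k] by eventually_elim (use m in \<open>simp add: g_def abs_le_iff; linarith\<close>)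
    show "(\<integral>z. g z \<partial>PX) = 0"
      unfolding g_def using integrable_component_product[of j k]
      by (simp add: second_moment_def PX.prob_space)
  qed simp
  finally show "measure law {w \<in> space law. a < \<bar>?F w\<bar>} \<le> 4 * real n / a\<^sup>2" if "a > 0"
    using that by (intro measure_abs_gt_le) auto
qed

text \<open>
  The matrix of second moments exceeds the covariance matrix by a matrix of rank one with
  nonnegative quadratic form.
\<close>

lemma second_moment_form_ge:
  assumes "c \<le> lambda_min (covariance_matrix PX)"
  shows "c * (norm v)\<^sup>2 \<le> (\<Sum>j\<in>UNIV. \<Sum>k\<in>UNIV. v $ j * v $ k * second_moment j k)"
proof -
  interpret PX: prob_space PX by (rule PX_prob)
  define e where "e k = (\<integral>z. z $ k \<partial>PX)" for k
  have cov: "covariance_matrix PX $ j $ k = second_moment j k - e j * e k" for j k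
  proof -
    have "covariance_matrix PX $ j $ k = (\<integral>z. z $ j * z $ k - e k * z $ j - e j * z $ k + e j * e k \<partial>PX)"
      unfolding covariance_matrix_def e_def
      by (simp, intro Bochner_Integration.integral_cong) (auto simp: algebra_simps)
    also have "\<dots> = second_moment j k - e j * e k"
      using integrable_component_product[of j k] integrable_component[of j] integrable_component[of k]
      by (simp add: second_moment_def PX.prob_space e_def[symmetric])
    finally show ?thesis .
  qed
  have "transpose (covariance_matrix PX) = covariance_matrix PX"
    by (simp add: vec_eq_iff transpose_def cov second_moment_def mult.commute)
  then have "lambda_min (covariance_matrix PX) * (v \<bullet> v) \<le> v \<bullet> (covariance_matrix PX *v v)"
    by (rule lambda_min_le_quadratic_form)
  moreover have "c * (v \<bullet> v) \<le> lambda_min (covariance_matrix PX) * (v \<bullet> v)"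
    using assms by (intro mult_right_mono) auto
  moreover have "v \<bullet> (covariance_matrix PX *v v)
      = (\<Sum>j\<in>UNIV. \<Sum>k\<in>UNIV. v $ j * v $ k * second_moment j k) - (\<Sum>j\<in>UNIV. v $ j * e j)\<^sup>2"
    by (simp add: inner_vec_def matrix_vector_mult_def cov sum_distrib_left sum_product power2_eq_square
        sum_subtractf[symmetric] algebra_simps)
  moreover have "(\<Sum>j\<in>UNIV. v $ j * e j)\<^sup>2 \<ge> 0" by simp
  ultimately show ?thesis unfolding dot_square_norm by linarith
qed

lemma measurable_unique_MPL:
  fixes \<Theta> :: "(real \<times> (real^'d)) set"
  assumes "closed \<Theta>" "\<Theta> \<noteq> {}"
  shows "{w \<in> space law. MPL_exists n \<mu> A \<Theta> w} \<in> sets law"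
    and "MPL_estimator n \<mu> A \<Theta> \<in> borel_measurable law"
proof -
  have PL: "pseudo_likelihood n \<mu> A w b = exp (log_pl n \<mu> A (fst w) (fst (snd w)) (snd (snd w)) b)" for w b
    using outcome.pseudo_likelihood_eq[OF A_sym, of "fst w" "fst (snd w)" "snd (snd w)" b] by simp
  interpret continuous_objective law "pseudo_likelihood n \<mu> A" \<Theta>
  proof
    fix b
    have "(\<lambda>w. log_pl n \<mu> A (fst w) (fst (snd w)) (snd (snd w)) b) \<in> borel_measurable base3"
      unfolding log_pl_def
    proof (rule borel_measurable_sum)
      fix i assume "i \<in> {..<n}"
      then have i: "i < n" by simp
      have y: "(\<lambda>w. snd (snd w) j) \<in> borel_measurable base3" if "j < n" for j
        by (rule measurable_compose[OF _ measurable_y[OF that]]) measurable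
      note [measurable] = y[OF i] measurable_local_field[OF y]
      have [measurable]: "(\<lambda>w. predictor (fst w) (fst (snd w)) b i) \<in> borel_measurable base3"
        by (rule measurable_predictor[OF i]) measurable
      show "(\<lambda>w. A i i * (snd (snd w) i)\<^sup>2 / 2 + (local_field n A (snd (snd w)) i
          + predictor (fst w) (fst (snd w)) b i) * snd (snd w) i
        - log_partition \<mu> (A i i) (local_field n A (snd (snd w)) i + predictor (fst w) (fst (snd w)) b i))
        \<in> borel_measurable base3"
        by measurable
    qed
    then show "(\<lambda>w. pseudo_likelihood n \<mu> A w b) \<in> borel_measurable law" unfolding PL by measurable
  next
    fix w
    show "continuous_on \<Theta> (pseudo_likelihood n \<mu> A w)"
      unfolding PL using continuous_on_subset[OF outcome.continuous_on_log_pl] by (intro continuous_intros) auto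
  qed (use assms in auto)
  have "MPL_exists n \<mu> A \<Theta> w = (\<exists>!b. maximizer w b)" for w
    by (simp add: MPL_exists_def maximizer_def)
  then show "{w \<in> space law. MPL_exists n \<mu> A \<Theta> w} \<in> sets law"
    using sets_unique_maximizer by simp
  show "MPL_estimator n \<mu> A \<Theta> \<in> borel_measurable law"
    using measurable_unique_maximizer unfolding MPL_estimator_def MPL_exists_def maximizer_def .
qed

section \<open>Events of high probability\<close>

text \<open>
  The four requirements are what the deterministic analysis consumes: a score of order \<open>\<surd>n\<close>
  (treatment and covariate components), small cross terms between treatment residuals and
  covariates, and empirical second moments of the covariates close to the true ones.
\<close>

definition good_event :: "real \<Rightarrow> real \<Rightarrow> (nat \<Rightarrow> real^'d) \<times> (nat \<Rightarrow> real) \<times> (nat \<Rightarrow> real) \<Rightarrow> bool" where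
  "good_event \<kappa> \<epsilon> w \<longleftrightarrow> \<bar>score (\<lambda>x t. t) w\<bar> \<le> \<kappa> * sqrt n \<and> (\<forall>k. \<bar>score (\<lambda>x t i. x i $ k) w\<bar> \<le> \<kappa> * sqrt n)
    \<and> (\<forall>k. \<bar>spin_score k w\<bar> \<le> \<epsilon> * n) \<and> (\<forall>j k. \<bar>covariate_error j k w\<bar> \<le> \<epsilon> * n)"

lemma prob_not_good_event_le:
  fixes \<kappa> \<epsilon> :: real
  assumes \<kappa>: "\<kappa> > 0" and \<epsilon>: "\<epsilon> > 0" and n: "n > 0"
  shows "{w \<in> space law. \<not> good_event \<kappa> \<epsilon> w} \<in> sets law"
    and "measure law {w \<in> space law. \<not> good_event \<kappa> \<epsilon> w}
      \<le> (1 + real CARD('d)) * C\<^sub>\<rho> / \<kappa>\<^sup>2 + (CARD('d) * C\<^sub>\<rho> + (real CARD('d))\<^sup>2 * 4) / (\<epsilon>\<^sup>2 * n)"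
proof -
  let ?E = "\<lambda>a F. {w \<in> space law. a < \<bar>F w\<bar>}"
  have x: "(\<lambda>w. fst w i $ k) \<in> borel_measurable base3" if "i < n" for i k
    by (rule measurable_compose[OF measurable_compose[OF measurable_fst measurable_x[OF that]]]) measurable
  have t: "(\<lambda>w. fst (snd w) i) \<in> borel_measurable base3" if "i < n" for i
    by (rule measurable_compose[OF _ measurable_t[OF that]]) measurable
  have bt: "AE x in XB. \<forall>t\<in>space TB. \<forall>i<n. \<bar>t i\<bar> \<le> 1"
    using space_TB_D by (intro AE_I2) fastforce
  have bx: "AE x in XB. \<forall>t\<in>space TB. \<forall>i<n. \<bar>x i $ k\<bar> \<le> 1" for k
    using AE_x by eventually_elim (use cube_1_D(1) in auto)
  have S1: "score (\<lambda>x t. t) \<in> borel_measurable base3"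
    "a > 0 \<Longrightarrow> measure law (?E a (score (\<lambda>x t. t))) \<le> C\<^sub>\<rho> * n / a\<^sup>2" for a
    by (rule score_second_moment[where c = "\<lambda>x t. t", OF t bt]; assumption)+
  have S2: "score (\<lambda>x t i. x i $ k) \<in> borel_measurable base3"
    "a > 0 \<Longrightarrow> measure law (?E a (score (\<lambda>x t i. x i $ k))) \<le> C\<^sub>\<rho> * n / a\<^sup>2" for a k
    by (rule score_second_moment[where c = "\<lambda>x t i. x i $ k", OF x bx]; assumption)+
  note S3 = spin_residual_second_moment and S4 = covariate_second_moment
  have meas: "?E a F \<in> sets law" if "F \<in> borel_measurable base3" for a and F :: "_ \<Rightarrow> real"
    using that by measurable
  define B1 where "B1 = ?E (\<kappa> * sqrt n) (score (\<lambda>x t. t))"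
  define B2 where "B2 = (\<Union>k. ?E (\<kappa> * sqrt n) (score (\<lambda>x t i. x i $ k)))"
  define B3 where "B3 = (\<Union>k. ?E (\<epsilon> * n) (spin_score k))"
  define B4 where "B4 = (\<Union>jk. ?E (\<epsilon> * n) (covariate_error (fst jk) (snd jk)))"
  have eq: "{w \<in> space law. \<not> good_event \<kappa> \<epsilon> w} = (B1 \<union> B2) \<union> (B3 \<union> B4)"
    unfolding good_event_def B1_def B2_def B3_def B4_def by (auto simp: not_le)
  have E: "?E a (score (\<lambda>x t i. x i $ k)) \<in> sets law" "?E a (spin_score k) \<in> sets law"
    "?E a (covariate_error j k) \<in> sets law" for a j k
    by (rule meas S2(1) S3(1) S4(1))+
  have B: "B1 \<in> sets law" "B2 \<in> sets law" "B3 \<in> sets law" "B4 \<in> sets law"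
    unfolding B1_def B2_def B3_def B4_def
    by (intro sets.finite_UN finite E meas S1(1))+
  then show "{w \<in> space law. \<not> good_event \<kappa> \<epsilon> w} \<in> sets law" unfolding eq by auto
  have \<kappa>n: "\<kappa> * sqrt n > 0" and \<epsilon>n: "\<epsilon> * n > 0" using \<kappa> \<epsilon> n by auto
  have sq: "C\<^sub>\<rho> * n / (\<kappa> * sqrt n)\<^sup>2 = C\<^sub>\<rho> / \<kappa>\<^sup>2" "c * n / (\<epsilon> * n)\<^sup>2 = c / (\<epsilon>\<^sup>2 * n)" for c :: real
    using n by (simp_all add: power_mult_distrib) (simp add: power2_eq_square)
  have m1: "measure law B1 \<le> C\<^sub>\<rho> / \<kappa>\<^sup>2" unfolding B1_def sq[symmetric] by (rule S1(2)[OF \<kappa>n])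
  have m2: "measure law B2 \<le> (\<Sum>k\<in>(UNIV::'d set). C\<^sub>\<rho> / \<kappa>\<^sup>2)"
    unfolding B2_def sq[symmetric]
    by (intro order_trans[OF measure_UNION_le] sum_mono S2(2) \<kappa>n meas S2(1) finite)
  have m3: "measure law B3 \<le> (\<Sum>k\<in>(UNIV::'d set). C\<^sub>\<rho> / (\<epsilon>\<^sup>2 * n))"
  proof -
    have "measure law (?E (\<epsilon> * n) (spin_score k)) \<le> C\<^sub>\<rho> / (\<epsilon>\<^sup>2 * n)" for k
      using S3(2)[OF \<epsilon>n, of k] by (simp only: sq(2))
    then show ?thesis
      unfolding B3_def by (intro order_trans[OF measure_UNION_le] sum_mono meas S3(1) finite)
  qed
  have m4: "measure law B4 \<le> (\<Sum>jk\<in>(UNIV::('d \<times> 'd) set). 4 / (\<epsilon>\<^sup>2 * n))"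
    unfolding B4_def sq[symmetric]
    by (intro order_trans[OF measure_UNION_le] sum_mono S4(2) \<epsilon>n meas S4(1) finite)
  have "measure law ((B1 \<union> B2) \<union> (B3 \<union> B4)) \<le> (measure law B1 + measure law B2) + (measure law B3 + measure law B4)"
    using B by (intro order_trans[OF measure_Un_le] add_mono measure_Un_le) auto
  also have "\<dots> \<le> (C\<^sub>\<rho> / \<kappa>\<^sup>2 + CARD('d) * (C\<^sub>\<rho> / \<kappa>\<^sup>2))
      + (CARD('d) * (C\<^sub>\<rho> / (\<epsilon>\<^sup>2 * n)) + (real CARD('d))\<^sup>2 * (4 / (\<epsilon>\<^sup>2 * n)))"
    using m1 m2 m3 m4 by (intro add_mono) (simp_all add: power2_eq_square)
  also have "\<dots> = (1 + real CARD('d)) * C\<^sub>\<rho> / \<kappa>\<^sup>2 + (CARD('d) * C\<^sub>\<rho> + (real CARD('d))\<^sup>2 * 4) / (\<epsilon>\<^sup>2 * n)"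
  proof -
    have "(u / a + D * (u / a)) + (D * (u / b) + E * (4 / b)) = (1 + D) * u / a + (D * u + E * 4) / b"
      for u a b D E :: real
      by (simp add: add_divide_distrib distrib_right)
    from this[of "C\<^sub>\<rho>" "\<kappa>\<^sup>2" "CARD('d)" "\<epsilon>\<^sup>2 * n" "(real CARD('d))\<^sup>2"] show ?thesis by simp
  qed
  finally show "measure law {w \<in> space law. \<not> good_event \<kappa> \<epsilon> w}
      \<le> (1 + real CARD('d)) * C\<^sub>\<rho> / \<kappa>\<^sup>2 + (CARD('d) * C\<^sub>\<rho> + (real CARD('d))\<^sup>2 * 4) / (\<epsilon>\<^sup>2 * n)"
    unfolding eq .
qed

text \<open>
  \<open>K\<close> is chosen such that at least half of the variance bound at bounded local fields survives in
  \<open>\<delta>\<close>; the factors \<open>CARD('d)\<close> come from comparing the \<open>\<ell>\<^sub>1\<close> with the Euclidean norm when passing from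
  coordinates to an arbitrary direction.
\<close>

lemma good_event_design:
  fixes c \<epsilon> \<delta> \<eta> H K :: real
  assumes good: "good_event \<kappa> \<epsilon> (x, t, y)"
    and x: "\<And>i. i < n \<Longrightarrow> x i \<in> cube 1" and t: "t \<in> space TB"
    and c: "c > 0" "c \<le> lambda_min (covariance_matrix PX)"
    and K: "K > 0" "4 * \<rho>\<^sup>2 / K\<^sup>2 \<le> 1 / 2" and H: "H = CARD('d) * norm \<gamma>"
    and \<delta>: "\<delta> = spin.var_bound \<rho> (K + H) / 2"
    and \<eta>: "\<eta> = min (\<delta> / 2) (\<delta> / (2 * (1 + \<delta>)) * (c / 4))"
    and \<epsilon>: "\<epsilon> \<ge> 0" "\<epsilon> * CARD('d) \<le> \<eta> / 2" "\<epsilon> * (real CARD('d))\<^sup>2 \<le> c / 2"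
  shows "\<eta> / 2 * n * (norm u)\<^sup>2 \<le> (\<Sum>i<n. (predictor x t u i)\<^sup>2)"
proof (rule design_nondegenerate[OF _ _ _ _ c(1) _ _ \<eta> \<epsilon>(2)])
  let ?b = "cond_mean (count_space {-1, 1}) n Q (\<lambda>i. x i \<bullet> \<gamma>) t"
  show "(t i)\<^sup>2 = 1" if "i < n" for i using space_TB_D[OF t that] by auto
  show "\<delta> > 0" unfolding \<delta> using spin.var_bound_pos by simp
  show "0 \<le> \<epsilon> * CARD('d)" using \<epsilon>(1) by simp
  show "c / 2 * n * (norm v)\<^sup>2 \<le> (\<Sum>i<n. (x i \<bullet> v)\<^sup>2)" for v
  proof -
    have "(\<Sum>i<n. (x i \<bullet> v)\<^sup>2) = (\<Sum>i<n. \<Sum>j\<in>UNIV. \<Sum>k\<in>UNIV. v $ j * (v $ k * (x i $ j * x i $ k)))"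
      by (simp add: power2_eq_square inner_vec_def sum_product mult_ac)
    also have "\<dots> = (\<Sum>j\<in>UNIV. \<Sum>k\<in>UNIV. \<Sum>i<n. v $ j * (v $ k * (x i $ j * x i $ k)))"
      by (subst sum.swap) (intro sum.cong refl sum.swap)
    also have "\<dots> = (\<Sum>j\<in>UNIV. v $ j * (\<Sum>k\<in>UNIV. v $ k * covariate_error j k (x, t, y)))
        + n * (\<Sum>j\<in>UNIV. \<Sum>k\<in>UNIV. v $ j * v $ k * second_moment j k)"
      by (simp add: sum_distrib_left sum_subtractf sum.distrib[symmetric] algebra_simps)
    finally have eq: "(\<Sum>i<n. (x i \<bullet> v)\<^sup>2) = (\<Sum>j\<in>UNIV. v $ j * (\<Sum>k\<in>UNIV. v $ k * covariate_error j k (x, t, y)))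
        + n * (\<Sum>j\<in>UNIV. \<Sum>k\<in>UNIV. v $ j * v $ k * second_moment j k)" .
    have "\<bar>\<Sum>k\<in>UNIV. v $ k * covariate_error j k (x, t, y)\<bar> \<le> \<epsilon> * n * (CARD('d) * norm v)" for j
      using good by (intro abs_sum_components_le) (simp add: good_event_def)
    then have "\<bar>\<Sum>j\<in>UNIV. v $ j * (\<Sum>k\<in>UNIV. v $ k * covariate_error j k (x, t, y))\<bar>
        \<le> \<epsilon> * n * (CARD('d) * norm v) * (CARD('d) * norm v)"
      by (rule abs_sum_components_le)
    also have "\<dots> = \<epsilon> * (real CARD('d))\<^sup>2 * (n * (norm v)\<^sup>2)" by (simp add: power2_eq_square)
    also have "\<dots> \<le> c / 2 * (n * (norm v)\<^sup>2)" using \<epsilon>(3) by (intro mult_right_mono) auto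
    finally have 1: "\<bar>\<Sum>j\<in>UNIV. v $ j * (\<Sum>k\<in>UNIV. v $ k * covariate_error j k (x, t, y))\<bar> \<le> c / 2 * (n * (norm v)\<^sup>2)" .
    have "n * (c * (norm v)\<^sup>2) \<le> n * (\<Sum>j\<in>UNIV. \<Sum>k\<in>UNIV. v $ j * v $ k * second_moment j k)"
      by (intro mult_left_mono second_moment_form_ge c) auto
    with 1 show ?thesis unfolding eq by (simp add: algebra_simps)
  qed
  show "\<bar>\<Sum>i<n. (t i - ?b i) * (x i \<bullet> v)\<bar> \<le> \<epsilon> * CARD('d) * n * norm v" for v
  proof -
    have "(\<Sum>i<n. (t i - ?b i) * (x i \<bullet> v)) = (\<Sum>k\<in>UNIV. v $ k * spin_score k (x, t, y))"
      unfolding fst_conv snd_conv residual_sum_inner[symmetric] by (simp add: residual_sum_def mult.commute)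
    also have "\<bar>\<dots>\<bar> \<le> \<epsilon> * n * (CARD('d) * norm v)"
      using good by (intro abs_sum_components_le) (simp add: good_event_def)
    finally show ?thesis by (simp add: mult_ac)
  qed
  show "\<delta> * n \<le> (\<Sum>i<n. 1 - (?b i)\<^sup>2)"
  proof -
    have h: "\<bar>x i \<bullet> \<gamma>\<bar> \<le> H" if "i < n" for i
      unfolding H using Cauchy_Schwarz_ineq2[of "x i" \<gamma>] cube_1_D(2)[OF x[OF that]]
        mult_right_mono[of "norm (x i)" "CARD('d)" "norm \<gamma>"] by simp
    have "spin.var_bound \<rho> (K + H) * (1 / 2) * n \<le> spin.var_bound \<rho> (K + H) * (1 - 4 * \<rho>\<^sup>2 / K\<^sup>2) * n"
      using K spin.var_bound_pos[of \<rho> "K + H"] by (intro mult_right_mono mult_left_mono) auto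
    also have "\<dots> \<le> (\<Sum>i<n. tilted_var (count_space {-1, 1}) (Q i i) (local_field n Q t i + x i \<bullet> \<gamma>))"
      using space_TB_D[OF t] by (intro spin.sum_tilted_var_ge Q_norm h K(1)) fastforce
    also have "\<dots> = (\<Sum>i<n. 1 - (?b i)\<^sup>2)" by (simp add: spin_tilted_var cond_mean_def)
    finally show ?thesis by (simp add: \<delta>)
  qed
qed

lemma good_event_score:
  assumes good: "good_event \<kappa> \<epsilon> (x, t, y)" and "\<kappa> > 0"
  shows "\<bar>residual_sum \<mu> n A (predictor x t \<beta>) (predictor x t u) y\<bar> \<le> \<kappa> * (1 + real CARD('d)) * sqrt n * norm u"
proof -
  obtain a v where u: "u = (a, v)" by fastforce
  have "residual_sum \<mu> n A (predictor x t \<beta>) (predictor x t u) y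
    = a * score (\<lambda>x t. t) (x, t, y) + residual_sum \<mu> n A (predictor x t \<beta>) (\<lambda>i. x i \<bullet> v) y"
    by (simp add: u residual_sum_def predictor_def[of x t "(a, v)"] sum_distrib_left sum.distrib[symmetric] algebra_simps)
  also have "\<bar>\<dots>\<bar> \<le> \<bar>a\<bar> * (\<kappa> * sqrt n) + \<kappa> * sqrt n * (CARD('d) * norm v)"
  proof (rule order_trans[OF abs_triangle_ineq add_mono])
    show "\<bar>a * score (\<lambda>x t. t) (x, t, y)\<bar> \<le> \<bar>a\<bar> * (\<kappa> * sqrt n)"
      unfolding abs_mult using good by (intro mult_left_mono) (simp_all add: good_event_def)
    show "\<bar>residual_sum \<mu> n A (predictor x t \<beta>) (\<lambda>i. x i \<bullet> v) y\<bar> \<le> \<kappa> * sqrt n * (CARD('d) * norm v)"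
      unfolding residual_sum_inner using good by (intro abs_sum_components_le) (simp add: good_event_def)
  qed
  also have "\<dots> \<le> norm u * (\<kappa> * sqrt n) + \<kappa> * sqrt n * (CARD('d) * norm u)"
    using \<open>\<kappa> > 0\<close> norm_fst_le[of a v] norm_snd_le[of v a]
    by (intro add_mono mult_right_mono mult_left_mono) (auto simp: u)
  finally show ?thesis by (simp add: algebra_simps)
qed

end

context sample_model
begin

lemmas prob_law = law.prob_space_axioms

lemma deviation_probability_le:
  fixes \<kappa> \<epsilon> c K\<^sub>T H \<delta>\<^sub>T \<eta> K \<delta> r :: real and \<Theta> :: "(real \<times> (real^'d)) set"
  assumes c: "c > 0" "c \<le> lambda_min (covariance_matrix PX)"
    and KT: "K\<^sub>T > 0" "4 * \<rho>\<^sup>2 / K\<^sub>T\<^sup>2 \<le> 1 / 2" and H: "H = CARD('d) * norm \<gamma>"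
    and \<delta>T: "\<delta>\<^sub>T = spin.var_bound \<rho> (K\<^sub>T + H) / 2"
    and \<eta>: "\<eta> = min (\<delta>\<^sub>T / 2) (\<delta>\<^sub>T / (2 * (1 + \<delta>\<^sub>T)) * (c / 4))" "\<eta> > 0"
    and \<epsilon>: "\<epsilon> > 0" "\<epsilon> * CARD('d) \<le> \<eta> / 2" "\<epsilon> * (real CARD('d))\<^sup>2 \<le> c / 2"
    and K: "K > 0" "4 * (1 + real CARD('d))\<^sup>2 * \<rho>\<^sup>2 / K\<^sup>2 \<le> \<eta> / 2 / 2"
    and \<delta>: "\<delta> = outcome.var_bound \<rho> (K + (1 + real CARD('d)) * (norm \<beta> + 1)) * (\<eta> / 2) / 4"
    and \<kappa>: "\<kappa> > 0" and n: "n > 0"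
    and r: "r = 2 * (\<kappa> * (1 + real CARD('d))) / (\<delta> * sqrt n)" "r \<le> 1" "cball \<beta> r \<subseteq> \<Theta>"
    and \<Theta>: "convex \<Theta>"
  shows "measure law {w \<in> space law. \<not> (MPL_exists n \<mu> A \<Theta> w \<and> norm (MPL_estimator n \<mu> A \<Theta> w - \<beta>) \<le> r)}
    \<le> (1 + real CARD('d)) * C\<^sub>\<rho> / \<kappa>\<^sup>2 + (CARD('d) * C\<^sub>\<rho> + (real CARD('d))\<^sup>2 * 4) / (\<epsilon>\<^sup>2 * n)"
proof -
  have close: "MPL_exists n \<mu> A \<Theta> w \<and> norm (MPL_estimator n \<mu> A \<Theta> w - \<beta>) \<le> r"
    if w: "w \<in> space law" and x: "\<forall>i\<in>{..<n}. fst w i \<in> cube 1" and y: "\<forall>i\<in>{..<n}. \<bar>snd (snd w) i\<bar> \<le> 1"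
      and good: "good_event \<kappa> \<epsilon> w" for w
  proof -
    obtain x t y where wxty: "w = (x, t, y)" by (cases w)
    have t: "t \<in> space TB" using w by (simp add: wxty space_law)
    have x': "x i \<in> cube 1" if "i < n" for i using x that by (simp add: wxty)
    have good': "good_event \<kappa> \<epsilon> (x, t, y)" using good by (simp add: wxty)
    have a: "\<bar>y i\<bar> \<le> 1" "\<bar>t i\<bar> \<le> 1" "norm (x i) \<le> CARD('d)" if "i < n" for i
      using y space_TB_D[OF t that] cube_1_D(2)[OF x'[OF that]] that by (auto simp: wxty)
    have design: "\<eta> / 2 * n * (norm u)\<^sup>2 \<le> (\<Sum>i<n. (predictor x t u i)\<^sup>2)" for u
      by (rule good_event_design[OF good' x' t c KT H \<delta>T \<eta>(1) less_imp_le[OF \<epsilon>(1)] \<epsilon>(2,3)])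
    have score: "\<bar>residual_sum \<mu> n A (predictor x t \<beta>) (predictor x t u) y\<bar> \<le> \<kappa> * (1 + real CARD('d)) * sqrt n * norm u" for u
      using good_event_score[OF good' \<kappa>, of u] by simp
    have pos: "\<eta> / 2 > 0" "\<kappa> * (1 + real CARD('d)) > 0" using \<eta>(2) \<kappa> by simp_all
    show ?thesis
      unfolding wxty
      by (rule conjI outcome.MPL_close[OF A_sym A_norm a(1) a(2) a(3) _ K design pos(1) score pos(2) \<delta> n r \<Theta>]; simp?)+
  qed
  have "measure law {w \<in> space law. \<not> (MPL_exists n \<mu> A \<Theta> w \<and> norm (MPL_estimator n \<mu> A \<Theta> w - \<beta>) \<le> r)}
    \<le> measure law {w \<in> space law. \<not> good_event \<kappa> \<epsilon> w}"
  proof (rule law.finite_measure_mono_AE)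
    show "AE w in law. w \<in> {w \<in> space law. \<not> (MPL_exists n \<mu> A \<Theta> w \<and> norm (MPL_estimator n \<mu> A \<Theta> w - \<beta>) \<le> r)}
        \<longrightarrow> w \<in> {w \<in> space law. \<not> good_event \<kappa> \<epsilon> w}"
      using AE_law_x AE_law_y AE_space by eventually_elim (use close in blast)
  qed (rule prob_not_good_event_le(1)[OF \<kappa> \<epsilon>(1) n])
  also have "\<dots> \<le> (1 + real CARD('d)) * C\<^sub>\<rho> / \<kappa>\<^sup>2 + (CARD('d) * C\<^sub>\<rho> + (real CARD('d))\<^sup>2 * 4) / (\<epsilon>\<^sup>2 * n)"
    by (rule prob_not_good_event_le(2)[OF \<kappa> \<epsilon>(1) n])
  finally show ?thesis .
qed

end

section \<open>Tightness of the rescaled estimator\<close>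

text \<open>
  The variance of \<open>\<mu>\<close> serves as \<open>v\<^sub>0\<close>. If it vanished, \<open>\<mu>\<close> would be carried by its mean \<open>m\<close>, and the
  open set \<open>- {m}\<close> would be a null set containing a support point.
\<close>

lemma nondegenerate_base:
  fixes \<mu> :: "real measure"
  assumes "prob_space \<mu>" and sets: "sets \<mu> = sets borel" and one: "measure \<mu> {-1..1} = 1"
    and supp: "\<exists>a b. a \<noteq> b \<and> a \<in> measure_support \<mu> \<and> b \<in> measure_support \<mu>"
  obtains v\<^sub>0 where "bounded_base \<mu> v\<^sub>0"
proof -
  interpret prob_space \<mu> by fact
  note [measurable_cong] = sets
  have AE: "AE u in \<mu>. \<bar>u\<bar> \<le> 1"
    using AE_prob_1[OF one] by eventually_elim auto
  have int: "integrable \<mu> (\<lambda>u. u)" "integrable \<mu> (\<lambda>u. u\<^sup>2)"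
    by (rule integrable_const_bound[where B = 1]; use AE in \<open>auto simp: abs_square_le_1\<close>)+
  define m where "m = (\<integral>u. u \<partial>\<mu>)"
  define v\<^sub>0 where "v\<^sub>0 = (\<integral>u. (u - m)\<^sup>2 \<partial>\<mu>)"
  have expand: "(\<integral>u. (u - c)\<^sup>2 \<partial>\<mu>) = (\<integral>u. u\<^sup>2 \<partial>\<mu>) - 2 * c * m + c\<^sup>2" for c
  proof -
    have "(\<integral>u. (u - c)\<^sup>2 \<partial>\<mu>) = (\<integral>u. u\<^sup>2 - 2 * c * u + c\<^sup>2 \<partial>\<mu>)"
      by (intro Bochner_Integration.integral_cong) (auto simp: power2_eq_square algebra_simps)
    then show ?thesis using int by (simp add: m_def prob_space)
  qed
  have "v\<^sub>0 > 0"
  proof (rule ccontr)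
    assume "\<not> v\<^sub>0 > 0"
    moreover have "v\<^sub>0 \<ge> 0" unfolding v\<^sub>0_def by simp
    ultimately have "v\<^sub>0 = 0" by simp
    moreover have "integrable \<mu> (\<lambda>u. (u - m)\<^sup>2)"
      using int by (simp add: power2_diff)
    ultimately have "AE u in \<mu>. (u - m)\<^sup>2 = 0"
      unfolding v\<^sub>0_def using integral_nonneg_eq_0_iff_AE[of \<mu> "\<lambda>u. (u - m)\<^sup>2"] by simp
    then have "AE u in \<mu>. u \<notin> - {m}" by eventually_elim auto
    then have "measure \<mu> (- {m}) = 0"
      by (subst (asm) AE_iff_measurable[where N = "- {m}"]) (auto simp: sets sets_eq_imp_space_eq[OF sets] measure_def)
    moreover obtain a where "a \<in> measure_support \<mu>" "a \<in> - {m}" using supp by blast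
    then have "measure \<mu> (- {m}) > 0" unfolding measure_support_def by auto
    ultimately show False by simp
  qed
  moreover have "v\<^sub>0 \<le> (\<integral>u. (u - c)\<^sup>2 \<partial>\<mu>)" for c
    unfolding v\<^sub>0_def expand using zero_le_power2[of "m - c"] by (simp add: power2_eq_square algebra_simps)
  ultimately have "bounded_base \<mu> v\<^sub>0"
    using AE by (intro bounded_base.intro bounded_base_axioms.intro finite_measure_axioms) auto
  then show ?thesis by (rule that)
qed

lemma single_law_tight:
  fixes Z :: "'a \<Rightarrow> 'b::real_normed_vector"
  assumes "prob_space M" and "Z \<in> borel_measurable M" and e: "e > 0"
  obtains R where "measure M {w \<in> space M. R < norm (Z w)} \<le> e"
proof -
  interpret prob_space M by fact
  note [measurable] = assms(2)
  let ?B = "\<lambda>k::nat. {w \<in> space M. real k < norm (Z w)}"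
  have "(\<lambda>k. measure M (?B k)) \<longlonglongrightarrow> measure M (\<Inter>k. ?B k)"
    by (intro finite_Lim_measure_decseq) (auto simp: decseq_def)
  moreover have "(\<Inter>k. ?B k) = {}"
  proof -
    have "\<exists>k. w \<notin> ?B k" for w
      using real_arch_simple[of "norm (Z w)"] by (auto simp: not_less)
    then show ?thesis by blast
  qed
  ultimately have "(\<lambda>k. measure M (?B k)) \<longlonglongrightarrow> 0" by simp
  then have "\<forall>\<^sub>F k in sequentially. measure M (?B k) < e" using e by (rule order_tendstoD(2))
  then obtain k where "measure M (?B k) < e" by (auto simp: eventually_sequentially)
  then show ?thesis by (intro that[of k]) simp
qed

text \<open>
  Tightness asks for one compact set for all \<open>n\<close>. The finitely many exceptional indices are harmless
  because a single law on a Euclidean space is tight.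
\<close>

lemma bounded_in_probabilityI:
  fixes Z :: "nat \<Rightarrow> 'w \<Rightarrow> 'a::euclidean_space"
  assumes P: "\<And>n. prob_space (P n)" and Z [measurable]: "\<And>n. Z n \<in> borel_measurable (P n)"
    and ev: "\<And>e. e > 0 \<Longrightarrow> \<exists>R. \<forall>\<^sub>F n in sequentially. measure (P n) {w \<in> space (P n). R < norm (Z n w)} \<le> e"
  shows "bounded_in_probability P Z"
  unfolding bounded_in_probability_def
proof (intro conjI allI impI)
  fix e :: real assume e: "e > 0"
  obtain R N where R: "\<And>n. n \<ge> N \<Longrightarrow> measure (P n) {w \<in> space (P n). R < norm (Z n w)} \<le> e"
    using ev[OF e] by (auto simp: eventually_sequentially)
  have "\<exists>r. measure (P n) {w \<in> space (P n). r < norm (Z n w)} \<le> e" for n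
    using single_law_tight[OF P Z e] by metis
  then obtain r where r: "\<And>n. measure (P n) {w \<in> space (P n). r n < norm (Z n w)} \<le> e" by metis
  define b where "b = Max (insert R (r ` {..<N}))"
  have b: "R \<le> b" "\<And>n. n < N \<Longrightarrow> r n \<le> b" by (auto simp: b_def)
  have "measure (P n) {w \<in> space (P n). Z n w \<notin> cball 0 b} \<le> e" for n
  proof -
    interpret prob_space "P n" by (rule P)
    obtain s where s: "s \<le> b" "measure (P n) {w \<in> space (P n). s < norm (Z n w)} \<le> e"
      using R[of n] r[of n] b by (cases "n < N") auto
    have "measure (P n) {w \<in> space (P n). Z n w \<notin> cball 0 b} \<le> measure (P n) {w \<in> space (P n). s < norm (Z n w)}"
      using s(1) by (intro finite_measure_mono) auto
    with s(2) show ?thesis by simp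
  qed
  then show "\<exists>K. compact K \<and> (\<forall>n. measure (P n) {w \<in> space (P n). Z n w \<notin> K} \<le> e)"
    using compact_cball by blast
qed (rule Z)

theorem theorem2p3:
  fixes PX :: "(real^'d) measure" and \<mu> :: "real measure"
    and A Q :: "nat \<Rightarrow> nat \<Rightarrow> nat \<Rightarrow> real"
    and \<gamma>\<^sub>0 \<theta>\<^sub>0 :: "real^'d" and \<tau>\<^sub>0 c C B M :: real
    and \<Theta> :: "(real \<times> (real^'d)) set"
  assumes "prob_space PX" and "sets PX = sets borel" and "measure PX (cube 1) = 1"
    and "c > 0" and "lambda_min (covariance_matrix PX) \<ge> c"
    and "lambda_max (covariance_matrix PX) \<le> C"
    and "prob_space \<mu>" and "sets \<mu> = sets borel" and "measure \<mu> {-1..1} = 1"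
    and "\<exists>a b. a \<noteq> b \<and> a \<in> measure_support \<mu> \<and> b \<in> measure_support \<mu>"
    and "\<And>n. symmetric_matrix n (A n)" and "bdd_above (range (\<lambda>n. op_norm n (A n)))"
    and "\<And>n. symmetric_matrix n (Q n)" and "bdd_above (range (\<lambda>n. op_norm n (Q n)))"
    and "B > 0" and "M > 0"
    and "\<gamma>\<^sub>0 \<in> cube M"
    and "(\<tau>\<^sub>0, \<theta>\<^sub>0) \<in> interior ({-B..B} \<times> cube M)"
    and "\<Theta> = UNIV \<or> \<Theta> = {-B..B} \<times> cube M"
  defines "law \<equiv> (\<lambda>n. model_law n PX (Q n) \<gamma>\<^sub>0 \<mu> (A n) (\<tau>\<^sub>0, \<theta>\<^sub>0))"
  shows "(\<lambda>n. measure (law n) {\<omega> \<in> space (law n). MPL_exists n \<mu> (A n) \<Theta> \<omega>}) \<longlonglongrightarrow> 1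
       \<and> bounded_in_probability law
           (\<lambda>n \<omega>. sqrt (real n) *\<^sub>R (MPL_estimator n \<mu> (A n) \<Theta> \<omega> - (\<tau>\<^sub>0, \<theta>\<^sub>0)))"
proof -
  let ?ex = "\<lambda>n. MPL_exists n \<mu> (A n) \<Theta>" and ?est = "\<lambda>n. MPL_estimator n \<mu> (A n) \<Theta>"
  define \<beta> where "\<beta> = (\<tau>\<^sub>0, \<theta>\<^sub>0)"
  obtain v\<^sub>0 where base: "bounded_base \<mu> v\<^sub>0"
    using nondegenerate_base assms(7-10) by blast
  obtain \<rho>\<^sub>A \<rho>\<^sub>Q where "\<And>n. op_norm n (A n) \<le> \<rho>\<^sub>A" "\<And>n. op_norm n (Q n) \<le> \<rho>\<^sub>Q"
    using assms(12,14) by (auto simp: bdd_above_def)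
  then have norms: "op_norm n (A n) \<le> max \<rho>\<^sub>A \<rho>\<^sub>Q" "op_norm n (Q n) \<le> max \<rho>\<^sub>A \<rho>\<^sub>Q" for n
    by (auto intro: max.coboundedI1 max.coboundedI2)
  define \<rho> where "\<rho> = max \<rho>\<^sub>A \<rho>\<^sub>Q"
  have cube: "AE z in PX. z \<in> cube 1"
    using prob_space.AE_prob_1[OF assms(1,3)] .
  have model: "sample_model \<mu> v\<^sub>0 n PX (Q n) (A n) \<rho>" for n
    using base norms[of n] assms cube
    by (intro sample_model.intro sample_model_axioms.intro) (auto simp: \<rho>_def)
  interpret outcome: bounded_base \<mu> v\<^sub>0 by (rule base)
  have law: "law n = model_law n PX (Q n) \<gamma>\<^sub>0 \<mu> (A n) \<beta>" for n by (simp add: law_def \<beta>_def)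
  have prob: "prob_space (law n)" for n
    unfolding law by (rule sample_model.prob_law[OF model])
  have \<Theta>: "closed \<Theta>" "convex \<Theta>" "\<Theta> \<noteq> {}" and "\<beta> \<in> interior \<Theta>"
    using assms(18,19) interior_subset by (auto simp: cube_def \<beta>_def intro!: closed_Times convex_Times)
  then obtain r\<^sub>0 where r0: "r\<^sub>0 > 0" "cball \<beta> r\<^sub>0 \<subseteq> \<Theta>"
    by (auto simp: mem_interior_cball)
  have meas: "{w \<in> space (law n). ?ex n w} \<in> sets (law n)"
    "?est n \<in> borel_measurable (law n)" for n
    unfolding law by (rule sample_model.measurable_unique_MPL[OF model \<Theta>(1,3)])+
  have \<rho>0: "\<rho> \<ge> 0" using op_norm_nonneg[of 0 "A 0"] norms(1)[of 0] unfolding \<rho>_def by linarith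

  define d where "d = real CARD('d)"
  have d: "d > 0" by (simp add: d_def)
  define C\<^sub>\<rho> where "C\<^sub>\<rho> = 2 + 4 * \<rho> + 12 * \<rho>\<^sup>2"
  have C\<rho>: "C\<^sub>\<rho> > 0" unfolding C\<^sub>\<rho>_def using \<rho>0 by (intro add_pos_nonneg) auto
  \<comment> \<open>Truncation levels for the local fields of treatments and outcomes: a number of the form
    \<open>1 + a\<close> has square at least \<open>a\<close>, so no square roots are needed.\<close>
  define K\<^sub>T where "K\<^sub>T = 1 + 8 * \<rho>\<^sup>2"
  have sq_ge: "a \<le> (1 + a)\<^sup>2" if "a \<ge> 0" for a :: real using that by (simp add: power2_eq_square algebra_simps)
  have KT: "K\<^sub>T > 0" "4 * \<rho>\<^sup>2 / K\<^sub>T\<^sup>2 \<le> 1 / 2"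
  proof -
    show K0: "K\<^sub>T > 0" unfolding K\<^sub>T_def by (intro add_pos_nonneg) auto
    have "8 * \<rho>\<^sup>2 \<le> K\<^sub>T\<^sup>2" unfolding K\<^sub>T_def by (rule sq_ge) simp
    then show "4 * \<rho>\<^sup>2 / K\<^sub>T\<^sup>2 \<le> 1 / 2" using K0 by (simp add: pos_divide_le_eq)
  qed
  define \<delta>\<^sub>T where "\<delta>\<^sub>T = spin.var_bound \<rho> (K\<^sub>T + d * norm \<gamma>\<^sub>0) / 2"
  define \<eta> where "\<eta> = min (\<delta>\<^sub>T / 2) (\<delta>\<^sub>T / (2 * (1 + \<delta>\<^sub>T)) * (c / 4))"
  have "\<delta>\<^sub>T > 0" unfolding \<delta>\<^sub>T_def using spin.var_bound_pos by simp
  then have \<eta>: "\<eta> > 0" unfolding \<eta>_def using \<open>c > 0\<close> by simp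
  define \<epsilon> where "\<epsilon> = min (\<eta> / (2 * d)) (c / (2 * d\<^sup>2))"
  have \<epsilon>: "\<epsilon> > 0" "\<epsilon> * d \<le> \<eta> / 2" "\<epsilon> * d\<^sup>2 \<le> c / 2"
  proof -
    show "\<epsilon> > 0" unfolding \<epsilon>_def using \<eta> d \<open>c > 0\<close> by simp
    have "\<epsilon> * d \<le> \<eta> / (2 * d) * d" "\<epsilon> * d\<^sup>2 \<le> c / (2 * d\<^sup>2) * d\<^sup>2"
      unfolding \<epsilon>_def using d by (intro mult_right_mono; simp)+
    then show "\<epsilon> * d \<le> \<eta> / 2" "\<epsilon> * d\<^sup>2 \<le> c / 2" using d by simp_all
  qed
  define K where "K = 1 + 16 * (1 + d)\<^sup>2 * \<rho>\<^sup>2 / \<eta>"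
  have K: "K > 0" "4 * (1 + d)\<^sup>2 * \<rho>\<^sup>2 / K\<^sup>2 \<le> \<eta> / 2 / 2"
  proof -
    have nn: "16 * (1 + d)\<^sup>2 * \<rho>\<^sup>2 / \<eta> \<ge> 0" using \<eta> by simp
    then show K0: "K > 0" unfolding K_def by linarith
    have "16 * (1 + d)\<^sup>2 * \<rho>\<^sup>2 / \<eta> \<le> K\<^sup>2" unfolding K_def by (rule sq_ge[OF nn])
    then show "4 * (1 + d)\<^sup>2 * \<rho>\<^sup>2 / K\<^sup>2 \<le> \<eta> / 2 / 2"
      using \<eta> K0 by (simp add: pos_divide_le_eq mult_ac)
  qed
  define \<delta> where "\<delta> = outcome.var_bound \<rho> (K + (1 + d) * (norm \<beta> + 1)) * (\<eta> / 2) / 4"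
  have \<delta>: "\<delta> > 0" unfolding \<delta>_def using outcome.var_bound_pos \<eta> by simp

  let ?bad = "\<lambda>n r. {w \<in> space (law n). \<not> (?ex n w \<and> norm (?est n w - \<beta>) \<le> r)}"
  have bad_meas: "?bad n r \<in> sets (law n)" for n r
  proof -
    note [measurable] = meas[of n]
    have "{w \<in> space (law n). norm (?est n w - \<beta>) \<le> r} \<in> sets (law n)" by measurable
    then show ?thesis by (intro sets.sets_Collect_neg sets.sets_Collect_conj meas(1))
  qed
  have deviation: "\<exists>R. \<forall>\<^sub>F n in sequentially. measure (law n) (?bad n (R / sqrt n)) \<le> e" if e: "e > 0" for e
  proof -
    define a where "a = (1 + d) * C\<^sub>\<rho>"
    define b where "b = (d * C\<^sub>\<rho> + d\<^sup>2 * 4) / \<epsilon>\<^sup>2"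
    have a: "a > 0" unfolding a_def using d C\<rho> by simp
    \<comment> \<open>The term \<open>a / \<kappa>\<^sup>2\<close> bounds the failure probability of the score bound, the only one that does
      not vanish as \<open>n\<close> grows.\<close>
    define \<kappa> where "\<kappa> = 1 + 2 * a / e"
    have "2 * a / e \<ge> 0" using a e by simp
    then have \<kappa>: "\<kappa> > 0" "2 * a / e \<le> \<kappa>\<^sup>2" using sq_ge[of "2 * a / e"] unfolding \<kappa>_def by auto
    have a\<kappa>: "a / \<kappa>\<^sup>2 \<le> e / 2"
      using \<kappa> e by (simp add: pos_divide_le_eq mult_ac)
    define R where "R = 2 * (\<kappa> * (1 + d)) / \<delta>"
    have "(\<lambda>n. R * sqrt (1 / n)) \<longlonglongrightarrow> R * sqrt 0" "(\<lambda>n. b * (1 / n)) \<longlonglongrightarrow> b * 0"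
      by (intro tendsto_intros lim_1_over_n)+
    then have lim: "(\<lambda>n. R * sqrt (1 / n)) \<longlonglongrightarrow> 0" "(\<lambda>n. b * (1 / n)) \<longlonglongrightarrow> 0" by simp_all
    have pos: "min 1 r\<^sub>0 > 0" "e / 2 > 0" using r0 e by auto
    have "\<forall>\<^sub>F n in sequentially. R * sqrt (1 / n) < min 1 r\<^sub>0" "\<forall>\<^sub>F n in sequentially. b * (1 / n) < e / 2"
      by (rule order_tendstoD(2)[OF lim(1) pos(1)], rule order_tendstoD(2)[OF lim(2) pos(2)])
    then have "\<forall>\<^sub>F n in sequentially. measure (law n) (?bad n (R / sqrt n)) \<le> e"
      using eventually_gt_at_top[of 0]
    proof eventually_elim
      case (elim n)
      have R: "R / sqrt n = R * sqrt (1 / n)" by (simp add: real_sqrt_divide)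
      have sub: "cball \<beta> (R / sqrt n) \<subseteq> \<Theta>"
        using elim(1) r0(2) subset_cball[of "R / sqrt n" r\<^sub>0 \<beta>] unfolding R by simp
      have r: "R / sqrt n = 2 * (\<kappa> * (1 + real CARD('d))) / (\<delta> * sqrt n)"
        by (simp add: R_def d_def)
      have r1: "R / sqrt n \<le> 1" using elim(1) unfolding R by simp
      have "measure (law n) (?bad n (R / sqrt n))
        \<le> (1 + real CARD('d)) * (2 + 4 * \<rho> + 12 * \<rho>\<^sup>2) / \<kappa>\<^sup>2
          + (CARD('d) * (2 + 4 * \<rho> + 12 * \<rho>\<^sup>2) + (real CARD('d))\<^sup>2 * 4) / (\<epsilon>\<^sup>2 * n)"
        unfolding law
        by (rule sample_model.deviation_probability_le[OF model \<open>c > 0\<close> assms(5) KT refl \<delta>\<^sub>T_def[unfolded d_def]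
              \<eta>_def \<eta> \<epsilon>[unfolded d_def] K[unfolded d_def] \<delta>_def[unfolded d_def] \<kappa>(1) elim(3) r r1 sub \<Theta>(2)])
      also have "\<dots> = a / \<kappa>\<^sup>2 + b * (1 / n)" by (simp add: a_def b_def d_def C\<^sub>\<rho>_def)
      also have "\<dots> \<le> e" using a\<kappa> elim(2) by linarith
      finally show ?case .
    qed
    then show ?thesis by blast
  qed

  have "(\<lambda>n. measure (law n) {w \<in> space (law n). ?ex n w}) \<longlonglongrightarrow> 1"
  proof (rule tendstoI)
    fix e :: real assume e: "e > 0"
    then obtain R where "\<forall>\<^sub>F n in sequentially. measure (law n) (?bad n (R / sqrt n)) \<le> e / 2"
      using deviation[of "e / 2"] by auto
    then show "\<forall>\<^sub>F n in sequentially. dist (measure (law n) {w \<in> space (law n). ?ex n w}) 1 < e"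
    proof eventually_elim
      case (elim n)
      interpret prob_space "law n" by (rule prob)
      let ?E = "{w \<in> space (law n). ?ex n w}"
      have "1 - measure (law n) ?E = measure (law n) (space (law n) - ?E)" using prob_compl[OF meas(1)] by simp
      also have "\<dots> \<le> measure (law n) (?bad n (R / sqrt n))"
        by (intro finite_measure_mono bad_meas) auto
      also have "\<dots> < e" using elim e by simp
      finally show ?case using prob_le_1[of ?E] by (simp add: dist_real_def)
    qed
  qed
  moreover let ?far = "\<lambda>n R. {w \<in> space (law n). R < norm (sqrt (real n) *\<^sub>R (?est n w - \<beta>))}"
  have "bounded_in_probability law (\<lambda>n w. sqrt (real n) *\<^sub>R (?est n w - \<beta>))"
  proof (rule bounded_in_probabilityI[OF prob])
    show "(\<lambda>w. sqrt (real n) *\<^sub>R (?est n w - \<beta>)) \<in> borel_measurable (law n)" for n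
      using meas(2)[of n] by measurable
  next
    fix e :: real assume "e > 0"
    from deviation[OF this] obtain R where "\<forall>\<^sub>F n in sequentially. measure (law n) (?bad n (R / sqrt n)) \<le> e" by blast
    then have "\<forall>\<^sub>F n in sequentially.
        measure (law n) (?far n R) \<le> e"
      using eventually_gt_at_top[of 0]
    proof eventually_elim
      case (elim n)
      interpret prob_space "law n" by (rule prob)
      have "measure (law n) (?far n R)
        \<le> measure (law n) (?bad n (R / sqrt n))"
      proof (rule finite_measure_mono[OF _ bad_meas])
        have "norm z \<le> R / sqrt n \<longleftrightarrow> norm (sqrt (real n) *\<^sub>R z) \<le> R" for z :: "real \<times> (real^'d)"
          using elim(2) unfolding norm_scaleR by (simp add: pos_le_divide_eq mult.commute)
        then show "(?far n R)
            \<subseteq> ?bad n (R / sqrt n)"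
          by (simp only: not_le[symmetric]) blast
      qed
      with elim(1) show ?case by simp
    qed
    then show "\<exists>R. \<forall>\<^sub>F n in sequentially.
        measure (law n) (?far n R) \<le> e" ..
  qed
  ultimately show ?thesis unfolding \<beta>_def ..
qed

end
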